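(* Let $d\geq 2$ and let $X$ be a tight spherical $5$-design in the unit sphere $\mathbf{S}^{d-1}\subset\mathbb{R}^d$ that contains a set $\Gamma$ of $d$ points such that the pairwise inner products of points in $\Gamma$ are positive. Then $d=2,3,7$ or $23$ and $X$ is isometric to the set of points of intersection of $\mathbf{S}^{d-1}$ with the lines of the standard set $\Omega_d$ of equiangular lines in $\mathbb{R}^d$ described in the context.
   Context: A spherical $t$-design is a finite set $X\subset\mathbf{S}^{d-1}$ such that $\frac{1}{\mathrm{Vol}(\mathbf{S}^{d-1})}\int_{\mathbf{S}^{d-1}}f(x)\,d\sigma(x)=\frac{1}{|X|}\sum_{u\in X}f(u)$ for every polynomial $f\in\mathbb{R}[x_1,\dots,x_d]$ of degree at most $t$. It is known that $|X|\geq\binom{d+e-1}{d-1}+\binom{d+e-2}{d-1}$ if $t=2e$ and $|X|\geq 2\binom{d+e-1}{d-1}$ if $t=2e+1$; $X$ is tight if equality holds. In particular a spherical $5$-design in $\mathbf{S}^{d-1}$ is tight iff $|X|=d(d+1)$. Isometric means equal up to an orthogonal transformation of $\mathbb{R}^d$. A quasi-symmetric $t$-$(d,k,\lambda;s_1,s_2)$ design is a pair $(\mathcal{P},\mathcal{B})$, $|\mathcal P|=d$, $\mathcal B$ a set of $k$-subsets of $\mathcal P$ (blocks), such that every $t$-subset of $\mathcal P$ lies in exactly $\lambda$ blocks and the set of intersection sizes of distinct blocks is exactly $\{s_1,s_2\}$. Standard sets $\Omega_d$: $\Omega_2$ is the set of $3$ lines through opposite vertices of a regular hexagon in $\mathbb{R}^2$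 centred at the origin; $\Omega_3$ is the set of $6$ lines through opposite vertices of a regular icosahedron in $\mathbb{R}^3$ centred at the origin. For $d=7$ let $(\mathcal{P},\mathcal{B})$ be the $2$-$(7,2,1;1,0)$ design of all $2$-subsets of $\mathcal P=\{1,\dots,7\}$; for $d=23$ let $(\mathcal{P},\mathcal{B})$ be the (unique up to isomorphism) Steiner system $S(4,7,23)$ on $\mathcal P=\{1,\dots,23\}$, which is a quasi-symmetric $4$-$(23,7,1;3,1)$ design. With $k$ the block size and $s_1>s_2$ the intersection numbers, put $\Delta_1=k^2-\frac{d(s_1+s_2)}{2}$ and $\Delta_2=(k-s_1)+\frac{d(s_1-s_2)}{2}$. For $B\in\mathcal{B}$ let $v(B)\in\mathbb{R}^d$ have $j$th entry $d-k+\sqrt{\Delta_1}$ if $j\in B$ and $-k+\sqrt{\Delta_1}$ if $j\notin B$. For $i\in\mathcal{P}$ let $v(i)\in\mathbb{R}^d$ have $j$th entry $(s_1-s_2)(d-1)-\sqrt{\Delta_2}$ if $j=i$ and $-(s_1-s_2)-\sqrt{\Delta_2}$ if $j\ne i$. Then $\Omega_d$ is the set of lines spanned by the vectors $v(B)$ ($B\in\mathcal{B}$) and $v(i)$ ($i\in\mathcal{P}$); it has $28$ lines for $d=7$ and $276$ lines for $d=23$. *)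

theory Defs
  imports "HOL-Analysis.Analysis"
begin

section \<open>Spherical designs\<close>

text \<open>The surface measure \<open>\<sigma>\<close> of the unit sphere, as the cone measure: the area of a
  Borel set \<open>A\<close> is the dimension times the volume of the part of the unit ball that projects
  radially into \<open>A\<close>. It is a measure on the Borel sets of the whole space which is
  concentrated on the sphere.\<close>

definition sphere_measure :: "'a::euclidean_space measure" where
  "sphere_measure =
     scale_measure (of_nat DIM('a)) (distr (restrict_space lborel (ball 0 1)) borel sgn)"

lemma borel_measurable_sgn_vector: "(sgn :: 'a::euclidean_space \<Rightarrow> 'a) \<in> borel_measurable borel"
  unfolding sgn_div_norm by measurable

lemma emeasure_sphere_measure:
  fixes A :: "'a::euclidean_space set"
  assumes "A \<in> sets borel"
  shows "emeasure sphere_measure A = of_nat DIM('a) * emeasure lborel {x \<in> ball 0 1. sgn x \<in> A}"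
proof -
  have m: "sgn \<in> measurable (restrict_space lborel (ball (0::'a) 1)) borel"
    by (intro measurable_restrict_space1) (simp add: borel_measurable_sgn_vector)
  have "sgn -` A \<inter> space (restrict_space lborel (ball (0::'a) 1)) = {x \<in> ball 0 1. sgn x \<in> A}"
    by (auto simp: space_restrict_space)
  then show ?thesis
    using assms m by (simp add: sphere_measure_def emeasure_distr emeasure_restrict_space subset_iff)
qed

text \<open>Polynomial functions in the coordinates, of total degree at most \<open>t\<close>; the sum is over
  the multi-indices \<open>a\<close>, of which there are only finitely many.\<close>

definition poly_of_degree_le :: "nat \<Rightarrow> (real^'n \<Rightarrow> real) \<Rightarrow> bool" where
  "poly_of_degree_le t f \<longleftrightarrow>
     (\<exists>c :: ('n \<Rightarrow> nat) \<Rightarrow> real. \<forall>x.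
        f x = (\<Sum>a | (\<Sum>i\<in>UNIV. a i) \<le> t. c a * (\<Prod>i\<in>UNIV. (x $ i) ^ a i)))"

lemma finite_multi_indices: "finite {a :: 'n::finite \<Rightarrow> nat. (\<Sum>i\<in>UNIV. a i) \<le> t}"
proof (rule finite_subset)
  show "{a :: 'n \<Rightarrow> nat. (\<Sum>i\<in>UNIV. a i) \<le> t} \<subseteq> (\<Pi>\<^sub>E i\<in>UNIV. {..t})"
    by (auto intro: order_trans[OF member_le_sum])
  show "finite (\<Pi>\<^sub>E i\<in>(UNIV :: 'n set). {..t})"
    by (rule finite_PiE) auto
qed

definition spherical_design :: "nat \<Rightarrow> (real^'n) set \<Rightarrow> bool" where
  "spherical_design t X \<longleftrightarrow>
     finite X \<and> X \<subseteq> sphere 0 1 \<and>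
     (\<forall>f. poly_of_degree_le t f \<longrightarrow>
        1 / measure sphere_measure (sphere (0 :: real^'n) 1) * (LINT x:sphere 0 1|sphere_measure. f x)
          = 1 / real (card X) * (\<Sum>u\<in>X. f u))"

definition tight_spherical_design :: "nat \<Rightarrow> (real^'n) set \<Rightarrow> bool" where
  "tight_spherical_design t X \<longleftrightarrow>
     spherical_design t X \<and>
     (let d = CARD('n); e = t div 2 in
      card X = (if even t then (d + e - 1 choose (d - 1)) + (d + e - 2 choose (d - 1))
                else 2 * (d + e - 1 choose (d - 1))))"

lemma tight_spherical_5_design_iff:
  fixes X :: "(real^'n) set"
  shows "tight_spherical_design 5 X \<longleftrightarrow>
    spherical_design 5 X \<and> card X = CARD('n) * (CARD('n) + 1)"
proof -
  have "2 * (CARD('n) + 1 choose (CARD('n) - 1)) = CARD('n) * (CARD('n) + 1)"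
  proof -
    have "(CARD('n) + 1 choose (CARD('n) - 1)) = (CARD('n) + 1 choose 2)"
      using binomial_symmetric[of 2 "CARD('n) + 1"] zero_less_card_finite[where 'a='n]
      by (simp add: numeral_2_eq_2)
    then show ?thesis
      by (simp add: choose_two)
  qed
  then show ?thesis
    by (simp add: tight_spherical_design_def Let_def)
qed

definition isometric_sets :: "(real^'n) set \<Rightarrow> (real^'n) set \<Rightarrow> bool" where
  "isometric_sets X Y \<longleftrightarrow> (\<exists>f. orthogonal_transformation f \<and> f ` X = Y)"


section \<open>The standard sets of equiangular lines\<close>

text \<open>The vertex set of a regular hexagon centred at the origin, of any size and orientation.\<close>

definition regular_hexagon :: "(real^'n) set \<Rightarrow> bool" where
  "regular_hexagon H \<longleftrightarrow>
     (\<exists>r u v. 0 < r \<and> norm u = 1 \<and> norm v = 1 \<and> u \<bullet> v = 0 \<and>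
        H = {r *\<^sub>R (cos (real j * pi / 3) *\<^sub>R u + sin (real j * pi / 3) *\<^sub>R v) | j::nat. j < 6})"

text \<open>The vertex set of a regular icosahedron centred at the origin: in an orthonormal frame
  the vertices are, up to scale, the cyclic permutations of \<open>(0, \<plusminus>1, \<plusminus>\<phi>)\<close> with
  \<open>\<phi>\<close> the golden ratio.\<close>

definition regular_icosahedron :: "(real^'n) set \<Rightarrow> bool" where
  "regular_icosahedron H \<longleftrightarrow>
     (\<exists>r u v w. 0 < r \<and> norm u = 1 \<and> norm v = 1 \<and> norm w = 1 \<and>
        u \<bullet> v = 0 \<and> v \<bullet> w = 0 \<and> w \<bullet> u = 0 \<and>
        H = {r *\<^sub>R (a *\<^sub>R x + (b * ((1 + sqrt 5) / 2)) *\<^sub>R y) | a b x y.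
               a \<in> {1, -1} \<and> b \<in> {1, -1} \<and> (x, y) \<in> {(v, w), (w, u), (u, v)}})"

definition quasi_symmetric_design ::
  "nat \<Rightarrow> nat \<Rightarrow> nat \<Rightarrow> nat \<Rightarrow> nat \<Rightarrow> nat \<Rightarrow> 'a set \<Rightarrow> 'a set set \<Rightarrow> bool" where
  "quasi_symmetric_design t d k l s1 s2 P \<B> \<longleftrightarrow>
     finite P \<and> card P = d \<and>
     (\<forall>B\<in>\<B>. B \<subseteq> P \<and> card B = k) \<and>
     (\<forall>T. T \<subseteq> P \<and> card T = t \<longrightarrow> card {B \<in> \<B>. T \<subseteq> B} = l) \<and>
     {card (B \<inter> C) | B C. B \<in> \<B> \<and> C \<in> \<B> \<and> B \<noteq> C} = {s1, s2}"

definition block_vector :: "nat \<Rightarrow> nat \<Rightarrow> nat \<Rightarrow> 'n set \<Rightarrow> real^'n" where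
  "block_vector k s1 s2 B =
     (let d = real CARD('n); D1 = (real k)^2 - d * (real s1 + real s2) / 2
      in \<chi> j. if j \<in> B then d - real k + sqrt D1 else - real k + sqrt D1)"

definition point_vector :: "nat \<Rightarrow> nat \<Rightarrow> nat \<Rightarrow> 'n \<Rightarrow> real^'n" where
  "point_vector k s1 s2 i =
     (let d = real CARD('n); s = real s1 - real s2; D2 = (real k - real s1) + d * s / 2
      in \<chi> j. if j = i then s * (d - 1) - sqrt D2 else - s - sqrt D2)"

definition design_lines :: "nat \<Rightarrow> nat \<Rightarrow> nat \<Rightarrow> 'n set set \<Rightarrow> (real^'n) set set" where
  "design_lines k s1 s2 \<B> =
     (\<lambda>B. span {block_vector k s1 s2 B}) ` \<B> \<union> range (\<lambda>i. span {point_vector k s1 s2 i})"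

text \<open>\<open>standard_line_set \<Omega>\<close> says that \<open>\<Omega>\<close> is a realization of the standard set
  \<open>\<Omega>\<^sub>d\<close>, with the index type serving as the point set of the design. The standard set is
  determined only up to the choice of the hexagon, of the icosahedron, and of the representative
  of the isomorphism class of \<open>S(4,7,23)\<close>. The line through a vertex \<open>x\<close> of the hexagon or
  the icosahedron and the opposite vertex \<open>-x\<close> is \<open>span {x}\<close>. The Steiner system
  \<open>S(4,7,23)\<close> is a 4-(23,7,1) design, and its intersection numbers are 3 and 1.\<close>

definition standard_line_set :: "(real^'n) set set \<Rightarrow> bool" where
  "standard_line_set \<Omega> \<longleftrightarrow>
     CARD('n) = 2 \<and> (\<exists>H. regular_hexagon H \<and> \<Omega> = (\<lambda>x. span {x}) ` H) \<or>
     CARD('n) = 3 \<and> (\<exists>H. regular_icosahedron H \<and> \<Omega> = (\<lambda>x. span {x}) ` H) \<or>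
     CARD('n) = 7 \<and> \<Omega> = design_lines 2 1 0 {B. card B = 2} \<or>
     CARD('n) = 23 \<and>
       (\<exists>\<B>. quasi_symmetric_design 4 23 7 1 3 1 UNIV \<B> \<and> \<Omega> = design_lines 7 3 1 \<B>)"

end

theory Submission
  imports Defs
begin

text \<open>
  The average over a design of a power \<open>(u \<bullet> x)\<^sup>k\<close> is an integral over the sphere, hence depends only on
  the norm of \<open>x\<close>; this determines all moments up to degree 5 without computing an integral.
  Tightness forces the inner products \<open>\<plusminus>1/\<beta>\<close> with \<open>\<beta>\<^sup>2 = d + 2\<close> between non-proportional points, so \<open>\<Gamma>\<close> is a
  basis with a known Gram matrix and every other point \<open>u\<close> is given by the signs of its inner
  products with \<open>\<Gamma>\<close>. The norm of \<open>u\<close> fixes the square of the sum \<open>m\<close> of these signs as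
  \<open>m\<^sup>2 = (\<beta> - 2)(\<beta>\<^sup>2 + \<beta> - 3)\<close>, so \<open>\<beta>\<close> is an integer if \<open>d \<ge> 4\<close>, and a fourth moment gives an integer
  \<open>K\<close> with \<open>m K = (\<beta>\<^sup>2 + \<beta> - 3)(\<beta>\<^sup>2 - 6 \<beta> + 7)\<close>. Squaring shows that \<open>\<beta> - 2\<close> divides 3, whence \<open>d = 7\<close> or
  \<open>d = 23\<close>. The sets of positive signs (one from each antipodal pair) are all singletons for
  \<open>d \<le> 3\<close>, all pairs for \<open>d = 7\<close>, and a Steiner system \<open>S(4,7,23)\<close> for \<open>d = 23\<close>; together with the Gram matrix
  they determine \<open>X\<close> up to isometry.

  For \<open>d = 23\<close> this leaves the uniqueness of \<open>S(4,7,23)\<close>. The complement \<open>D\<close> of the symmetric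
  difference of two blocks that meet in one point has 11 points, and for a point \<open>e\<close> outside \<open>D\<close>
  there is exactly one block through \<open>e\<close> that meets \<open>D\<close> in a given point only. These 11 blocks induce a
  \<open>2-(11,5,2)\<close> biplane on the other points outside \<open>D\<close>; it is unique because the points off one of its
  blocks are six pentagons on that block, pairwise with two common edges, and one pentagon
  determines the other five. The 11 blocks and the complement of \<open>D\<close> span the binary code of the
  design, and the blocks are recovered as the words of weight 7 in that code.\<close>

section \<open>Moments of spherical designs\<close>

lemma borel_measurable_orthogonal_transformation:
  fixes f :: "'a::euclidean_space \<Rightarrow> 'a"
  assumes "orthogonal_transformation f"
  shows "f \<in> borel_measurable borel"
  using assms linear_continuous_on linear_conv_bounded_linear orthogonal_transformation_linear
  by (intro borel_measurable_continuous_onI) blast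

text \<open>By the Vitali covering theorem an open set is a disjoint union of balls up to a null set, and
  balls are mapped to balls. (The library has the invariance of Lebesgue measure under orthogonal
  maps only for index types with a well-order.)\<close>

lemma emeasure_lborel_orthogonal_vimage_open:
  fixes f :: "'a::euclidean_space \<Rightarrow> 'a"
  assumes f: "orthogonal_transformation f" and U: "open U"
  shows "emeasure lborel (f -` U) = emeasure lborel U"
proof -
  \<comment> \<open>\<open>K\<close> lists the closed balls inside \<open>U\<close> by centre and
    radius; they cover each point of \<open>U\<close> at arbitrarily small scale, as the Vitali
    theorem demands.\<close>
  define K where "K = {(a, r). 0 < r \<and> cball a r \<subseteq> U}"
  have cov: "\<exists>i. i \<in> K \<and> x \<in> cball (fst i) (snd i) \<and> snd i < d" if x: "x \<in> U" and d: "0 < d" for x d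
  proof -
    obtain e where e: "0 < e" "cball x e \<subseteq> U"
      using U x open_contains_cball by blast
    have "cball x (min e (d / 2)) \<subseteq> cball x e"
      by (rule subset_cball) simp
    then show ?thesis
      using e d by (intro exI[of _ "(x, min e (d / 2))"]) (auto simp: K_def)
  qed
  have "0 < snd i" if "i \<in> K" for i
    using that by (auto simp: K_def)
  from Vitali_covering_theorem_cballs[OF this cov]
  obtain C where C: "countable C" "C \<subseteq> K"
    and disj: "pairwise (\<lambda>i j. disjnt (cball (fst i) (snd i)) (cball (fst j) (snd j))) C"
    and neg: "negligible (U - (\<Union>i\<in>C. cball (fst i) (snd i)))"
    by blast
  define N where "N = U - (\<Union>i\<in>C. cball (fst i) (snd i))"
  let ?g = "inv f"
  have g: "orthogonal_transformation ?g"
    using f by (rule orthogonal_transformation_inv)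
  have bij: "bij f"
    using f by (rule orthogonal_transformation_bij)
  have vim: "f -` S = ?g ` S" for S
    using bij by (simp add: bij_vimage_eq_inv_image)
  have vcball: "f -` cball a r = cball (?g a) r" for a r
    using g by (simp add: vim image_orthogonal_transformation_cball)
  have Nb: "N \<in> sets borel"
    unfolding N_def using U C(1) by (intro sets.Diff sets.countable_UN' ) auto
  have fb: "f \<in> borel_measurable borel"
    using f by (rule borel_measurable_orthogonal_transformation)
  have fNb: "f -` N \<in> sets borel"
    using measurable_sets[OF fb Nb] by simp
  have N0: "N \<in> null_sets lborel"
    using neg Nb unfolding N_def[symmetric]
    by (simp add: negligible_iff_null_sets null_sets_completion_iff)
  \<comment> \<open>Linear maps send null sets to null sets, so the uncovered remainder is
    negligible on both sides.\<close>
  have fN0: "f -` N \<in> null_sets lborel"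
  proof -
    have "negligible (?g ` N)"
      using neg unfolding N_def[symmetric]
      by (intro negligible_differentiable_image_negligible linear_imp_differentiable_on
          orthogonal_transformation_linear[OF g]) simp_all
    then show ?thesis
      using fNb by (simp add: vim[symmetric] negligible_iff_null_sets null_sets_completion_iff)
  qed
  have eqU: "U = (\<Union>i\<in>C. cball (fst i) (snd i)) \<union> N"
    using C(2) by (fastforce simp: N_def K_def)
  have dj: "disjoint_family_on (\<lambda>i. cball (fst i) (snd i)) C"
    using disj by (auto simp: disjoint_family_on_def pairwise_def disjnt_def)
  then have djv: "disjoint_family_on (\<lambda>i. f -` cball (fst i) (snd i)) C"
    unfolding disjoint_family_on_def by (metis vimage_Int vimage_empty)
  have UN: "emeasure lborel ((\<Union>i\<in>C. A i) \<union> M) = (\<integral>\<^sup>+i. emeasure lborel (A i) \<partial>count_space C)"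
    if A: "\<And>i. i \<in> C \<Longrightarrow> A i \<in> sets lborel" "disjoint_family_on A C" and M: "M \<in> null_sets lborel"
    for A :: "'a \<times> real \<Rightarrow> 'a set" and M
  proof -
    have "(\<Union>i\<in>C. A i) \<in> sets lborel"
      using C(1) A(1) by (rule sets.countable_UN'')
    then have "emeasure lborel ((\<Union>i\<in>C. A i) \<union> M) = emeasure lborel (\<Union>i\<in>C. A i)"
      using M by (rule emeasure_Un_null_set)
    also have "\<dots> = (\<integral>\<^sup>+i. emeasure lborel (A i) \<partial>count_space C)"
      using A(1) C(1) A(2) by (rule emeasure_UN_countable)
    finally show ?thesis .
  qed
  have "f -` U = (\<Union>i\<in>C. f -` cball (fst i) (snd i)) \<union> f -` N"
    by (subst eqU) (simp only: vimage_Un vimage_UN)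
  then have "emeasure lborel (f -` U) = (\<integral>\<^sup>+i. emeasure lborel (f -` cball (fst i) (snd i)) \<partial>count_space C)"
    using UN[OF _ djv fN0] by (simp add: vcball)
  also have "\<dots> = (\<integral>\<^sup>+i. emeasure lborel (cball (fst i) (snd i)) \<partial>count_space C)"
  proof (rule nn_integral_cong)
    fix i assume "i \<in> space (count_space C)"
    then have "0 < snd i"
      using C(2) by (auto simp: K_def)
    then show "emeasure lborel (f -` cball (fst i) (snd i)) = emeasure lborel (cball (fst i) (snd i))"
      by (simp add: vcball emeasure_cball)
  qed
  also have "\<dots> = emeasure lborel U"
    using UN[OF _ dj N0] by (simp flip: eqU)
  finally show ?thesis .
qed

text \<open>Lebesgue measure is determined by its values on open boxes, so the case of open sets
  suffices.\<close>

lemma distr_lborel_orthogonal: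
  fixes f :: "'a::euclidean_space \<Rightarrow> 'a"
  assumes f: "orthogonal_transformation f"
  shows "distr lborel borel f = lborel"
proof -
  have fb: "f \<in> borel_measurable borel"
    using f by (rule borel_measurable_orthogonal_transformation)
  show ?thesis
  proof (rule lborel_eqI[symmetric])
    fix l u :: 'a
    assume lu: "\<And>b. b \<in> Basis \<Longrightarrow> l \<bullet> b \<le> u \<bullet> b"
    have "emeasure (distr lborel borel f) (box l u) = emeasure lborel (f -` box l u)"
      using fb by (subst emeasure_distr) auto
    also have "\<dots> = emeasure lborel (box l u)"
      by (rule emeasure_lborel_orthogonal_vimage_open[OF f open_box])
    finally show "emeasure (distr lborel borel f) (box l u) = (\<Prod>b\<in>Basis. (u - l) \<bullet> b)"
      using lu by (simp add: emeasure_lborel_box)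
  qed simp
qed

text \<open>\<open>sgn\<close> commutes with orthogonal maps and the unit ball is preserved, so the
  cone over a preimage is the preimage of the cone.\<close>

lemma distr_sphere_measure_orthogonal:
  fixes f :: "'a::euclidean_space \<Rightarrow> 'a"
  assumes f: "orthogonal_transformation f"
  shows "distr sphere_measure borel f = sphere_measure"
proof (rule measure_eqI)
  have lin: "linear f"
    using f by (rule orthogonal_transformation_linear)
  have fb: "f \<in> borel_measurable borel"
    using f by (rule borel_measurable_orthogonal_transformation)
  have sets: "sets sphere_measure = sets (borel :: 'a measure)"
    by (simp add: sphere_measure_def)
  show "sets (distr sphere_measure borel f) = sets sphere_measure"
    by (simp add: sets)
  fix A assume "A \<in> sets (distr sphere_measure borel f)"
  then have A: "A \<in> sets borel"
    by simp
  have A': "f -` A \<in> sets borel"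
    using measurable_sets[OF fb A] by simp
  have B: "{x \<in> ball 0 1. sgn x \<in> A} \<in> sets borel"
    using measurable_sets[OF borel_measurable_sgn_vector A]
    by (simp add: vimage_def Collect_conj_eq)
  have sgnf: "sgn (f x) = f (sgn x)" and normf: "norm (f x) = norm x" for x
    using f by (simp_all add: sgn_div_norm orthogonal_transformation_norm orthogonal_transformation_scaleR)
  have fsm: "f \<in> measurable sphere_measure borel"
    using fb by (simp add: measurable_def sets sets_eq_imp_space_eq[OF sets])
  have "emeasure (distr sphere_measure borel f) A = emeasure sphere_measure (f -` A)"
    using A fsm by (subst emeasure_distr) (auto simp: sets_eq_imp_space_eq[OF sets])
  also have "\<dots> = of_nat DIM('a) * emeasure lborel {x \<in> ball 0 1. sgn x \<in> f -` A}"
    by (rule emeasure_sphere_measure[OF A'])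
  also have "{x \<in> ball 0 1. sgn x \<in> f -` A} = f -` {x \<in> ball 0 1. sgn x \<in> A}"
    by (auto simp: sgnf normf)
  also have "emeasure lborel \<dots> = emeasure (distr lborel borel f) {x \<in> ball 0 1. sgn x \<in> A}"
    using fb B by (subst emeasure_distr) auto
  also have "\<dots> = emeasure lborel {x \<in> ball 0 1. sgn x \<in> A}"
    by (simp add: distr_lborel_orthogonal[OF f])
  also have "of_nat DIM('a) * \<dots> = emeasure sphere_measure A"
    by (rule emeasure_sphere_measure[OF A, symmetric])
  finally show "emeasure (distr sphere_measure borel f) A = emeasure sphere_measure A" .
qed

lemma sphere_integral_orthogonal:
  fixes f :: "'a::euclidean_space \<Rightarrow> 'a" and h :: "'a \<Rightarrow> real"
  assumes f: "orthogonal_transformation f" and h: "h \<in> borel_measurable borel"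
  shows "(LINT x:sphere 0 1|sphere_measure. h (f x)) = (LINT x:sphere 0 1|sphere_measure. h x)"
proof -
  have fb: "f \<in> borel_measurable borel"
    using f by (rule borel_measurable_orthogonal_transformation)
  have sets: "sets sphere_measure = sets (borel :: 'a measure)"
    by (simp add: sphere_measure_def)
  have fsm: "f \<in> measurable sphere_measure borel"
    using fb by (simp add: measurable_def sets sets_eq_imp_space_eq[OF sets])
  let ?k = "\<lambda>x. indicator (sphere 0 1) x *\<^sub>R h x"
  have "(LINT x:sphere 0 1|sphere_measure. h x) = (LINT x|distr sphere_measure borel f. ?k x)"
    by (simp add: set_lebesgue_integral_def distr_sphere_measure_orthogonal[OF f])
  also have "\<dots> = (LINT x|sphere_measure. ?k (f x))"
    using h by (intro integral_distr[OF fsm]) (intro borel_measurable_scaleR borel_measurable_indicator borel_closed closed_sphere)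
  also have "\<dots> = (LINT x:sphere 0 1|sphere_measure. h (f x))"
    using f by (simp add: set_lebesgue_integral_def indicator_def orthogonal_transformation_norm)
  finally show ?thesis ..
qed

section \<open>Polynomial functions of bounded total degree\<close>

lemma poly_of_degree_le_monomial:
  assumes "(\<Sum>i\<in>UNIV. b i) \<le> t"
  shows "poly_of_degree_le t (\<lambda>x::real^'n. c * (\<Prod>i\<in>UNIV. (x $ i) ^ b i))"
proof -
  have "(\<Sum>a | (\<Sum>i\<in>UNIV. a i) \<le> t. (if a = b then c else 0) * (\<Prod>i\<in>UNIV. (x $ i) ^ a i)) =
      c * (\<Prod>i\<in>UNIV. (x $ i) ^ b i)" for x :: "real^'n"
  proof -
    have "(\<Sum>a | (\<Sum>i\<in>UNIV. a i) \<le> t. (if a = b then c else 0) * (\<Prod>i\<in>UNIV. (x $ i) ^ a i)) =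
        (\<Sum>a | (\<Sum>i\<in>UNIV. a i) \<le> t. if a = b then c * (\<Prod>i\<in>UNIV. (x $ i) ^ b i) else 0)"
      by (intro sum.cong) auto
    then show ?thesis
      using assms by (simp add: finite_multi_indices)
  qed
  then show ?thesis
    unfolding poly_of_degree_le_def by (intro exI[of _ "\<lambda>a. if a = b then c else 0"]) simp
qed

lemma poly_of_degree_le_add:
  assumes "poly_of_degree_le t f" "poly_of_degree_le t g"
  shows "poly_of_degree_le t (\<lambda>x. f x + g x)"
proof -
  obtain c where "\<And>x. f x = (\<Sum>a | (\<Sum>i\<in>UNIV. a i) \<le> t. c a * (\<Prod>i\<in>UNIV. (x $ i) ^ a i))"
    using assms(1) unfolding poly_of_degree_le_def by blast
  moreover obtain c' where "\<And>x. g x = (\<Sum>a | (\<Sum>i\<in>UNIV. a i) \<le> t. c' a * (\<Prod>i\<in>UNIV. (x $ i) ^ a i))"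
    using assms(2) unfolding poly_of_degree_le_def by blast
  ultimately show ?thesis
    unfolding poly_of_degree_le_def
    by (intro exI[of _ "\<lambda>a. c a + c' a"]) (simp add: sum.distrib distrib_right)
qed

lemma poly_of_degree_le_sum:
  assumes "finite I" "\<And>i. i \<in> I \<Longrightarrow> poly_of_degree_le t (f i)"
  shows "poly_of_degree_le t (\<lambda>x. \<Sum>i\<in>I. f i x)"
  using assms
proof (induction I rule: finite_induct)
  case empty
  show ?case
    unfolding poly_of_degree_le_def by (rule exI[of _ "\<lambda>_. 0"]) simp
qed (simp add: poly_of_degree_le_add)

text \<open>Multiplying out gives a double sum of monomials whose multi-indices add.\<close>

lemma poly_of_degree_le_mult:
  fixes f g :: "real^'n \<Rightarrow> real"
  assumes "poly_of_degree_le s f" "poly_of_degree_le t g"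
  shows "poly_of_degree_le (s + t) (\<lambda>x. f x * g x)"
proof -
  obtain c where f: "\<And>x. f x = (\<Sum>a | (\<Sum>i\<in>UNIV. a i) \<le> s. c a * (\<Prod>i\<in>UNIV. (x $ i) ^ a i))"
    using assms(1) unfolding poly_of_degree_le_def by blast
  obtain c' where g: "\<And>x. g x = (\<Sum>a | (\<Sum>i\<in>UNIV. a i) \<le> t. c' a * (\<Prod>i\<in>UNIV. (x $ i) ^ a i))"
    using assms(2) unfolding poly_of_degree_le_def by blast
  have "(\<lambda>x :: real^'n. f x * g x) = (\<lambda>x. \<Sum>a | (\<Sum>i\<in>UNIV. a i) \<le> s. \<Sum>b | (\<Sum>i\<in>UNIV. b i) \<le> t.
      (c a * c' b) * (\<Prod>i\<in>UNIV. (x $ i) ^ (a i + b i)))"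
    unfolding f g sum_product power_add prod.distrib by (simp only: mult_ac)
  moreover have "poly_of_degree_le (s + t) (\<lambda>x :: real^'n. \<Sum>a | (\<Sum>i\<in>UNIV. a i) \<le> s. \<Sum>b | (\<Sum>i\<in>UNIV. b i) \<le> t.
      (c a * c' b) * (\<Prod>i\<in>UNIV. (x $ i) ^ (a i + b i)))"
    by (intro poly_of_degree_le_sum finite_multi_indices poly_of_degree_le_monomial)
      (simp add: sum.distrib add_mono)
  ultimately show ?thesis
    by simp
qed

lemma poly_of_degree_le_inner: "poly_of_degree_le 1 (\<lambda>u. u \<bullet> x)" for x :: "real^'n"
proof -
  have "poly_of_degree_le 1 (\<lambda>u :: real^'n. x $ i * (\<Prod>j\<in>UNIV. (u $ j) ^ (if j = i then 1 else 0)))" for i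
    by (rule poly_of_degree_le_monomial) simp
  moreover have "(\<Prod>j\<in>UNIV. (u $ j) ^ (if j = i then 1 else 0)) = u $ i" for i and u :: "real^'n"
    by (simp add: if_distrib prod.delta cong: if_cong)
  ultimately have "poly_of_degree_le 1 (\<lambda>u :: real^'n. \<Sum>i\<in>UNIV. x $ i * u $ i)"
    by (intro poly_of_degree_le_sum) simp_all
  then show ?thesis
    by (simp add: inner_vec_def mult.commute)
qed

lemma poly_of_degree_le_mono:
  assumes "poly_of_degree_le s f" "s \<le> t"
  shows "poly_of_degree_le t f"
proof -
  have "poly_of_degree_le (t - s) (\<lambda>x::real^'n. 1)"
    using poly_of_degree_le_monomial[of "\<lambda>_. 0" "t - s" 1] by simp
  from poly_of_degree_le_mult[OF assms(1) this] show ?thesis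
    using assms(2) by simp
qed

text \<open>Powers of linear forms are the only test functions to which the design property is
  applied below.\<close>

lemma poly_of_degree_le_inner_power:
  assumes "k \<le> t"
  shows "poly_of_degree_le t (\<lambda>u :: real^'n. (u \<bullet> x) ^ k)"
proof -
  have "poly_of_degree_le k (\<lambda>u :: real^'n. (u \<bullet> x) ^ k)"
  proof (induction k)
    case 0
    show ?case
      using poly_of_degree_le_monomial[of "\<lambda>_. 0" 0 1] by simp
  next
    case (Suc k)
    show ?case
      using poly_of_degree_le_mult[OF poly_of_degree_le_inner Suc.IH] by simp
  qed
  then show ?thesis
    using assms by (rule poly_of_degree_le_mono)
qed

text \<open>Moving \<open>f\<close> to the other factor replaces \<open>u\<close> by its image under
  the inverse of \<open>f\<close>. The two spherical averages agree by rotation invariance, and the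
  design turns each into a sum over \<open>X\<close>.\<close>

lemma spherical_design_power_sum_orthogonal:
  fixes X :: "(real^'n) set"
  assumes X: "spherical_design t X" and k: "k \<le> t" and f: "orthogonal_transformation f"
  shows "(\<Sum>u\<in>X. (u \<bullet> f x) ^ k) = (\<Sum>u\<in>X. (u \<bullet> x) ^ k)"
proof (cases "X = {}")
  case False
  then have "card X \<noteq> 0"
    using X by (simp add: spherical_design_def)
  define g where "g = inv f"
  have g: "orthogonal_transformation g"
    unfolding g_def using f by (rule orthogonal_transformation_inv)
  have gf: "u \<bullet> f x = g u \<bullet> x" for u
  proof -
    have "f (g u) = u"
      using orthogonal_transformation_surj[OF f] by (simp add: g_def surj_f_inv_f)
    moreover have "f (g u) \<bullet> f x = g u \<bullet> x"
      using f by (simp add: orthogonal_transformation_def)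
    ultimately show ?thesis
      by simp
  qed
  let ?I = "\<lambda>h. 1 / measure sphere_measure (sphere (0 :: real^'n) 1) * (LINT x:sphere 0 1|sphere_measure. h x)"
  have "?I (\<lambda>u. (u \<bullet> f x) ^ k) = ?I (\<lambda>u. (u \<bullet> x) ^ k)"
    unfolding gf by (subst sphere_integral_orthogonal[OF g, of "\<lambda>u. (u \<bullet> x) ^ k"]) simp_all
  moreover have avg: "?I (\<lambda>u. (u \<bullet> y) ^ k) = 1 / real (card X) * (\<Sum>u\<in>X. (u \<bullet> y) ^ k)" for y
    using X poly_of_degree_le_inner_power[OF k] unfolding spherical_design_def by blast
  ultimately have "1 / real (card X) * (\<Sum>u\<in>X. (u \<bullet> f x) ^ k) = 1 / real (card X) * (\<Sum>u\<in>X. (u \<bullet> x) ^ k)"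
    by (simp only: avg)
  then show ?thesis
    using \<open>card X \<noteq> 0\<close> by simp
qed simp

text \<open>Orthogonal maps act transitively on the vectors of a given norm.\<close>

lemma spherical_design_power_sum_norm:
  fixes X :: "(real^'n) set"
  assumes "spherical_design t X" "k \<le> t" "norm x = norm y"
  shows "(\<Sum>u\<in>X. (u \<bullet> x) ^ k) = (\<Sum>u\<in>X. (u \<bullet> y) ^ k)"
proof -
  obtain f where "orthogonal_transformation f" "f y = x"
    using orthogonal_transformation_exists[of y x] assms(3) by metis
  then show ?thesis
    using spherical_design_power_sum_orthogonal[OF assms(1,2)] by metis
qed

text \<open>\<open>x\<close> and \<open>- x\<close> have the same norm, and an odd power changes
  sign between them.\<close>

lemma spherical_design_odd_power_sum:
  fixes X :: "(real^'n) set"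
  assumes "spherical_design t X" "k \<le> t" "odd k"
  shows "(\<Sum>u\<in>X. (u \<bullet> x) ^ k) = 0"
proof -
  have "(\<Sum>u\<in>X. (u \<bullet> - x) ^ k) = (\<Sum>u\<in>X. (u \<bullet> x) ^ k)"
    by (rule spherical_design_power_sum_norm[OF assms(1,2)]) simp
  then show ?thesis
    using assms(3) by (simp add: sum_negf)
qed

lemma sum_Basis_inner_power2: "(\<Sum>b\<in>Basis. (x \<bullet> b)\<^sup>2) = (norm x)\<^sup>2"
proof -
  have "(norm x)\<^sup>2 = (\<Sum>b\<in>Basis. (x \<bullet> b) * (x \<bullet> b))"
    unfolding power2_norm_eq_inner by (rule euclidean_inner)
  then show ?thesis
    by (simp add: power2_eq_square)
qed

text \<open>The fourth power sum is a constant times the fourth power of the norm. Polarization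
  yields the mixed moment, summation over an orthonormal basis lowers the order to two, and a second
  such summation determines the constant from \<open>card X\<close>.\<close>

lemma spherical_design_moments:
  fixes X :: "(real^'n) set"
  assumes X: "spherical_design t X" and t: "4 \<le> t"
  defines "c \<equiv> real (card X) / (real CARD('n) * (real CARD('n) + 2))"
  shows spherical_design_moment2: "(\<Sum>u\<in>X. (u \<bullet> y)\<^sup>2) = real (card X) / real CARD('n) * (norm y)\<^sup>2" (is ?m2)
    and spherical_design_moment22:
      "(\<Sum>u\<in>X. (u \<bullet> x)\<^sup>2 * (u \<bullet> y)\<^sup>2) = c * ((norm x)\<^sup>2 * (norm y)\<^sup>2 + 2 * (x \<bullet> y)\<^sup>2)" (is ?m22)
proof -
  let ?d = "real CARD('n)"
  obtain b :: "real^'n" where b: "norm b = 1"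
    using vector_choose_size[of 1] by auto
  \<comment> \<open>The divisor \<open>3\<close> makes \<open>C\<close> the constant of the mixed
    moment: for \<open>x = y\<close> of norm one the bracket there equals \<open>3\<close>.\<close>
  define C where "C = (\<Sum>u\<in>X. (u \<bullet> b) ^ 4) / 3"
  have q: "(\<Sum>u\<in>X. (u \<bullet> x) ^ 4) = 3 * C * (norm x) ^ 4" for x
  proof -
    have "(\<Sum>u\<in>X. (u \<bullet> x) ^ 4) = (\<Sum>u\<in>X. (u \<bullet> (norm x *\<^sub>R b)) ^ 4)"
      using b by (intro spherical_design_power_sum_norm[OF X]) (use t in auto)
    then show ?thesis
      by (simp add: C_def power_mult_distrib sum_distrib_left mult_ac)
  qed
  have m22: "(\<Sum>u\<in>X. (u \<bullet> x)\<^sup>2 * (u \<bullet> y)\<^sup>2) = C * ((norm x)\<^sup>2 * (norm y)\<^sup>2 + 2 * (x \<bullet> y)\<^sup>2)" for x y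
  proof -
    \<comment> \<open>\<open>(a + b)^4 + (a - b)^4 = 2 a^4 + 12 a^2 b^2 + 2 b^4\<close>, applied to
      each summand.\<close>
    have "(\<Sum>u\<in>X. (u \<bullet> (x + y)) ^ 4) + (\<Sum>u\<in>X. (u \<bullet> (x - y)) ^ 4) =
      2 * (\<Sum>u\<in>X. (u \<bullet> x) ^ 4) + 2 * (\<Sum>u\<in>X. (u \<bullet> y) ^ 4) + 12 * (\<Sum>u\<in>X. (u \<bullet> x)\<^sup>2 * (u \<bullet> y)\<^sup>2)"
      unfolding sum_distrib_left sum.distrib[symmetric]
      by (intro sum.cong refl) (simp add: inner_add_right inner_diff_right, algebra)
    moreover have n4: "norm z ^ 4 = (z \<bullet> z)\<^sup>2" for z :: "real^'n"
      by (simp add: power2_norm_eq_inner[symmetric] flip: power_mult)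
    have "norm (x + y) ^ 4 + norm (x - y) ^ 4 =
        2 * norm x ^ 4 + 2 * norm y ^ 4 + 4 * ((norm x)\<^sup>2 * (norm y)\<^sup>2 + 2 * (x \<bullet> y)\<^sup>2)"
      unfolding n4 power2_norm_eq_inner
      by (simp add: inner_add_left inner_diff_left inner_add_right inner_diff_right inner_commute[of y x], algebra)
    then have "3 * C * (norm (x + y) ^ 4 + norm (x - y) ^ 4) =
        3 * C * (2 * norm x ^ 4 + 2 * norm y ^ 4 + 4 * ((norm x)\<^sup>2 * (norm y)\<^sup>2 + 2 * (x \<bullet> y)\<^sup>2))"
      by simp
    ultimately show ?thesis
      unfolding q by (simp add: algebra_simps)
  qed
  have unit: "norm u = 1" if "u \<in> X" for u
    using that X by (auto simp: spherical_design_def)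
  have m2: "(\<Sum>u\<in>X. (u \<bullet> y)\<^sup>2) = C * (?d + 2) * (norm y)\<^sup>2" for y
  proof -
    \<comment> \<open>The factor one is inserted as the sum of the squared coordinates of the unit
      vector \<open>u\<close>.\<close>
    have "(\<Sum>u\<in>X. (u \<bullet> y)\<^sup>2) = (\<Sum>u\<in>X. \<Sum>b\<in>Basis. (u \<bullet> b)\<^sup>2 * (u \<bullet> y)\<^sup>2)"
      by (intro sum.cong refl) (simp add: unit sum_Basis_inner_power2 flip: sum_distrib_right)
    also have "\<dots> = (\<Sum>b\<in>Basis. \<Sum>u\<in>X. (u \<bullet> b)\<^sup>2 * (u \<bullet> y)\<^sup>2)"
      by (rule sum.swap)
    also have "\<dots> = C * (\<Sum>b\<in>(Basis :: (real^'n) set). (norm y)\<^sup>2 + 2 * (y \<bullet> b)\<^sup>2)"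
      unfolding sum_distrib_left
      by (intro sum.cong refl, subst m22) (simp add: inner_commute)
    also have "\<dots> = C * (?d + 2) * (norm y)\<^sup>2"
      by (simp add: sum.distrib sum_Basis_inner_power2 algebra_simps flip: sum_distrib_left)
    finally show ?thesis .
  qed
  have "real (card X) = (\<Sum>u\<in>X. \<Sum>b\<in>Basis. (u \<bullet> b)\<^sup>2)"
    by (simp add: unit sum_Basis_inner_power2)
  also have "\<dots> = (\<Sum>b\<in>Basis. \<Sum>u\<in>X. (u \<bullet> b)\<^sup>2)"
    by (rule sum.swap)
  also have "\<dots> = C * (?d + 2) * ?d"
    unfolding m2 by simp
  finally have N: "real (card X) = C * (?d + 2) * ?d" .
  have "?d > 0"
    by simp
  then have "C = c"
    unfolding c_def N by (simp add: mult.assoc)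
  then show ?m22
    using m22 by simp
  show ?m2
    using m2 N \<open>?d > 0\<close> by simp
qed

text \<open>Polarization of the mixed moment in each of its two squares.\<close>

lemma spherical_design_moment4:
  fixes X :: "(real^'n) set"
  assumes X: "spherical_design t X" and t: "4 \<le> t"
  shows "(\<Sum>u\<in>X. (u \<bullet> p) * (u \<bullet> q) * (u \<bullet> r) * (u \<bullet> s)) =
    real (card X) / (real CARD('n) * (real CARD('n) + 2)) *
      ((p \<bullet> q) * (r \<bullet> s) + (p \<bullet> r) * (q \<bullet> s) + (p \<bullet> s) * (q \<bullet> r))"
proof -
  define c where "c = real (card X) / (real CARD('n) * (real CARD('n) + 2))"
  note m22 = spherical_design_moment22[OF X t, folded c_def]
  have m: "(\<Sum>u\<in>X. (u \<bullet> p) * (u \<bullet> q) * (u \<bullet> y)\<^sup>2) = c * ((p \<bullet> q) * (y \<bullet> y) + 2 * (p \<bullet> y) * (q \<bullet> y))" for y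
  proof -
    have "4 * (\<Sum>u\<in>X. (u \<bullet> p) * (u \<bullet> q) * (u \<bullet> y)\<^sup>2) =
      (\<Sum>u\<in>X. (u \<bullet> (p + q))\<^sup>2 * (u \<bullet> y)\<^sup>2) - (\<Sum>u\<in>X. (u \<bullet> (p - q))\<^sup>2 * (u \<bullet> y)\<^sup>2)"
      unfolding sum_distrib_left sum_subtractf[symmetric]
      by (intro sum.cong refl) (simp add: inner_add_right inner_diff_right, algebra)
    also have "\<dots> = 4 * (c * ((p \<bullet> q) * (y \<bullet> y) + 2 * (p \<bullet> y) * (q \<bullet> y)))"
      unfolding m22 power2_norm_eq_inner
      by (simp add: inner_add_left inner_diff_left inner_add_right inner_diff_right inner_commute[of q p], algebra)
    finally show ?thesis
      by simp
  qed
  have "4 * (\<Sum>u\<in>X. (u \<bullet> p) * (u \<bullet> q) * (u \<bullet> r) * (u \<bullet> s)) =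
    (\<Sum>u\<in>X. (u \<bullet> p) * (u \<bullet> q) * (u \<bullet> (r + s))\<^sup>2) - (\<Sum>u\<in>X. (u \<bullet> p) * (u \<bullet> q) * (u \<bullet> (r - s))\<^sup>2)"
    unfolding sum_distrib_left sum_subtractf[symmetric]
    by (intro sum.cong refl) (simp add: inner_add_right inner_diff_right, algebra)
  also have "\<dots> = 4 * (c * ((p \<bullet> q) * (r \<bullet> s) + (p \<bullet> r) * (q \<bullet> s) + (p \<bullet> s) * (q \<bullet> r)))"
    unfolding m
    by (simp add: inner_add_left inner_diff_left inner_add_right inner_diff_right inner_commute[of s r], algebra)
  finally show ?thesis
    by (simp add: c_def)
qed

section \<open>Equiangular points\<close>

lemma inner_unit_ge: "norm u = 1 \<Longrightarrow> norm v = 1 \<Longrightarrow> -1 \<le> u \<bullet> v"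
  using Cauchy_Schwarz_ineq2[of u v] by simp

section \<open>Inner products and antipodality in a tight 5-design\<close>

locale tight_5_design =
  fixes X :: "(real^'n) set"
  assumes design: "spherical_design 5 X"
    and card_X: "card X = CARD('n) * (CARD('n) + 1)"
begin

definition d :: real where "d = real CARD('n)"

lemma d_ge_1: "d \<ge> 1"
  by (simp add: d_def Suc_leI)

lemma finite_X: "finite X"
  using design by (simp add: spherical_design_def)

lemma norm_X: "u \<in> X \<Longrightarrow> norm u = 1"
  using design by (auto simp: spherical_design_def)

lemma inner_X_self: "u \<in> X \<Longrightarrow> u \<bullet> u = 1"
  by (simp add: norm_X flip: power2_norm_eq_inner)

lemma card_X_real: "real (card X) = d * (d + 1)"
  by (simp add: card_X d_def algebra_simps)

lemma even_moments:
  assumes "u \<in> X"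
  shows "(\<Sum>v\<in>X. (v \<bullet> u) ^ 2) = d + 1" "(\<Sum>v\<in>X. (v \<bullet> u) ^ 4) = 3 * (d + 1) / (d + 2)"
proof -
  show "(\<Sum>v\<in>X. (v \<bullet> u) ^ 2) = d + 1"
    using spherical_design_moment2[OF design, of u] d_ge_1
    by (simp add: card_X_real norm_X[OF assms] flip: d_def)
  have "(\<Sum>v\<in>X. (v \<bullet> u) ^ 4) = (\<Sum>v\<in>X. (v \<bullet> u)\<^sup>2 * (v \<bullet> u)\<^sup>2)"
    by (simp flip: power_add)
  also have "\<dots> = 3 * (d + 1) / (d + 2)"
    using spherical_design_moment22[OF design, of u u] d_ge_1
    by (simp add: card_X_real norm_X[OF assms] inner_X_self[OF assms] flip: d_def)
  finally show "(\<Sum>v\<in>X. (v \<bullet> u) ^ 4) = 3 * (d + 1) / (d + 2)" .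
qed

text \<open>The value is exactly what two points with inner products \<open>1\<close> and
  \<open>-1\<close> contribute. Tightness enters here, through the number \<open>d (d + 1)\<close>
  of terms.\<close>

lemma sum_quartic:
  assumes "u \<in> X"
  shows "(\<Sum>v\<in>X. ((v \<bullet> u)\<^sup>2 - 1 / (d + 2))\<^sup>2) = 2 * (1 - 1 / (d + 2))\<^sup>2"
proof -
  have "(\<Sum>v\<in>X. ((v \<bullet> u)\<^sup>2 - 1 / (d + 2))\<^sup>2) =
      (\<Sum>v\<in>X. (v \<bullet> u) ^ 4 - 2 / (d + 2) * (v \<bullet> u)\<^sup>2 + (1 / (d + 2))\<^sup>2)"
    by (intro sum.cong refl) algebra
  also have "\<dots> = 3 * (d + 1) / (d + 2) - 2 / (d + 2) * (d + 1) + d * (d + 1) * (1 / (d + 2))\<^sup>2"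
    unfolding sum.distrib sum_subtractf sum_distrib_left[symmetric] even_moments[OF assms]
    by (simp add: card_X_real)
  also have "\<dots> = 2 * (1 - 1 / (d + 2))\<^sup>2"
    using d_ge_1 by (simp add: divide_simps power2_eq_square) algebra
  finally show ?thesis .
qed

text \<open>The summand is an odd polynomial of degree five in the inner product, so every moment in
  its expansion vanishes.\<close>

lemma sum_quintic:
  assumes "u \<in> X"
  shows "(\<Sum>v\<in>X. ((v \<bullet> u)\<^sup>2 - 1 / (d + 2))\<^sup>2 * (v \<bullet> u)) = 0"
proof -
  have "(\<Sum>v\<in>X. ((v \<bullet> u)\<^sup>2 - 1 / (d + 2))\<^sup>2 * (v \<bullet> u)) =
      (\<Sum>v\<in>X. (v \<bullet> u) ^ 5 - 2 / (d + 2) * (v \<bullet> u) ^ 3 + (1 / (d + 2))\<^sup>2 * (v \<bullet> u) ^ 1)"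
    by (intro sum.cong refl) algebra
  also have "\<dots> = 0"
    unfolding sum.distrib sum_subtractf sum_distrib_left[symmetric]
    by (subst (1 2 3) spherical_design_odd_power_sum[OF design]) simp_all
  finally show ?thesis .
qed

text \<open>The polynomial \<open>(t\<^sup>2 - 1/(d+2))\<^sup>2 (t + 1)\<close> is nonnegative on \<open>[-1, 1]\<close>, and its sum over all inner
  products with \<open>u\<close> is already attained by the term of \<open>u\<close> itself.\<close>

lemma inner_X:
  assumes "u \<in> X" "v \<in> X" "v \<noteq> u"
  shows "(v \<bullet> u)\<^sup>2 = 1 / (d + 2) \<or> v \<bullet> u = -1"
proof -
  let ?F = "\<lambda>v. ((v \<bullet> u)\<^sup>2 - 1 / (d + 2))\<^sup>2 * (v \<bullet> u + 1)"
  have "(\<Sum>v\<in>X. ?F v) = 2 * (1 - 1 / (d + 2))\<^sup>2"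
    using sum_quartic[OF assms(1)] sum_quintic[OF assms(1)] by (simp add: distrib_left sum.distrib)
  then have "(\<Sum>v\<in>X - {u}. ?F v) = 0"
    using assms(1) finite_X by (simp add: sum.remove[of X u] inner_X_self)
  moreover have "0 \<le> ?F v" if "v \<in> X - {u}" for v
    using inner_unit_ge[of v u] norm_X that assms(1) by auto
  ultimately have "?F v = 0"
    using assms finite_X by (subst (asm) sum_nonneg_eq_0_iff) auto
  then show ?thesis
    by auto
qed

text \<open>Without \<open>- u\<close> every point other than \<open>u\<close> has squared inner
  product \<open>1 / (d + 2)\<close>, so the quartic sum would keep only the term of
  \<open>u\<close>, which is half of its value.\<close>

lemma uminus_X:
  assumes "u \<in> X"
  shows "- u \<in> X"
proof (rule ccontr)
  assume *: "- u \<notin> X"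
  have "v \<bullet> u \<noteq> -1" if "v \<in> X" for v
  proof
    assume "v \<bullet> u = -1"
    then have "(norm (v + u))\<^sup>2 = 0"
      using inner_X_self[OF that] inner_X_self[OF assms]
      by (simp add: power2_norm_eq_inner inner_add_left inner_add_right inner_commute)
    then have "v = - u"
      by (simp add: add_eq_0_iff2)
    with that * show False
      by simp
  qed
  then have "(\<Sum>v\<in>X - {u}. ((v \<bullet> u)\<^sup>2 - 1 / (d + 2))\<^sup>2) = 0"
    using inner_X[OF assms] by (intro sum.neutral) fastforce
  then have "(1 - 1 / (d + 2))\<^sup>2 = 2 * (1 - 1 / (d + 2))\<^sup>2"
    using sum_quartic[OF assms] finite_X assms by (simp add: sum.remove[of X u] inner_X_self)
  then show False
    using d_ge_1 by (simp add: field_simps)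
qed

end

section \<open>Bases with one common inner product\<close>

definition equiangular_frame :: "real \<Rightarrow> ('n \<Rightarrow> real^'n) \<Rightarrow> bool" where
  "equiangular_frame \<alpha> g \<longleftrightarrow> 0 < \<alpha> \<and> \<alpha> < 1 \<and> (\<forall>i j. g i \<bullet> g j = (if i = j then 1 else \<alpha>))"

lemma equiangular_frame_inner:
  "equiangular_frame \<alpha> g \<Longrightarrow> g i \<bullet> g j = (if i = j then 1 else \<alpha>)"
  by (simp add: equiangular_frame_def)

text \<open>The Gram matrix is \<open>(1 - \<alpha>) I + \<alpha> J\<close> with \<open>J\<close>
  the all-one matrix.\<close>

lemma equiangular_frame_combination:
  assumes "equiangular_frame \<alpha> g"
  shows "(\<Sum>i\<in>UNIV. c i *\<^sub>R g i) \<bullet> g j = (1 - \<alpha>) * c j + \<alpha> * (\<Sum>i\<in>UNIV. c i)"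
proof -
  have "(\<Sum>i\<in>UNIV. c i *\<^sub>R g i) \<bullet> g j = (\<Sum>i\<in>UNIV. c i * (if i = j then 1 else \<alpha>))"
    by (simp add: inner_sum_left equiangular_frame_inner[OF assms])
  also have "\<dots> = (\<Sum>i\<in>UNIV. (if i = j then (1 - \<alpha>) * c i else 0) + \<alpha> * c i)"
    by (intro sum.cong) (auto simp: algebra_simps)
  finally show ?thesis
    by (simp add: sum.distrib flip: sum_distrib_left)
qed

lemma equiangular_frame_inj:
  assumes "equiangular_frame \<alpha> g"
  shows "inj g"
proof (rule injI)
  fix i j assume "g i = g j"
  then have "g i \<bullet> g j = 1"
    using equiangular_frame_inner[OF assms, of j j] by simp
  then show "i = j"
    using assms by (auto simp: equiangular_frame_def split: if_splits)
qed

lemma equiangular_frame_pos: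
  fixes g :: "'n::finite \<Rightarrow> real^'n"
  assumes "equiangular_frame \<alpha> g"
  shows "1 + (real CARD('n) - 1) * \<alpha> > 0"
proof -
  have "real CARD('n) \<ge> 1"
    by (simp add: Suc_leI)
  then show ?thesis
    using assms unfolding equiangular_frame_def by (intro add_pos_nonneg) auto
qed

text \<open>This inverts the Gram matrix: the products of \<open>x\<close> with all frame vectors
  add up to a multiple of the sum of the coefficients, from which each coefficient follows.\<close>

lemma equiangular_frame_coeff:
  fixes g :: "'n::finite \<Rightarrow> real^'n"
  assumes g: "equiangular_frame \<alpha> g" and x: "x = (\<Sum>i\<in>UNIV. c i *\<^sub>R g i)"
  shows "c i = (x \<bullet> g i - \<alpha> / (1 + (real CARD('n) - 1) * \<alpha>) * (\<Sum>j\<in>UNIV. x \<bullet> g j)) / (1 - \<alpha>)"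
proof -
  let ?s = "\<Sum>i\<in>UNIV. c i"
  have xg: "x \<bullet> g j = (1 - \<alpha>) * c j + \<alpha> * ?s" for j
    unfolding x by (rule equiangular_frame_combination[OF g])
  have "(\<Sum>j\<in>UNIV. x \<bullet> g j) = (1 + (real CARD('n) - 1) * \<alpha>) * ?s"
    unfolding xg sum.distrib sum_distrib_left[symmetric] by (simp add: algebra_simps)
  then have "\<alpha> / (1 + (real CARD('n) - 1) * \<alpha>) * (\<Sum>j\<in>UNIV. x \<bullet> g j) = \<alpha> * ?s"
    using equiangular_frame_pos[OF g] by simp
  then show ?thesis
    using g by (simp add: xg equiangular_frame_def)
qed

lemma equiangular_frame_independent:
  fixes g :: "'n::finite \<Rightarrow> real^'n"
  assumes g: "equiangular_frame \<alpha> g"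
  shows "independent (range g)"
proof
  assume "dependent (range g)"
  then obtain u where u: "\<exists>v\<in>range g. u v \<noteq> 0" "(\<Sum>v\<in>range g. u v *\<^sub>R v) = 0"
    by (subst (asm) dependent_finite) auto
  have "0 = (\<Sum>i\<in>UNIV. u (g i) *\<^sub>R g i)"
    using u(2) by (simp add: sum.reindex equiangular_frame_inj[OF g])
  from equiangular_frame_coeff[OF g this] have "u (g i) = 0" for i
    by simp
  with u(1) show False
    by auto
qed

text \<open>The frame is indexed by the coordinate type, so it has as many vectors as the dimension,
  and independence makes it a basis.\<close>

lemma equiangular_frame_expand:
  fixes g :: "'n::finite \<Rightarrow> real^'n"
  assumes g: "equiangular_frame \<alpha> g"
  obtains c where "x = (\<Sum>i\<in>UNIV. c i *\<^sub>R g i)"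
proof -
  have "dim (range g) = CARD('n)"
    using equiangular_frame_inj[OF g]
    by (simp add: dim_eq_card_independent[OF equiangular_frame_independent[OF g]] card_image)
  then have "span (range g) = UNIV"
    by (metis DIM_cart DIM_real dim_eq_full mult_1_right)
  then have "x \<in> span (range g)"
    by simp
  then obtain u where "x = (\<Sum>v\<in>range g. u v *\<^sub>R v)"
    by (subst (asm) span_finite) auto
  then show ?thesis
    by (intro that[of "\<lambda>i. u (g i)"]) (simp add: sum.reindex equiangular_frame_inj[OF g])
qed

text \<open>The bilinear form of the inverse Gram matrix, scaled by \<open>1 - \<alpha>\<close>. It
  computes inner products of arbitrary vectors from their products with the frame.\<close>

lemma equiangular_frame_inner_expansion:
  fixes g :: "'n::finite \<Rightarrow> real^'n"
  assumes g: "equiangular_frame \<alpha> g"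
  shows "(1 - \<alpha>) * (x \<bullet> y) = (\<Sum>i\<in>UNIV. (x \<bullet> g i) * (y \<bullet> g i)) -
    \<alpha> / (1 + (real CARD('n) - 1) * \<alpha>) * ((\<Sum>i\<in>UNIV. x \<bullet> g i) * (\<Sum>i\<in>UNIV. y \<bullet> g i))"
proof -
  let ?k = "\<alpha> / (1 + (real CARD('n) - 1) * \<alpha>)" and ?X = "\<Sum>j\<in>UNIV. x \<bullet> g j"
  obtain c where x: "x = (\<Sum>i\<in>UNIV. c i *\<^sub>R g i)"
    using equiangular_frame_expand[OF g] .
  have c: "(1 - \<alpha>) * c i = x \<bullet> g i - ?k * ?X" for i
    using g by (subst equiangular_frame_coeff[OF g x]) (auto simp: equiangular_frame_def)
  have "(1 - \<alpha>) * (x \<bullet> y) = (\<Sum>i\<in>UNIV. ((1 - \<alpha>) * c i) * (y \<bullet> g i))"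
    by (subst x) (simp add: inner_sum_left sum_distrib_left inner_commute[of y] mult.assoc)
  also have "\<dots> = (\<Sum>i\<in>UNIV. (x \<bullet> g i) * (y \<bullet> g i) - ?k * ?X * (y \<bullet> g i))"
    unfolding c by (simp add: left_diff_distrib)
  finally show ?thesis
    unfolding sum_subtractf sum_distrib_left[symmetric] mult.assoc .
qed

lemma equiangular_frame_eqI:
  fixes g :: "'n::finite \<Rightarrow> real^'n"
  assumes g: "equiangular_frame \<alpha> g" and eq: "\<And>i. x \<bullet> g i = y \<bullet> g i"
  shows "x = y"
proof -
  have "(1 - \<alpha>) * ((x - y) \<bullet> (x - y)) = 0"
    by (subst equiangular_frame_inner_expansion[OF g]) (simp add: eq inner_diff_left)
  then show ?thesis
    using g by (simp add: equiangular_frame_def)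
qed

text \<open>The linear map that carries one frame to the other preserves inner products because both
  Gram matrices agree. A point is determined by its products with the frame, so equal profiles give
  equal images.\<close>

lemma isometric_sets_of_frames:
  fixes g g' :: "'n::finite \<Rightarrow> real^'n"
  assumes g: "equiangular_frame \<alpha> g" and g': "equiangular_frame \<alpha> g'"
    and eq: "(\<lambda>u i. u \<bullet> g i) ` X = (\<lambda>u i. u \<bullet> g' i) ` X'"
  shows "isometric_sets X X'"
proof -
  obtain f where f: "linear f" "\<And>v. v \<in> range g \<Longrightarrow> f v = (g' \<circ> inv g) v"
    using linear_independent_extend[OF equiangular_frame_independent[OF g]] by metis
  have fg: "f (g i) = g' i" for i
    using f(2)[of "g i"] by (simp add: equiangular_frame_inj[OF g])
  have inner: "f x \<bullet> g' i = x \<bullet> g i" for x i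
  proof -
    obtain c where x: "x = (\<Sum>i\<in>UNIV. c i *\<^sub>R g i)"
      using equiangular_frame_expand[OF g] .
    then have "f x = (\<Sum>i\<in>UNIV. c i *\<^sub>R g' i)"
      by (simp add: linear_sum[OF f(1)] linear_scale[OF f(1)] fg)
    then show ?thesis
      by (simp add: x equiangular_frame_combination[OF g] equiangular_frame_combination[OF g'])
  qed
  have "f x \<bullet> f y = x \<bullet> y" for x y
  proof -
    have "(1 - \<alpha>) * (f x \<bullet> f y) = (1 - \<alpha>) * (x \<bullet> y)"
      unfolding equiangular_frame_inner_expansion[OF g, of x y]
        equiangular_frame_inner_expansion[OF g', of "f x" "f y"] inner ..
    then show ?thesis
      using g by (simp add: equiangular_frame_def)
  qed
  then have "orthogonal_transformation f"
    using f(1) by (simp add: orthogonal_transformation_def)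
  moreover have "f ` X = X'"
  proof (intro set_eqI iffI)
    fix y assume "y \<in> f ` X"
    then obtain x where x: "x \<in> X" "y = f x"
      by auto
    then obtain x' where x': "x' \<in> X'" "(\<lambda>i. x \<bullet> g i) = (\<lambda>i. x' \<bullet> g' i)"
      using eq by (metis (mono_tags, lifting) imageE imageI)
    then have "y = x'"
      unfolding x(2) by (intro equiangular_frame_eqI[OF g']) (metis inner)
    with x' show "y \<in> X'"
      by simp
  next
    fix y assume y: "y \<in> X'"
    then obtain x where x: "x \<in> X" "(\<lambda>i. x \<bullet> g i) = (\<lambda>i. y \<bullet> g' i)"
      using eq by (metis (mono_tags, lifting) imageE imageI)
    then have "f x = y"
      by (intro equiangular_frame_eqI[OF g']) (metis inner)
    with x show "y \<in> f ` X"
      by auto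
  qed
  ultimately show ?thesis
    unfolding isometric_sets_def by blast
qed

section \<open>Signs relative to an equiangular basis\<close>

lemma inner_eq_minus_one_imp:
  fixes u v :: "'a::real_inner"
  assumes "norm u = 1" "norm v = 1" "u \<bullet> v = -1"
  shows "v = - u"
proof -
  have "(norm (v + u))\<^sup>2 = 0"
    using assms by (simp add: power2_norm_eq_inner inner_add_left inner_add_right inner_commute norm_eq_1)
  then show ?thesis
    by (simp add: add_eq_0_iff2)
qed

text \<open>A profile lists the inner products of a point with the frame. The first set belongs to
  the frame vectors and their negatives, the second to the remaining points: \<open>\<B>\<close>
  holds sets of positive signs and \<open>s\<close> supplies the antipodes.\<close>

definition frame_profiles :: "real \<Rightarrow> 'n set set \<Rightarrow> ('n \<Rightarrow> real) set" where
  "frame_profiles \<alpha> \<B> =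
     {(\<lambda>i. s * (if i = j then 1 else \<alpha>)) | j s. s \<in> {1, -1}} \<union>
     {(\<lambda>i. s * (if i \<in> B then \<alpha> else - \<alpha>)) | B s. B \<in> \<B> \<and> s \<in> {1, -1}}"

lemma sum_signs:
  fixes B :: "'n::finite set" and \<alpha> :: real
  shows "(\<Sum>i\<in>UNIV. if i \<in> B then \<alpha> else - \<alpha>) = \<alpha> * (2 * real (card B) - real CARD('n))"
proof -
  have "(\<Sum>i\<in>UNIV. if i \<in> B then \<alpha> else - \<alpha>) = (\<Sum>i\<in>UNIV. 2 * \<alpha> * indicator B i - \<alpha>)"
    by (intro sum.cong) (auto simp: indicator_def)
  then show ?thesis
    by (simp add: sum_subtractf indicator_def sum.If_cases algebra_simps flip: sum_distrib_left)
qed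

lemma sum_signs_mult:
  fixes B C :: "'n::finite set" and \<alpha> :: real
  shows "(\<Sum>i\<in>UNIV. (if i \<in> B then \<alpha> else - \<alpha>) * (if i \<in> C then \<alpha> else - \<alpha>)) =
    \<alpha>\<^sup>2 * (real CARD('n) - 2 * real (card B) - 2 * real (card C) + 4 * real (card (B \<inter> C)))"
proof -
  have "(\<Sum>i\<in>UNIV. (if i \<in> B then \<alpha> else - \<alpha>) * (if i \<in> C then \<alpha> else - \<alpha>)) =
    (\<Sum>i\<in>UNIV. \<alpha>\<^sup>2 * (1 - 2 * indicator B i - 2 * indicator C i + 4 * indicator (B \<inter> C) i))"
    by (intro sum.cong) (auto simp: indicator_def power2_eq_square)
  then show ?thesis
    by (simp add: sum_subtractf sum.distrib indicator_def sum.If_cases Int_def flip: sum_distrib_left)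
qed

text \<open>At \<open>b = 2\<close> the right side takes the value \<open>3\<close>, so it leaves
  the remainder \<open>3\<close> modulo \<open>b - 2\<close>, while the left side is
  divisible.\<close>

lemma dvd_three_of_square_identity:
  fixes b K :: int
  assumes "(b - 2) * K\<^sup>2 = (b\<^sup>2 + b - 3) * (b\<^sup>2 - 6 * b + 7)\<^sup>2"
  shows "(b - 2) dvd 3"
proof -
  define c where "c = b - 2"
  have b: "b = c + 2"
    by (simp add: c_def)
  \<comment> \<open>The subtracted polynomial is the quotient of
    \<open>(c^2 + 5 c + 3) (c^2 - 2 c - 1)^2 - 3\<close> by \<open>c\<close>.\<close>
  have "3 = c * (K\<^sup>2 - (c ^ 5 + c ^ 4 - 15 * c ^ 3 + 2 * c\<^sup>2 + 27 * c + 17))"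
    using assms unfolding b by algebra
  then show ?thesis
    unfolding c_def by (rule dvdI)
qed

text \<open>\<open>x = q / p\<close> is a rational square root of a natural number: squaring gives
  \<open>p^2 n = q^2\<close>, whence \<open>p\<close> divides \<open>q\<close>.\<close>

lemma real_sqrt_of_nat_in_Nats:
  assumes "real n = x\<^sup>2" "p * x = q" "p \<noteq> 0" "p \<in> \<int>" "q \<in> \<int>" "0 \<le> x"
  obtains b where "x = real b"
proof -
  from assms(4,5) obtain p' q' where pq: "p = of_int p'" "q = of_int q'"
    by (auto elim!: Ints_cases)
  have "(p * x)\<^sup>2 = q\<^sup>2"
    using assms(2) by simp
  then have "real_of_int (p'\<^sup>2 * int n) = real_of_int (q'\<^sup>2)"
    by (simp add: power_mult_distrib pq assms(1))
  then have "p'\<^sup>2 * int n = q'\<^sup>2"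
    by (simp only: of_int_eq_iff)
  then have "p'\<^sup>2 dvd q'\<^sup>2"
    by (metis dvd_triv_left)
  then have "p' dvd q'"
    by simp
  then obtain r where "q' = p' * r"
    by (elim dvdE)
  then have "x = of_int r"
    using assms(2,3) by (simp add: pq)
  then have "x = real (nat r)"
    using assms(6) by simp
  then show ?thesis
    by (rule that)
qed

section \<open>Sign patterns of the points outside \<plusminus>\<Gamma>, and the dimension\<close>

locale tight_5_design_frame = tight_5_design X for X :: "(real^'n) set" +
  fixes g :: "'n \<Rightarrow> real^'n"
  assumes two_le: "2 \<le> CARD('n)"
    and g_X: "g i \<in> X"
    and inj_g: "inj g"
    and g_pos: "i \<noteq> j \<Longrightarrow> 0 < g i \<bullet> g j"
begin

definition \<beta> :: real where "\<beta> = sqrt (d + 2)"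
definition \<alpha> :: real where "\<alpha> = 1 / \<beta>"
text \<open>\<open>\<alpha> * \<kappa>\<close> is the row sum \<open>1 + (d - 1) \<alpha>\<close> of
  the Gram matrix of the frame.\<close>

definition \<kappa> :: real where "\<kappa> = \<beta>\<^sup>2 + \<beta> - 3"
definition R :: "(real^'n) set" where "R = X - (range g \<union> uminus ` range g)"
definition pos :: "real^'n \<Rightarrow> 'n set" where "pos u = {i. 0 < u \<bullet> g i}"
text \<open>The bound selects representatives of the antipodal pairs. For \<open>d = 2\<close> both
  members of a pair satisfy it; for larger \<open>d\<close> the total of the signs is never zero and
  exactly one does.\<close>

definition U :: "(real^'n) set" where "U = {u \<in> R. 2 * card (pos u) \<le> CARD('n)}"

lemma beta_sq: "\<beta>\<^sup>2 = d + 2"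
  using d_ge_1 by (simp add: \<beta>_def)

lemma d_ge_2: "d \<ge> 2"
  using two_le by (simp add: d_def)

lemma beta_ge: "\<beta> \<ge> 2"
  using real_sqrt_le_mono[of "2\<^sup>2" "d + 2"] d_ge_2 by (simp add: \<beta>_def)

lemma kappa_pos: "\<kappa> > 0"
  using beta_ge d_ge_2 by (simp add: \<kappa>_def beta_sq)

lemma alpha_sq: "\<alpha>\<^sup>2 = 1 / (d + 2)"
  by (simp add: \<alpha>_def beta_sq power_divide)

lemma alpha_pos: "\<alpha> > 0"
  using beta_ge by (simp add: \<alpha>_def)

text \<open>Positivity selects \<open>\<alpha>\<close> among the possible inner products
  \<open>\<alpha>\<close>, \<open>- \<alpha>\<close> and \<open>-1\<close>.\<close>

lemma frame: "equiangular_frame \<alpha> g"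
proof -
  have "g i \<bullet> g j = \<alpha>" if "i \<noteq> j" for i j
  proof -
    have "g i \<noteq> g j"
      using inj_g that by (simp add: inj_eq)
    then have "(g i \<bullet> g j)\<^sup>2 = \<alpha>\<^sup>2"
      using inner_X[of "g j" "g i"] g_X g_pos[OF that] by (auto simp: alpha_sq)
    then show ?thesis
      using g_pos[OF that] alpha_pos by (simp add: power2_eq_iff)
  qed
  moreover have "\<alpha> < 1"
    using beta_ge by (simp add: \<alpha>_def)
  ultimately show ?thesis
    using alpha_pos by (simp add: equiangular_frame_def inner_X_self[OF g_X])
qed

lemma coeff_ratio: "\<alpha> / (1 + (real CARD('n) - 1) * \<alpha>) = 1 / \<kappa>"
proof -
  have "(1 + (real CARD('n) - 1) * \<alpha>) = \<alpha> * \<kappa>"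
    using beta_ge unfolding d_def[symmetric] \<alpha>_def \<kappa>_def beta_sq
    by (simp add: field_simps)
  then show ?thesis
    using alpha_pos by simp
qed

lemma finite_R: "finite R"
  by (simp add: R_def finite_X)

lemma R_X: "u \<in> R \<Longrightarrow> u \<in> X"
  by (simp add: R_def)

lemma uminus_R:
  assumes "u \<in> R"
  shows "- u \<in> R"
proof -
  have "u \<noteq> - g i" "u \<noteq> g i" for i
    using assms by (auto simp: R_def)
  then have "- u \<noteq> g i" "- u \<noteq> - g i" for i
    by (metis minus_minus)+
  then show ?thesis
    using assms by (auto simp: R_def uminus_X)
qed

lemma inner_R:
  assumes "u \<in> R"
  shows "u \<bullet> g i = (if i \<in> pos u then \<alpha> else - \<alpha>)"
proof -
  have "u \<noteq> g i" "u \<noteq> - g i" "u \<in> X"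
    using assms by (auto simp: R_def)
  moreover have "u \<bullet> g i \<noteq> -1"
    using inner_eq_minus_one_imp[of "g i" u] \<open>u \<in> X\<close> \<open>u \<noteq> - g i\<close> g_X[of i] norm_X
    by (auto simp: inner_commute)
  ultimately have "(u \<bullet> g i)\<^sup>2 = \<alpha>\<^sup>2"
    using inner_X[OF g_X, of u i] by (auto simp: alpha_sq)
  then have "u \<bullet> g i = \<alpha> \<or> u \<bullet> g i = - \<alpha>"
    by (simp add: power2_eq_iff)
  then show ?thesis
    using alpha_pos by (auto simp: pos_def)
qed

lemma pos_uminus:
  assumes "u \<in> R"
  shows "pos (- u) = - pos u"
proof (rule set_eqI)
  fix i
  show "i \<in> pos (- u) \<longleftrightarrow> i \<in> - pos u"
    using inner_R[OF assms, of i] alpha_pos by (auto simp: pos_def split: if_splits)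
qed

lemma card_compl: "card (- A :: 'n set) = CARD('n) - card A"
  by (simp add: Compl_eq_Diff_UNIV card_Diff_subset)

lemma inj_on_pos: "inj_on pos R"
proof (rule inj_onI)
  fix u v assume "u \<in> R" "v \<in> R" "pos u = pos v"
  then show "u = v"
    by (intro equiangular_frame_eqI[OF frame]) (simp add: inner_R)
qed

lemma range_g_disjoint: "range g \<inter> uminus ` range g = {}"
proof -
  have "g i \<noteq> - g j" for i j
  proof
    assume "g i = - g j"
    then have "g i \<bullet> g j = -1"
      by (simp add: inner_X_self[OF g_X])
    then show False
      using alpha_pos equiangular_frame_inner[OF frame, of i j] by (simp split: if_splits)
  qed
  then show ?thesis
    by blast
qed

lemma card_R: "card R = CARD('n) * (CARD('n) - 1)"
proof -
  have "card (range g \<union> uminus ` range g) = 2 * CARD('n)"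
    using inj_g by (subst card_Un_disjoint) (auto simp: range_g_disjoint card_image)
  moreover have "range g \<union> uminus ` range g \<subseteq> X"
    using g_X uminus_X by auto
  ultimately show ?thesis
    unfolding R_def by (subst card_Diff_subset) (auto simp: card_X algebra_simps)
qed

lemma R_nonempty: "R \<noteq> {}"
proof -
  have "card R \<noteq> 0"
    using two_le by (simp add: card_R)
  then show ?thesis
    by auto
qed

text \<open>Expanding \<open>u \<bullet> u = 1\<close> through the inverse Gram matrix leaves the
  number of positive signs as the only unknown.\<close>

lemma card_pos_sq:
  assumes "u \<in> R"
  shows "(2 * real (card (pos u)) - d)\<^sup>2 = (\<beta> - 2) * \<kappa>"
proof -
  let ?M = "2 * real (card (pos u)) - d"
  have "1 - \<alpha> = \<alpha>\<^sup>2 * d - 1 / \<kappa> * ((\<alpha> * ?M) * (\<alpha> * ?M))"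
    using equiangular_frame_inner_expansion[OF frame, of u u]
    unfolding inner_R[OF assms] sum_signs_mult sum_signs coeff_ratio d_def
    by (simp add: inner_X_self[OF R_X[OF assms]] algebra_simps)
  moreover have "\<beta> * \<alpha> = 1"
    using beta_ge by (simp add: \<alpha>_def)
  ultimately have "\<beta>\<^sup>2 - \<beta> = d - 1 / \<kappa> * ?M\<^sup>2"
    by algebra
  then have "?M\<^sup>2 / \<kappa> = \<beta> - 2"
    by (simp add: beta_sq)
  then show ?thesis
    using kappa_pos by (simp add: field_simps)
qed

lemma frame_sum_inner: "g i \<bullet> (\<Sum>j\<in>UNIV. g j) = \<alpha> * \<kappa>"
proof -
  have "(\<Sum>j\<in>UNIV. 1 *\<^sub>R g j) \<bullet> g i = (1 - \<alpha>) + \<alpha> * d"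
    using equiangular_frame_combination[OF frame, of "\<lambda>_. 1" i] by (simp add: d_def)
  also have "\<dots> = \<alpha> * \<kappa>"
    using beta_ge unfolding \<alpha>_def \<kappa>_def beta_sq by (simp add: field_simps)
  finally show ?thesis
    by (simp add: inner_commute)
qed

text \<open>The integer \<open>K\<close> is the sum, over the points outside \<open>\<plusminus>\<Gamma>\<close>, of the products of three signs and the
  sign of their total \<open>m\<close>.\<close>

lemma mixed_moment_identity:
  fixes i j k :: 'n
  assumes ijk: "i \<noteq> j" "i \<noteq> k" "j \<noteq> k"
  shows "\<exists>K :: int. \<exists>m :: real. m\<^sup>2 = (\<beta> - 2) * \<kappa> \<and> m * of_int K = \<kappa> * (d + 9 - 6 * \<beta>)"
proof -
  define h where "h = (\<Sum>l\<in>UNIV. g l)"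
  define P where "P u = (u \<bullet> g i) * (u \<bullet> g j) * (u \<bullet> g k) * (u \<bullet> h)" for u
  have gh: "g l \<bullet> h = \<alpha> * \<kappa>" for l
    unfolding h_def by (rule frame_sum_inner)
  have "d > 0"
    using d_ge_2 by simp
  have ip: "g i \<bullet> g j = \<alpha>" "g i \<bullet> g k = \<alpha>" "g j \<bullet> g k = \<alpha>"
    using ijk by (simp_all add: equiangular_frame_inner[OF frame])
  \<comment> \<open>Each of the three pairings of the four vectors contributes
    \<open>\<alpha> * (\<alpha> * \<kappa>)\<close>.\<close>
  have "sum P X = (d + 1) / (d + 2) * (3 * \<alpha> * (\<alpha> * \<kappa>))"
    using spherical_design_moment4[OF design, of "g i" "g j" "g k" h] \<open>d > 0\<close>
    by (simp add: P_def card_X_real ip gh flip: d_def)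
  moreover have "sum P X = sum P (range g) + sum P (uminus ` range g) + sum P R"
  proof -
    have "X = (range g \<union> uminus ` range g) \<union> R"
      using g_X uminus_X by (auto simp: R_def)
    then have "sum P X = sum P (range g \<union> uminus ` range g) + sum P R"
      using finite_R by (metis R_def Diff_disjoint finite_UNIV finite_Un finite_imageI finite_X sum.union_disjoint)
    then show ?thesis
      using range_g_disjoint by (simp add: sum.union_disjoint)
  qed
  \<comment> \<open>\<open>P\<close> has four linear factors, so antipodes give equal
    values.\<close>
  moreover have "sum P (uminus ` range g) = sum P (range g)"
    by (subst sum.reindex) (auto simp: P_def)
  \<comment> \<open>The product of the three inner products is \<open>\<alpha>^3\<close> for a
    generic frame vector, but \<open>\<alpha>^2\<close> for \<open>g i\<close>, \<open>g j\<close>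
    and \<open>g k\<close>, where one factor is \<open>1\<close>.\<close>
  moreover have "sum P (range g) = \<alpha> * \<kappa> * (d * \<alpha> ^ 3 + 3 * (\<alpha>\<^sup>2 - \<alpha> ^ 3))"
  proof -
    have "sum P (range g) = (\<Sum>l\<in>UNIV. \<alpha> * \<kappa> * (\<alpha> ^ 3 + (if l = i then \<alpha>\<^sup>2 - \<alpha> ^ 3 else 0) +
        (if l = j then \<alpha>\<^sup>2 - \<alpha> ^ 3 else 0) + (if l = k then \<alpha>\<^sup>2 - \<alpha> ^ 3 else 0)))"
      using ijk by (subst sum.reindex[OF inj_g], intro sum.cong refl)
        (auto simp: P_def gh equiangular_frame_inner[OF frame] power2_eq_square power3_eq_cube)
    also have "\<dots> = \<alpha> * \<kappa> * (d * \<alpha> ^ 3 + 3 * (\<alpha>\<^sup>2 - \<alpha> ^ 3))"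
      by (simp add: sum.distrib d_def flip: sum_distrib_left)
    finally show ?thesis .
  qed
  moreover obtain m :: real and K :: int where m: "m\<^sup>2 = (\<beta> - 2) * \<kappa>" and "sum P R = \<alpha> ^ 4 * (m * of_int K)"
  proof -
    define m where "m = sqrt ((\<beta> - 2) * \<kappa>)"
    define e where "e u l = (if l \<in> pos u then 1 else -1 :: int)" for u l
    define s where "s u = (if 2 * real (card (pos u)) - d = m then 1 else -1 :: int)" for u
    have m: "m\<^sup>2 = (\<beta> - 2) * \<kappa>"
      using beta_ge kappa_pos by (simp add: m_def)
    have "P u = \<alpha> ^ 4 * (m * of_int (e u i * e u j * e u k * s u))" if "u \<in> R" for u
    proof -
      have eu: "u \<bullet> g l = \<alpha> * of_int (e u l)" for l
        by (simp add: inner_R[OF that] e_def)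
      have "(2 * real (card (pos u)) - d)\<^sup>2 = m\<^sup>2"
        using card_pos_sq[OF that] m by simp
      then have su: "2 * real (card (pos u)) - d = m * of_int (s u)"
        by (auto simp: s_def power2_eq_iff)
      have "u \<bullet> h = \<alpha> * (m * of_int (s u))"
        unfolding h_def inner_sum_right inner_R[OF that] sum_signs
        by (simp add: su flip: d_def)
      then show ?thesis
        by (simp add: P_def eu power4_eq_xxxx)
    qed
    then have "sum P R = \<alpha> ^ 4 * (m * of_int (\<Sum>u\<in>R. e u i * e u j * e u k * s u))"
      by (simp add: sum_distrib_left)
    with m show ?thesis
      by (rule that)
  qed
  ultimately have "(d + 1) / (d + 2) * (3 * \<alpha> * (\<alpha> * \<kappa>)) =
      2 * (\<alpha> * \<kappa> * (d * \<alpha> ^ 3 + 3 * (\<alpha>\<^sup>2 - \<alpha> ^ 3))) + \<alpha> ^ 4 * (m * of_int K)"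
    by simp
  moreover have "1 / (d + 2) = \<alpha>\<^sup>2"
    by (simp add: alpha_sq)
  then have "(d + 1) / (d + 2) = (d + 1) * \<alpha>\<^sup>2"
    by (metis mult.right_neutral times_divide_eq_right)
  ultimately have "\<alpha> ^ 4 * (3 * (d + 1) * \<kappa>) =
      \<alpha> ^ 4 * (2 * \<kappa> * (d - 3)) + 6 * \<kappa> * \<alpha> ^ 3 + \<alpha> ^ 4 * (m * of_int K)"
    by algebra
  moreover have "\<alpha> ^ 3 = \<alpha> ^ 4 * \<beta>"
    using beta_ge by (simp add: \<alpha>_def field_simps power4_eq_xxxx power3_eq_cube)
  ultimately have "\<alpha> ^ 4 * (3 * (d + 1) * \<kappa>) = \<alpha> ^ 4 * (2 * \<kappa> * (d - 3) + 6 * \<kappa> * \<beta> + m * of_int K)"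
    by (simp add: algebra_simps)
  then have "3 * (d + 1) * \<kappa> = 2 * \<kappa> * (d - 3) + 6 * \<kappa> * \<beta> + m * of_int K"
    using alpha_pos by simp
  then have "m * of_int K = \<kappa> * (d + 9 - 6 * \<beta>)"
    by (simp add: algebra_simps)
  with m show ?thesis
    by blast
qed

lemma dimension: "CARD('n) \<in> {2, 3, 7, 23}"
proof (cases "CARD('n) \<le> 3")
  case True
  then show ?thesis
    using two_le by auto
next
  case False
  then have d4: "d \<ge> 4"
    by (simp add: d_def)
  obtain u where u: "u \<in> R"
    using R_nonempty by auto
  \<comment> \<open>With \<open>\<beta>^2 = d + 2\<close> the identity for the sign total becomes
    linear in \<open>\<beta>\<close>. Its coefficient \<open>d - 3\<close> is nonzero for
    \<open>d \<ge> 4\<close>, so \<open>\<beta>\<close> is rational and hence an integer.\<close>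
  have "(d - 3) * \<beta> = (2 * real (card (pos u)) - d)\<^sup>2 + d - 4"
    using card_pos_sq[OF u] beta_sq unfolding \<kappa>_def by algebra
  then obtain b where b: "\<beta> = real b"
    using d4 beta_ge
    by (elim real_sqrt_of_nat_in_Nats[of "CARD('n) + 2" \<beta> "d - 3", rotated])
      (auto simp: beta_sq d_def)
  have "3 \<le> CARD('n)"
    using False by simp
  then obtain I :: "'n set" where "card I = 3"
    by (metis obtain_subset_with_card_n)
  then obtain i j k :: 'n where "i \<noteq> j" "i \<noteq> k" "j \<noteq> k"
    by (auto simp: card_3_iff)
  from mixed_moment_identity[OF this] obtain K :: int and m where
    m: "m\<^sup>2 = (\<beta> - 2) * \<kappa>" and mK: "m * of_int K = \<kappa> * (d + 9 - 6 * \<beta>)"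
    by blast
  \<comment> \<open>Squaring the mixed moment identity eliminates \<open>m\<close>, and one factor
    \<open>\<kappa>\<close> cancels.\<close>
  have "\<kappa> * ((\<beta> - 2) * (of_int K)\<^sup>2) = \<kappa> * (\<kappa> * (d + 9 - 6 * \<beta>)\<^sup>2)"
    using m mK by algebra
  then have "(\<beta> - 2) * (of_int K)\<^sup>2 = \<kappa> * (d + 9 - 6 * \<beta>)\<^sup>2"
    using kappa_pos by simp
  moreover have "d + 9 - 6 * \<beta> = \<beta>\<^sup>2 - 6 * \<beta> + 7"
    by (simp add: beta_sq)
  ultimately have "(\<beta> - 2) * (of_int K)\<^sup>2 = (\<beta>\<^sup>2 + \<beta> - 3) * (\<beta>\<^sup>2 - 6 * \<beta> + 7)\<^sup>2"
    by (simp only: \<kappa>_def)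
  then have "real_of_int ((int b - 2) * K\<^sup>2) =
      real_of_int (((int b)\<^sup>2 + int b - 3) * ((int b)\<^sup>2 - 6 * int b + 7)\<^sup>2)"
    by (simp add: b)
  then have "(int b - 2) dvd 3"
    by (intro dvd_three_of_square_identity) (simp only: of_int_eq_iff)
  moreover have bb: "CARD('n) + 2 = b\<^sup>2"
    using beta_sq unfolding b d_def by (metis of_nat_add of_nat_eq_iff of_nat_numeral of_nat_power)
  have "3 \<le> b"
  proof (rule ccontr)
    assume "\<not> 3 \<le> b"
    then have "b\<^sup>2 \<le> 2\<^sup>2"
      by (intro power_mono) auto
    with bb False show False
      by simp
  qed
  moreover have "int b - 2 \<le> 3"
    using calculation(1) by (intro zdvd_imp_le) auto
  \<comment> \<open>\<open>b - 2\<close> is positive and divides \<open>3\<close>; the candidate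
    \<open>b = 4\<close> fails because \<open>2\<close> does not.\<close>
  ultimately have "b = 3 \<or> b = 4 \<or> b = 5"
    by auto
  then have "b = 3 \<or> b = 5"
    using \<open>(int b - 2) dvd 3\<close> by auto
  then show ?thesis
    using bb by auto
qed

end

section \<open>Uniqueness of the Steiner system S(4,7,23)\<close>

lemma sum_card_Int:
  assumes "finite F" "finite D"
  shows "(\<Sum>B\<in>F. card (B \<inter> D)) = (\<Sum>x\<in>D. card {B \<in> F. x \<in> B})"
proof -
  have "(\<Sum>B\<in>F. card (B \<inter> D)) = (\<Sum>B\<in>F. card {x \<in> D. x \<in> B})"
    by (simp add: Int_def conj_commute)
  also have "\<dots> = (\<Sum>x\<in>D. card {B \<in> F. x \<in> B})"
    using assms by (intro sum_multicount_gen) auto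
  finally show ?thesis .
qed

lemma card_sym_diff:
  assumes "finite A" "finite B"
  shows "card (sym_diff A B) + 2 * card (A \<inter> B) = card A + card B"
proof -
  have "card A = card (A - B) + card (A \<inter> B)" "card B = card (B - A) + card (A \<inter> B)"
    using assms by (metis card_Int_Diff add.commute, metis card_Int_Diff add.commute inf_commute)
  moreover have "card (sym_diff A B) = card (A - B) + card (B - A)"
    using assms by (intro card_Un_disjoint) auto
  ultimately show ?thesis
    by simp
qed

lemma even_card_Int_sym_diff:
  assumes "finite A" "finite B"
  shows "even (card (C \<inter> sym_diff A B)) \<longleftrightarrow> (even (card (C \<inter> A)) \<longleftrightarrow> even (card (C \<inter> B)))"
proof -
  have "C \<inter> sym_diff A B = sym_diff (C \<inter> A) (C \<inter> B)"
    by blast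
  moreover have "card (sym_diff (C \<inter> A) (C \<inter> B)) + 2 * card ((C \<inter> A) \<inter> (C \<inter> B)) = card (C \<inter> A) + card (C \<inter> B)"
    using assms by (intro card_sym_diff) auto
  ultimately show ?thesis
    by (metis even_add even_mult_iff even_numeral)
qed

text \<open>The sum of the words \<open>w i\<close> over the two-element field, in a closed form
  that is independent of the order of summation.\<close>

definition xor_sum :: "'i set \<Rightarrow> ('i \<Rightarrow> 'a set) \<Rightarrow> 'a set" where
  "xor_sum I w = {y. odd (card {i \<in> I. y \<in> w i})}"

lemma xor_sum_insert:
  assumes "finite I" "j \<notin> I"
  shows "xor_sum (insert j I) w = sym_diff (xor_sum I w) (w j)"
proof (rule set_eqI)
  fix y
  have "{i \<in> insert j I. y \<in> w i} = (if y \<in> w j then insert j {i \<in> I. y \<in> w i} else {i \<in> I. y \<in> w i})"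
    by auto
  then show "y \<in> xor_sum (insert j I) w \<longleftrightarrow> y \<in> sym_diff (xor_sum I w) (w j)"
    using assms by (simp add: xor_sum_def)
qed

text \<open>The parity of an intersection is the standard bilinear form on subsets over the
  two-element field, hence additive.\<close>

lemma even_card_Int_xor_sum:
  fixes w :: "'i \<Rightarrow> 'a::finite set"
  assumes "finite I"
  shows "even (card (C \<inter> xor_sum I w)) \<longleftrightarrow> even (\<Sum>i\<in>I. card (C \<inter> w i))"
  using assms
proof (induction I rule: finite_induct)
  case empty
  show ?case
    by (simp add: xor_sum_def)
next
  case (insert j I)
  then show ?case
    by (simp add: xor_sum_insert even_card_Int_sym_diff) blast
qed

lemma even_sum_odd:
  assumes "finite I" "\<And>i. i \<in> I \<Longrightarrow> odd (f i :: nat)"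
  shows "even (sum f I) \<longleftrightarrow> even (card I)"
  using assms by (induction I rule: finite_induct) auto

section \<open>Block counts and minimum weight of a Steiner system \<open>S(4,7,23)\<close>\<close>

lemma steiner_count_step:
  fixes \<B> :: "'a::finite set set"
  assumes block: "\<And>B. B \<in> \<B> \<Longrightarrow> card B = k"
    and count: "\<And>T :: 'a set. card T = Suc t \<Longrightarrow> card {B \<in> \<B>. T \<subseteq> B} = l"
    and T: "card T = t"
  shows "(k - t) * card {B \<in> \<B>. T \<subseteq> B} = (CARD('a) - t) * l"
proof -
  let ?F = "{B \<in> \<B>. T \<subseteq> B}"
  \<comment> \<open>Double counting of pairs of a point outside \<open>T\<close> and a block through
    that point and \<open>T\<close>.\<close>
  have "(\<Sum>B\<in>?F. card (B \<inter> - T)) = (\<Sum>x\<in>- T. card {B \<in> ?F. x \<in> B})"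
    by (intro sum_card_Int) auto
  also have "\<dots> = (\<Sum>x\<in>- T. l)"
  proof (rule sum.cong)
    fix x assume "x \<in> - T"
    then have "card (insert x T) = Suc t"
      using T by simp
    moreover have "{B \<in> ?F. x \<in> B} = {B \<in> \<B>. insert x T \<subseteq> B}"
      by auto
    ultimately show "card {B \<in> ?F. x \<in> B} = l"
      using count by metis
  qed simp
  also have "\<dots> = (CARD('a) - t) * l"
    using T by (simp add: Compl_eq_Diff_UNIV card_Diff_subset)
  finally have "(\<Sum>B\<in>?F. card (B \<inter> - T)) = (CARD('a) - t) * l" .
  moreover have "card (B \<inter> - T) = k - t" if "B \<in> ?F" for B
  proof -
    have "card (B - T) = k - t"
      using that T block by (subst card_Diff_subset) auto
    then show ?thesis
      by (simp add: Diff_eq)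
  qed
  ultimately show ?thesis
    by (simp add: mult.commute)
qed

locale steiner_4_7_23 =
  fixes \<B> :: "'a::finite set set"
  assumes card_UNIV: "CARD('a) = 23"
    and block: "B \<in> \<B> \<Longrightarrow> card B = 7"
    and inter: "B \<in> \<B> \<Longrightarrow> C \<in> \<B> \<Longrightarrow> B \<noteq> C \<Longrightarrow> card (B \<inter> C) = 1 \<or> card (B \<inter> C) = 3"
    and count4: "card T = 4 \<Longrightarrow> card {B \<in> \<B>. T \<subseteq> B} = 1"
begin

lemma count3: "card T = 3 \<Longrightarrow> card {B \<in> \<B>. T \<subseteq> B} = 5"
  using steiner_count_step[of \<B> 7 3 1 T] block count4 by (simp add: card_UNIV)

lemma count2: "card T = 2 \<Longrightarrow> card {B \<in> \<B>. T \<subseteq> B} = 21"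
  using steiner_count_step[of \<B> 7 2 5 T] block count3 by (simp add: card_UNIV)

lemma count1: "card T = 1 \<Longrightarrow> card {B \<in> \<B>. T \<subseteq> B} = 77"
  using steiner_count_step[of \<B> 7 1 21 T] block count2 by (simp add: card_UNIV numeral_2_eq_2)

text \<open>Points of \<open>D\<close> inside \<open>T\<close> lie on all \<open>l\<close> blocks,
  the others on \<open>l'\<close> of them.\<close>

lemma sum_card_Int_containing:
  assumes l: "card {B \<in> \<B>. T \<subseteq> B} = l"
    and l': "\<And>x. x \<notin> T \<Longrightarrow> card {B \<in> \<B>. insert x T \<subseteq> B} = l'"
  shows "(\<Sum>B | B \<in> \<B> \<and> T \<subseteq> B. card (B \<inter> D)) = card (T \<inter> D) * l + card (D - T) * l'"
proof -
  let ?F = "{B \<in> \<B>. T \<subseteq> B}"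
  have "(\<Sum>B\<in>?F. card (B \<inter> D)) = (\<Sum>x\<in>D. card {B \<in> ?F. x \<in> B})"
    by (intro sum_card_Int) auto
  also have "\<dots> = (\<Sum>x\<in>T \<inter> D. card {B \<in> ?F. x \<in> B}) + (\<Sum>x\<in>D - T. card {B \<in> ?F. x \<in> B})"
    by (subst sum.Int_Diff[of D _ T]) (simp_all add: Int_commute)
  also have "(\<Sum>x\<in>T \<inter> D. card {B \<in> ?F. x \<in> B}) = (\<Sum>x\<in>T \<inter> D. l)"
  proof (rule sum.cong)
    fix x assume "x \<in> T \<inter> D"
    then have "{B \<in> ?F. x \<in> B} = ?F"
      by auto
    then show "card {B \<in> ?F. x \<in> B} = l"
      using l by simp
  qed simp
  also have "(\<Sum>x\<in>D - T. card {B \<in> ?F. x \<in> B}) = (\<Sum>x\<in>D - T. l')"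
  proof (rule sum.cong)
    fix x assume "x \<in> D - T"
    moreover have "{B \<in> ?F. x \<in> B} = {B \<in> \<B>. insert x T \<subseteq> B}"
      by auto
    ultimately show "card {B \<in> ?F. x \<in> B} = l'"
      using l' by auto
  qed simp
  finally show ?thesis
    by simp
qed

lemma sum_card_Int_2:
  assumes "card T = 2"
  shows "(\<Sum>B | B \<in> \<B> \<and> T \<subseteq> B. card (B \<inter> D)) = card (T \<inter> D) * 21 + card (D - T) * 5"
  using assms by (intro sum_card_Int_containing count2 count3) auto

lemma sum_card_Int_3:
  assumes "card T = 3"
  shows "(\<Sum>B | B \<in> \<B> \<and> T \<subseteq> B. card (B \<inter> D)) = card (T \<inter> D) * 5 + card (D - T)"
proof -
  have "card {B \<in> \<B>. insert x T \<subseteq> B} = 1" if "x \<notin> T" for x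
    using that assms by (intro count4) simp
  from sum_card_Int_containing[OF count3[OF assms] this, of D] show ?thesis
    by simp
qed

text \<open>Sets meeting all blocks evenly are the words of the dual of the code spanned by the blocks.\<close>

lemma even_set_card_ge:
  assumes S: "S \<noteq> {}" and even: "\<And>B. B \<in> \<B> \<Longrightarrow> even (card (B \<inter> S))"
  shows "8 \<le> card S"
proof -
  have "card S \<noteq> 0"
    using S by simp
  then consider "card S = 1" | "card S = 2" | "3 \<le> card S"
    by linarith
  then show ?thesis
  proof cases
    case 1
    then have "{B \<in> \<B>. S \<subseteq> B} \<noteq> {}"
      using count1[OF 1] by (metis card.empty zero_neq_numeral)
    then obtain B where "B \<in> \<B>" "S \<subseteq> B"
      by auto
    then show ?thesis
      using even[of B] 1 by (simp add: Int_absorb1)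
  next
    case 2
    then obtain x y where S2: "S = {x, y}" "x \<noteq> y"
      by (auto simp: card_2_iff)
    have "{B \<in> \<B>. {x} \<subseteq> B} \<noteq> {B \<in> \<B>. S \<subseteq> B}"
      using count1[of "{x}"] count2[OF 2] by auto
    then obtain B where B: "B \<in> \<B>" "x \<in> B" "y \<notin> B"
      unfolding S2(1) by blast
    then have "B \<inter> S = {x}"
      using S2 by auto
    then show ?thesis
      using even[OF B(1)] by simp
  next
    case 3
    then obtain T where T: "T \<subseteq> S" "card T = 3"
      by (meson obtain_subset_with_card_n)
    let ?F = "{B \<in> \<B>. T \<subseteq> B}"
    have "4 \<le> card (B \<inter> S)" if "B \<in> ?F" for B
    proof -
      have "card T \<le> card (B \<inter> S)"
        using that T(1) by (intro card_mono) auto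
      moreover have "even (card (B \<inter> S))"
        using even that by auto
      ultimately show ?thesis
        using T(2) by (cases "card (B \<inter> S) = 3") auto
    qed
    \<comment> \<open>Five blocks pass through \<open>T\<close> and a point outside \<open>T\<close>
      lies on just one of them, so the bound forces five further points in \<open>S\<close>.\<close>
    then have "(\<Sum>B\<in>?F. 4) \<le> (\<Sum>B\<in>?F. card (B \<inter> S))"
      by (intro sum_mono) auto
    also have "\<dots> = 15 + card (S - T)"
      using sum_card_Int_3[OF T(2), of S] T by (simp add: Int_absorb2)
    finally have "5 \<le> card (S - T)"
      using count3[OF T(2)] by simp
    then show ?thesis
      using T by (simp add: card_Diff_subset)
  qed
qed

text \<open>\<open>S\<close> shares at least four points with the block through four of its points.
  Their symmetric difference has at most six points and meets all blocks evenly, so it is empty by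
  the minimum weight \<open>8\<close>.\<close>

lemma odd_set_block:
  assumes S: "card S = 7" and odd: "\<And>B. B \<in> \<B> \<Longrightarrow> odd (card (B \<inter> S))"
  shows "S \<in> \<B>"
proof -
  have "4 \<le> card S"
    using S by simp
  then obtain T where T: "T \<subseteq> S" "card T = 4"
    by (meson obtain_subset_with_card_n)
  then have "{B \<in> \<B>. T \<subseteq> B} \<noteq> {}"
    using count4[OF T(2)] by (metis card.empty zero_neq_one)
  then obtain B where B: "B \<in> \<B>" "T \<subseteq> B"
    by auto
  have "even (card (C \<inter> sym_diff S B))" if C: "C \<in> \<B>" for C
  proof -
    have "odd (card (C \<inter> B))"
      using inter[OF C B(1)] block[OF C] by (cases "C = B") auto
    then show ?thesis
      using odd[OF C] by (subst even_card_Int_sym_diff) auto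
  qed
  moreover have "card (sym_diff S B) < 8"
  proof -
    have "card T \<le> card (S \<inter> B)"
      using T(1) B(2) by (intro card_mono) auto
    then show ?thesis
      using card_sym_diff[of S B] S block[OF B(1)] T(2) by simp
  qed
  ultimately have "sym_diff S B = {}"
    using even_set_card_ge[of "sym_diff S B"] by fastforce
  then have "S = B"
    by blast
  with B(1) show ?thesis
    by simp
qed

lemma odd_card_Int_blocks: "B \<in> \<B> \<Longrightarrow> C \<in> \<B> \<Longrightarrow> odd (card (B \<inter> C))"
  using inter[of B C] block[of B] by (cases "B = C") auto

end

section \<open>The biplane attached to a set of eleven points\<close>

locale steiner_4_7_23_dodecad = steiner_4_7_23 \<B> for \<B> :: "'a::finite set set" +
  fixes D :: "'a set" and e :: 'a
  assumes card_D: "card D = 11"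
    and odd_D: "B \<in> \<B> \<Longrightarrow> odd (card (B \<inter> D))"
    and e: "e \<notin> D"
begin

text \<open>These blocks induce the biplane on the points outside \<open>D\<close> other than
  \<open>e\<close>.\<close>

definition W :: "'a set set" where "W = {B \<in> \<B>. e \<in> B \<and> card (B \<inter> D) = 1}"

lemma W_block: "B \<in> W \<Longrightarrow> B \<in> \<B>"
  by (simp add: W_def)

lemma card_compl_D: "card (- D) = 12"
  by (simp add: Compl_eq_Diff_UNIV card_Diff_subset card_UNIV card_D)

lemma card_Int_compl_D: "B \<in> \<B> \<Longrightarrow> card (B \<inter> - D) = 7 - card (B \<inter> D)"
  using block[of B] card_Int_Diff[of B D] by (simp add: Diff_eq)

lemma even_compl_D: "B \<in> \<B> \<Longrightarrow> even (card (B \<inter> - D))"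
  using odd_D[of B] card_mono[of B "B \<inter> D"] block[of B] by (simp add: card_Int_compl_D)

text \<open>Each of the five blocks through \<open>e\<close>, \<open>x\<close>, \<open>y\<close>
  meets \<open>D\<close> in one or three points. Together they cover the eleven points of
  \<open>D\<close> once, which forces two of the first kind.\<close>

lemma card_W_pair:
  assumes "x \<notin> D" "y \<notin> D" "x \<noteq> e" "y \<noteq> e" "x \<noteq> y"
  shows "card {B \<in> W. x \<in> B \<and> y \<in> B} = 2"
proof -
  let ?T = "{e, x, y}"
  let ?F = "{B \<in> \<B>. ?T \<subseteq> B}" and ?j = "\<lambda>B. card (B \<inter> D)"
  have T: "card ?T = 3"
    using assms by simp
  have "?j B + (if ?j B = 1 then 2 else 0) = 3" if "B \<in> ?F" for B
  proof -
    have "card ?T \<le> card (B \<inter> - D)"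
      using that assms e by (intro card_mono) auto
    then have "?j B \<le> 4"
      using that T card_Int_compl_D[of B] by simp
    moreover have "odd (?j B)"
      using that odd_D by simp
    ultimately have "?j B = 1 \<or> ?j B = 3"
      by presburger
    then show ?thesis
      by auto
  qed
  then have "(\<Sum>B\<in>?F. ?j B + (if ?j B = 1 then 2 else 0)) = (\<Sum>B\<in>?F. 3)"
    by (intro sum.cong) auto
  then have "(\<Sum>B\<in>?F. ?j B) + 2 * card {B \<in> ?F. ?j B = 1} = 15"
    using count3[OF T] by (simp add: sum.distrib sum.If_cases Int_def)
  moreover have "(\<Sum>B\<in>?F. ?j B) = 11"
    using sum_card_Int_3[OF T, of D] assms e card_D by (simp add: Diff_triv)
  moreover have "{B \<in> ?F. ?j B = 1} = {B \<in> W. x \<in> B \<and> y \<in> B}"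
    by (auto simp: W_def)
  ultimately show ?thesis
    by simp
qed

text \<open>The sum of \<open>(j - 3)(j - 5)\<close>, where \<open>j\<close> runs over the sizes of the intersections with \<open>D\<close>, counts the
  blocks with \<open>j = 1\<close> eight times.\<close>

lemma card_W_point:
  assumes d: "d \<in> D"
  shows "card {B \<in> W. d \<in> B} = 1"
proof -
  let ?T = "{d, e}"
  let ?F = "{B \<in> \<B>. ?T \<subseteq> B}" and ?j = "\<lambda>B. card (B \<inter> D)"
  have "d \<noteq> e"
    using d e by blast
  then have T: "card ?T = 2"
    by simp
  have "(?j B)\<^sup>2 + 15 = 8 * ?j B + (if ?j B = 1 then 8 else 0)" if "B \<in> ?F" for B
  proof -
    have "card (B \<inter> D) < card B"
      using that e by (intro psubset_card_mono) auto
    then have "?j B < 7"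
      using that block by simp
    moreover have "odd (?j B)"
      using that odd_D by simp
    ultimately have "?j B = 1 \<or> ?j B = 3 \<or> ?j B = 5"
      by presburger
    then show ?thesis
      by auto
  qed
  then have "(\<Sum>B\<in>?F. (?j B)\<^sup>2 + 15) = (\<Sum>B\<in>?F. 8 * ?j B + (if ?j B = 1 then 8 else 0))"
    by (intro sum.cong) auto
  then have *: "(\<Sum>B\<in>?F. (?j B)\<^sup>2) + 315 = 8 * (\<Sum>B\<in>?F. ?j B) + 8 * card {B \<in> ?F. ?j B = 1}"
    using count2[OF T] by (simp add: sum.distrib sum.If_cases Int_def sum_distrib_left)
  have "?T \<inter> D = {d}"
    using d e by auto
  moreover have "D - ?T = D - {d}"
    using e by auto
  then have "card (D - ?T) = 10"
    using d card_D by (simp add: card_Diff_singleton)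
  \<comment> \<open>The point \<open>d\<close> lies on all 21 blocks and each of the ten others on
    five, so the total is \<open>21 + 50\<close>.\<close>
  ultimately have j1: "(\<Sum>B\<in>?F. ?j B) = 71"
    using sum_card_Int_2[OF T, of D] by simp
  \<comment> \<open>Here \<open>j^2\<close> is \<open>j\<close> summed over the points of
    \<open>B \<inter> D\<close>. After exchanging the sums, points other than \<open>d\<close>
    contribute \<open>2 * 5 + 9 = 19\<close> each.\<close>
  have "(\<Sum>B\<in>?F. (?j B)\<^sup>2) = (\<Sum>B\<in>?F. \<Sum>x | x \<in> D \<and> x \<in> B. ?j B)"
    by (simp add: power2_eq_square Int_def conj_commute)
  also have "\<dots> = (\<Sum>x\<in>D. \<Sum>B | B \<in> ?F \<and> x \<in> B. ?j B)"
    by (rule sum.swap_restrict) auto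
  also have "\<dots> = (\<Sum>x\<in>D. if x = d then 71 else 19)"
  proof (rule sum.cong)
    fix x assume x: "x \<in> D"
    show "(\<Sum>B | B \<in> ?F \<and> x \<in> B. ?j B) = (if x = d then 71 else 19)"
    proof (cases "x = d")
      case True
      then have "{B. B \<in> ?F \<and> x \<in> B} = ?F"
        by auto
      then show ?thesis
        using True j1 by simp
    next
      case False
      let ?T' = "{x, d, e}"
      have "x \<noteq> e"
        using x e by blast
      then have T': "card ?T' = 3"
        using False \<open>d \<noteq> e\<close> by simp
      have "?T' \<inter> D = {x, d}"
        using d e x by auto
      moreover have "card (D - ?T') = card (D - {x, d})"
        using e by (intro arg_cong[where f=card]) auto
      moreover have "\<dots> = 9"
        using d x False card_D by (simp add: card_Diff_subset)
      ultimately have "(\<Sum>B | B \<in> \<B> \<and> ?T' \<subseteq> B. ?j B) = 19"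
        using sum_card_Int_3[OF T', of D] False by simp
      moreover have "{B. B \<in> ?F \<and> x \<in> B} = {B. B \<in> \<B> \<and> ?T' \<subseteq> B}"
        by auto
      ultimately show ?thesis
        using False by simp
    qed
  qed simp
  also have "\<dots> = 71 + 10 * 19"
    using d card_D by (simp add: sum.remove[of D d])
  finally have "card {B \<in> ?F. ?j B = 1} = 1"
    using * j1 by simp
  moreover have "{B \<in> ?F. ?j B = 1} = {B \<in> W. d \<in> B}"
    by (auto simp: W_def)
  ultimately show ?thesis
    by simp
qed

lemma W_eqI:
  assumes "B \<in> W" "C \<in> W" "d \<in> B \<inter> C \<inter> D"
  shows "B = C"
proof -
  obtain A where A: "{B \<in> W. d \<in> B} = {A}"
    using card_W_point[of d] assms(3) by (auto simp: card_1_singleton_iff)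
  have "B \<in> {B \<in> W. d \<in> B}" "C \<in> {B \<in> W. d \<in> B}"
    using assms by auto
  then show ?thesis
    unfolding A by simp
qed

text \<open>Otherwise \<open>B\<close> and \<open>C\<close> meet in \<open>e\<close> only. Their
  symmetric difference then has ten of its twelve points outside \<open>D\<close>, and adding the
  complement of \<open>D\<close> leaves four points that meet all blocks evenly, against the minimum
  weight \<open>8\<close>.\<close>

lemma card_W_Int:
  assumes B: "B \<in> W" and C: "C \<in> W" and "B \<noteq> C"
  shows "card (B \<inter> C) = 3"
proof (rule ccontr)
  assume "card (B \<inter> C) \<noteq> 3"
  then have "card (B \<inter> C) = 1"
    using inter[of B C] assms W_block by auto
  then have BC: "card (sym_diff B C) = 12"
    using card_sym_diff[of B C] block B C W_block by simp
  have "B \<inter> D \<inter> (C \<inter> D) = {}"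
    using W_eqI[OF B C] assms(3) by auto
  moreover have "- D \<inter> sym_diff B C = sym_diff B C - (B \<inter> D \<union> C \<inter> D)"
    using calculation by blast
  moreover have "B \<inter> D \<union> C \<inter> D \<subseteq> sym_diff B C"
    using calculation by blast
  ultimately have "card (- D \<inter> sym_diff B C) = 10"
    using B C BC by (simp add: card_Diff_subset card_Un_disjoint W_def)
  then have "card (sym_diff (- D) (sym_diff B C)) = 4"
    using card_sym_diff[of "- D" "sym_diff B C"] BC card_compl_D by simp
  moreover have "even (card (A \<inter> sym_diff (- D) (sym_diff B C)))" if A: "A \<in> \<B>" for A
  proof -
    have "even (card (A \<inter> sym_diff B C))"
      using odd_card_Int_blocks[OF A W_block[OF B]] odd_card_Int_blocks[OF A W_block[OF C]]
      by (subst even_card_Int_sym_diff) auto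
    then show ?thesis
      using even_compl_D[OF A] by (subst even_card_Int_sym_diff) auto
  qed
  moreover from calculation(1) have "sym_diff (- D) (sym_diff B C) \<noteq> {}"
    by (metis card.empty zero_neq_numeral)
  ultimately have "8 \<le> card (sym_diff (- D) (sym_diff B C))"
    by (intro even_set_card_ge)
  with \<open>card (sym_diff (- D) (sym_diff B C)) = 4\<close> show False
    by simp
qed

end

section \<open>Pentagons on five points\<close>

text \<open>The edges 0--4 form the cycle on the vertices 0--4, the edges 5--9 the pentagram.\<close>

definition pentagon_edge :: "nat \<Rightarrow> nat set" where
  "pentagon_edge k = (if k < 5 then {k, (k + 1) mod 5} else {k - 5, (k - 3) mod 5})"

lemma less_five_cases: "(i::nat) < 5 \<longleftrightarrow> i = 0 \<or> i = 1 \<or> i = 2 \<or> i = 3 \<or> i = 4"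
  by auto

lemma less_ten_cases:
  "(i::nat) < 10 \<longleftrightarrow> i = 0 \<or> i = 1 \<or> i = 2 \<or> i = 3 \<or> i = 4 \<or> i = 5 \<or> i = 6 \<or> i = 7 \<or> i = 8 \<or> i = 9"
  by auto

lemma pentagon_edge_simps:
  "pentagon_edge 0 = {0, 1}" "pentagon_edge (Suc 0) = {1, 2}" "pentagon_edge 1 = {1, 2}"
  "pentagon_edge 2 = {2, 3}" "pentagon_edge 3 = {3, 4}"
  "pentagon_edge 4 = {4, 0}" "pentagon_edge 5 = {0, 2}" "pentagon_edge 6 = {1, 3}"
  "pentagon_edge 7 = {2, 4}" "pentagon_edge 8 = {3, 0}" "pentagon_edge 9 = {4, 1}"
  by (simp_all add: pentagon_edge_def) (simp_all add: numeral_2_eq_2)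

lemma inj_on_pentagon_edge: "inj_on pentagon_edge {..<10}"
  by (rule inj_onI)
    (auto simp: less_ten_cases pentagon_edge_simps doubleton_eq_iff simp del: One_nat_def)

lemma card_pentagon_edge: "k < 10 \<Longrightarrow> card (pentagon_edge k) = 2"
  by (auto simp: less_ten_cases pentagon_edge_simps)

lemma pentagon_edge_subset: "k < 10 \<Longrightarrow> pentagon_edge k \<subseteq> {..<5}"
  by (auto simp: less_ten_cases pentagon_edge_simps)

text \<open>The numbering reaches all pairs because its ten images are distinct and a five-element
  set has ten pairs.\<close>

lemma pentagon_edges:
  assumes p: "bij_betw p {..<5::nat} V"
  shows "bij_betw (\<lambda>k. p ` pentagon_edge k) {..<10} {A. A \<subseteq> V \<and> card A = 2}"
proof -
  have pinj: "inj_on p {..<5}"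
    using p by (simp add: bij_betw_def)
  have fin: "finite V"
    using p bij_betw_finite by blast
  have "inj_on (\<lambda>k. p ` pentagon_edge k) {..<10}"
  proof (rule inj_onI)
    fix k l :: nat assume kl: "k \<in> {..<10}" "l \<in> {..<10}" "p ` pentagon_edge k = p ` pentagon_edge l"
    then have "pentagon_edge k = pentagon_edge l"
      using inj_on_image_eq_iff[OF pinj] pentagon_edge_subset by simp
    then show "k = l"
      using kl inj_on_pentagon_edge by (simp add: inj_on_eq_iff)
  qed
  moreover have "(\<lambda>k. p ` pentagon_edge k) ` {..<10} = {A. A \<subseteq> V \<and> card A = 2}"
  proof (rule card_subset_eq)
    show "finite {A. A \<subseteq> V \<and> card A = 2}"
      using fin by simp
    show "(\<lambda>k. p ` pentagon_edge k) ` {..<10} \<subseteq> {A. A \<subseteq> V \<and> card A = 2}"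
    proof clarsimp
      fix k :: nat assume k: "k < 10"
      have "inj_on p (pentagon_edge k)"
        using inj_on_subset[OF pinj pentagon_edge_subset[OF k]] .
      moreover have "p ` {..<5} = V"
        using p by (simp add: bij_betw_def)
      ultimately show "p ` pentagon_edge k \<subseteq> V \<and> card (p ` pentagon_edge k) = 2"
        using pentagon_edge_subset[OF k] card_pentagon_edge[OF k] by (auto simp: card_image)
    qed
    have "card V = 5"
      using bij_betw_same_card[OF p] by simp
    then have "card {A. A \<subseteq> V \<and> card A = 2} = 10"
      using n_subsets[OF fin, of 2] by (simp add: choose_two)
    then show "card ((\<lambda>k. p ` pentagon_edge k) ` {..<10}) = card {A. A \<subseteq> V \<and> card A = 2}"
      using card_image[OF calculation] by simp
  qed
  ultimately show ?thesis
    by (simp add: bij_betw_def)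
qed

text \<open>Cardinalities are rewritten as sums of zero-one unknowns, which reduces the
  classification of the graphs to small linear systems.\<close>

lemma card_filter_eq_sum: "finite A \<Longrightarrow> card {x \<in> A. P x} = (\<Sum>x\<in>A. of_bool (P x))"
  by (simp add: Int_def)

lemma of_bool_eq_Suc_0: "of_bool P = Suc 0 \<longleftrightarrow> P"
  by (cases P) auto

lemma two_regular_degree:
  assumes G: "\<And>A. A \<in> G \<Longrightarrow> A \<subseteq> V \<and> card A = 2" and V: "finite V"
    and deg: "card {A \<in> G. a \<in> A} = 2"
  shows "(\<Sum>b\<in>V - {a}. of_bool ({a, b} \<in> G)) = (2::nat)"
proof -
  have "{A \<in> G. a \<in> A} = (\<lambda>b. {a, b}) ` {b \<in> V - {a}. {a, b} \<in> G}"
  proof (intro set_eqI iffI)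
    fix A assume A: "A \<in> {A \<in> G. a \<in> A}"
    then obtain b where "A = {a, b}" "a \<noteq> b"
      using G[of A] by (auto simp: card_2_iff)
    then show "A \<in> (\<lambda>b. {a, b}) ` {b \<in> V - {a}. {a, b} \<in> G}"
      using A G[of A] by auto
  qed auto
  moreover have "inj_on (\<lambda>b. {a, b}) {b \<in> V - {a}. {a, b} \<in> G}"
    by (auto intro!: inj_onI simp: doubleton_eq_iff)
  ultimately have "card {b \<in> V - {a}. {a, b} \<in> G} = 2"
    using deg by (simp add: card_image)
  then show ?thesis
    by (subst card_filter_eq_sum[symmetric]) (use V in simp_all)
qed

text \<open>A simple two-regular graph on five vertices is a cycle. Once the two neighbours of
  \<open>a0\<close> are fixed, the degree equations of the other four vertices have one solution up
  to exchanging \<open>x\<close> and \<open>y\<close>.\<close>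

lemma two_regular_pentagon:
  assumes V: "card V = 5" and G: "\<And>A. A \<in> G \<Longrightarrow> A \<subseteq> V \<and> card A = 2"
    and deg: "\<And>a. a \<in> V \<Longrightarrow> card {A \<in> G. a \<in> A} = 2"
  obtains p where "bij_betw p {..<5::nat} V" "\<And>k. k < 10 \<Longrightarrow> p ` pentagon_edge k \<in> G \<longleftrightarrow> k < 5"
proof -
  have fin: "finite V"
    using V card.infinite by fastforce
  have deg': "(\<Sum>b\<in>V - {a}. of_bool ({a, b} \<in> G)) = (2::nat)" if "a \<in> V" for a
    by (rule two_regular_degree[OF G fin deg[OF that]])
  obtain a0 where a0: "a0 \<in> V"
    using V by fastforce
  have "card {b \<in> V - {a0}. {a0, b} \<in> G} = 2"
    by (subst card_filter_eq_sum) (use fin deg'[OF a0] in \<open>simp_all del: sum_of_bool_eq\<close>)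
  then obtain a1 a4 where N0: "{b \<in> V - {a0}. {a0, b} \<in> G} = {a1, a4}" "a1 \<noteq> a4"
    by (auto simp: card_2_iff)
  have "a1 \<in> {b \<in> V - {a0}. {a0, b} \<in> G}" "a4 \<in> {b \<in> V - {a0}. {a0, b} \<in> G}"
    unfolding N0(1) by simp_all
  then have a14: "a1 \<in> V" "a1 \<noteq> a0" "{a0, a1} \<in> G" "a4 \<in> V" "a4 \<noteq> a0" "{a0, a4} \<in> G"
    by simp_all
  have "card (V - {a0, a1, a4}) = 2"
    using a14 N0(2) a0 V by (subst card_Diff_subset) simp_all
  then obtain x y where xy: "V - {a0, a1, a4} = {x, y}" "x \<noteq> y"
    by (auto simp: card_2_iff)
  have "x \<in> V - {a0, a1, a4}" "y \<in> V - {a0, a1, a4}"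
    unfolding xy(1) by simp_all
  then have dist: "a0 \<noteq> a1" "a0 \<noteq> a4" "a1 \<noteq> a4" "a0 \<noteq> x" "a0 \<noteq> y" "a1 \<noteq> x" "a1 \<noteq> y" "a4 \<noteq> x" "a4 \<noteq> y" "x \<noteq> y"
    and mem: "a1 \<in> V" "a4 \<in> V" "x \<in> V" "y \<in> V"
    using a14 N0(2) xy(2) by auto
  have "V = {a0, a1, a4} \<union> (V - {a0, a1, a4})"
    using a0 a14 by blast
  then have Veq: "V = {a0, a1, a4, x, y}"
    unfolding xy(1) by auto
  have "x \<notin> {b \<in> V - {a0}. {a0, b} \<in> G}" "y \<notin> {b \<in> V - {a0}. {a0, b} \<in> G}"
    unfolding N0(1) using dist by simp_all
  then have e0: "{a0, a1} \<in> G" "{a0, a4} \<in> G" "{a0, x} \<notin> G" "{a0, y} \<notin> G"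
    using a14 mem dist by simp_all
  have comm: "{a1, a0} = {a0, a1}" "{a4, a0} = {a0, a4}" "{x, a0} = {a0, x}" "{y, a0} = {a0, y}"
    "{a4, a1} = {a1, a4}" "{x, a1} = {a1, x}" "{y, a1} = {a1, y}" "{x, a4} = {a4, x}" "{y, a4} = {a4, y}" "{y, x} = {x, y}"
    by auto
  \<comment> \<open>The edge to \<open>a0\<close> already uses one degree of \<open>a1\<close> and
    of \<open>a4\<close>, while \<open>x\<close> and \<open>y\<close> still need two.\<close>
  have r1: "of_bool ({a1, a4} \<in> G) + of_bool ({a1, x} \<in> G) + of_bool ({a1, y} \<in> G) = (1::nat)"
    using deg'[OF mem(1)] dist e0 by (simp add: Veq insert_Diff_if comm del: sum_of_bool_eq)
  have r4: "of_bool ({a1, a4} \<in> G) + of_bool ({a4, x} \<in> G) + of_bool ({a4, y} \<in> G) = (1::nat)"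
    using deg'[OF mem(2)] dist e0 by (simp add: Veq insert_Diff_if comm del: sum_of_bool_eq)
  have rx: "of_bool ({a1, x} \<in> G) + of_bool ({a4, x} \<in> G) + of_bool ({x, y} \<in> G) = (2::nat)"
    using deg'[OF mem(3)] dist e0 by (simp add: Veq insert_Diff_if comm del: sum_of_bool_eq)
  have ry: "of_bool ({a1, y} \<in> G) + of_bool ({a4, y} \<in> G) + of_bool ({x, y} \<in> G) = (2::nat)"
    using deg'[OF mem(4)] dist e0 by (simp add: Veq insert_Diff_if comm del: sum_of_bool_eq)
  \<comment> \<open>An edge between \<open>a1\<close> and \<open>a4\<close> would exhaust both and
    leave \<open>x\<close> and \<open>y\<close> with at most one edge each, so a path from
    \<open>a1\<close> to \<open>a4\<close> runs through \<open>x\<close> and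
    \<open>y\<close>.\<close>
  have "{a1, x} \<in> G \<and> {a1, y} \<notin> G \<and> {a1, a4} \<notin> G \<and> {a4, y} \<in> G \<and> {a4, x} \<notin> G \<and> {x, y} \<in> G \<or>
      {a1, y} \<in> G \<and> {a1, x} \<notin> G \<and> {a1, a4} \<notin> G \<and> {a4, x} \<in> G \<and> {a4, y} \<notin> G \<and> {x, y} \<in> G"
    using r1 r4 rx ry
    by (cases "{a1, x} \<in> G"; cases "{a1, y} \<in> G"; cases "{a1, a4} \<in> G"; cases "{x, y} \<in> G"; simp add: of_bool_eq_Suc_0)
  moreover have "V = {a0, a1, x, y, a4}" "V = {a0, a1, y, x, a4}"
    unfolding Veq by auto
  ultimately have "\<exists>a2 a3. V = {a0, a1, a2, a3, a4} \<and> {a1, a2} \<in> G \<and> {a2, a3} \<in> G \<and> {a3, a4} \<in> G \<and>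
      {a0, a2} \<notin> G \<and> {a1, a3} \<notin> G \<and> {a2, a4} \<notin> G \<and> {a3, a0} \<notin> G \<and> {a4, a1} \<notin> G"
    using e0(3,4) comm by metis
  then obtain a2 a3 where a: "V = {a0, a1, a2, a3, a4}" "{a1, a2} \<in> G" "{a2, a3} \<in> G" "{a3, a4} \<in> G"
    "{a0, a2} \<notin> G" "{a1, a3} \<notin> G" "{a2, a4} \<notin> G" "{a3, a0} \<notin> G" "{a4, a1} \<notin> G"
    by blast
  define p where "p = (\<lambda>i. [a0, a1, a2, a3, a4] ! i)"
  have "{..<5::nat} = {0, 1, 2, 3, 4}"
    by auto
  then have "p ` {..<5} = V"
    by (simp add: p_def a(1))
  then have "bij_betw p {..<5} V"
    using V by (simp add: bij_betw_def eq_card_imp_inj_on)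
  moreover have "p ` pentagon_edge k \<in> G \<longleftrightarrow> k < 5" if "k < 10" for k
    using that a(2-) e0(1,2) unfolding less_ten_cases
    by (elim disjE) (simp_all add: pentagon_edge_simps p_def comm(2) del: One_nat_def)
  ultimately show ?thesis
    by (rule that)
qed

text \<open>The five pentagons that have exactly two edges in common with the cycle.\<close>

definition pentagon_switch :: "nat \<Rightarrow> nat set" where
  "pentagon_switch i = [{1, 3, 5, 8, 9}, {2, 4, 5, 6, 9}, {0, 3, 5, 6, 7}, {1, 4, 6, 7, 8}, {0, 2, 7, 8, 9}] ! i"

text \<open>Six linear equations in ten zero-one unknowns, one for the common edges and one per
  vertex. They leave five possibilities for any further pentagon once the first is numbered as the
  cycle.\<close>

lemma pentagon_switch_cases:
  assumes H: "H \<subseteq> {..<10::nat}" and c: "card (H \<inter> {..<5}) = 2"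
    and rows: "\<And>i. i < 5 \<Longrightarrow> card {k \<in> H. i \<in> pentagon_edge k} = 2"
  obtains i where "i < 5" "H = pentagon_switch i"
proof -
  have row: "(\<Sum>k<10. of_bool (k \<in> H \<and> i \<in> pentagon_edge k)) = (2::nat)" if "i < 5" for i
  proof -
    have "{k \<in> H. i \<in> pentagon_edge k} = {k \<in> {..<10}. k \<in> H \<and> i \<in> pentagon_edge k}"
      using H by auto
    then show ?thesis
      using rows[OF that] by (subst card_filter_eq_sum[symmetric]) simp_all
  qed
  have "H \<inter> {..<5} = {k \<in> {..<5}. k \<in> H}"
    by auto
  then have c': "(\<Sum>k<5. of_bool (k \<in> H)) = (2::nat)"
    using c by (subst card_filter_eq_sum[symmetric]) simp_all
  let ?h = "\<lambda>k. of_bool (k \<in> H) :: nat"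
  have ten: "{..<10::nat} = {0, 1, 2, 3, 4, 5, 6, 7, 8, 9}" and five: "{..<5::nat} = {0, 1, 2, 3, 4}"
    by auto
  note s = ten five pentagon_edge_simps
  have c: "?h 0 + ?h 1 + ?h 2 + ?h 3 + ?h 4 = 2"
    using c' by (simp add: s del: sum_of_bool_eq)
  have r: "?h 0 + ?h 4 + ?h 5 + ?h 8 = 2" "?h 0 + ?h 1 + ?h 6 + ?h 9 = 2" "?h 1 + ?h 2 + ?h 5 + ?h 7 = 2"
    "?h 2 + ?h 3 + ?h 6 + ?h 8 = 2" "?h 3 + ?h 4 + ?h 7 + ?h 9 = 2"
    using row[of 0] row[of 1] row[of 2] row[of 3] row[of 4] by (simp_all add: s del: sum_of_bool_eq)
  have "H \<subseteq> {0, 1, 2, 3, 4, 5, 6, 7, 8, 9}"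
    using H ten by simp
  then have eqI: "H = A \<longleftrightarrow> (\<forall>k\<in>{0, 1, 2, 3, 4, 5, 6, 7, 8, 9}. k \<in> H \<longleftrightarrow> k \<in> A)" if "A \<subseteq> {0, 1, 2, 3, 4, 5, 6, 7, 8, 9}" for A
    using that by blast
  have "H = {1, 3, 5, 8, 9} \<or> H = {2, 4, 5, 6, 9} \<or> H = {0, 3, 5, 6, 7} \<or> H = {1, 4, 6, 7, 8} \<or> H = {0, 2, 7, 8, 9}"
    using c r
    apply (subst (1 2 3 4 5) eqI)
    apply (simp_all del: One_nat_def)
    \<comment> \<open>The memberships of the edges \<open>0\<close> to \<open>5\<close> determine
      those of \<open>6\<close> to \<open>9\<close> through the vertex equations.\<close>
    by (cases "0 \<in> H"; cases "1 \<in> H"; cases "2 \<in> H"; cases "3 \<in> H"; cases "4 \<in> H"; cases "5 \<in> H";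
        simp add: of_bool_eq_Suc_0)
  then have "\<exists>i<5. H = pentagon_switch i"
    unfolding pentagon_switch_def
    by (elim disjE) (rule exI[of _ 0] exI[of _ 1] exI[of _ 2] exI[of _ 3] exI[of _ 4], simp)+
  then show ?thesis
    using that by blast
qed

lemma card_pentagon_switch: "i < 5 \<Longrightarrow> card (pentagon_switch i) = 5"
  by (auto simp: less_five_cases pentagon_switch_def)

section \<open>The binary code in coordinates\<close>

lemma xor_sum_subset:
  assumes "\<And>i. i \<in> I \<Longrightarrow> w i \<subseteq> S"
  shows "xor_sum I w \<subseteq> S"
proof
  fix y assume "y \<in> xor_sum I w"
  then have "odd (card {i \<in> I. y \<in> w i})"
    by (simp add: xor_sum_def)
  then have "{i \<in> I. y \<in> w i} \<noteq> {}"
    by (rule odd_card_imp_not_empty)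
  then show "y \<in> S"
    using assms by auto
qed

lemma image_xor_sum:
  assumes "inj_on f S" "\<And>i. i \<in> I \<Longrightarrow> w i \<subseteq> S"
  shows "f ` xor_sum I w = xor_sum I (\<lambda>i. f ` w i)"
proof -
  have sub: "xor_sum I w \<subseteq> S"
    using assms(2) by (rule xor_sum_subset)
  have sub': "xor_sum I (\<lambda>i. f ` w i) \<subseteq> f ` S"
    using assms(2) by (intro xor_sum_subset image_mono)
  have eq: "f x \<in> xor_sum I (\<lambda>i. f ` w i) \<longleftrightarrow> x \<in> xor_sum I w" if "x \<in> S" for x
  proof -
    have "{i \<in> I. f x \<in> f ` w i} = {i \<in> I. x \<in> w i}"
      using inj_on_image_mem_iff[OF assms(1) that assms(2)] by blast
    then show ?thesis
      by (simp add: xor_sum_def)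
  qed
  show ?thesis
    using sub sub' eq by blast
qed

text \<open>Indices below \<open>5\<close> keep the numbering of the switches; index
  \<open>5\<close> is the base cycle itself.\<close>

definition pentagon_set :: "nat \<Rightarrow> nat set" where
  "pentagon_set a = (if a = 5 then {..<5} else pentagon_switch a)"

text \<open>The coordinates 0--10 are the points of a dodecad word \<open>D\<close>, 11 is the base point outside it,
  12--16 are the remaining points of the first block, and 17--22 are the six pentagons on them.\<close>

definition code_block :: "nat \<Rightarrow> nat set" where
  "code_block i = (if i = 0 then {0, 11} \<union> (\<lambda>j. j + 12) ` {..<5}
     else {i, 11} \<union> (\<lambda>j. j + 12) ` pentagon_edge (i - 1) \<union> (\<lambda>a. a + 17) ` {a. a < 6 \<and> i - 1 \<in> pentagon_set a})"

text \<open>Weight-seven words of the code spanned by the eleven words \<open>code_block i\<close>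
  and \<open>{11..<23}\<close>. Since \<open>code_block i\<close> meets the first eleven coordinates
  in \<open>i\<close> alone, the trace of \<open>b\<close> there says which blocks occur in the sum,
  and only the optional extra word is left to try.\<close>

definition code_words :: "nat set set" where
  "code_words = {b. b \<subseteq> {..<23} \<and> card b = 7 \<and> odd (card (b \<inter> {..<11})) \<and>
     (xor_sum (b \<inter> {..<11}) code_block = b \<or> sym_diff (xor_sum (b \<inter> {..<11}) code_block) {11..<23} = b)}"

lemma code_block_subset:
  assumes "i < 11"
  shows "code_block i \<subseteq> {..<23}"
proof (cases i)
  case (Suc k)
  then have "pentagon_edge k \<subseteq> {..<5}"
    using assms by (intro pentagon_edge_subset) simp
  then show ?thesis
    using assms Suc by (auto simp: code_block_def)
qed (auto simp: code_block_def)

lemma code_block_Int: "i < 11 \<Longrightarrow> code_block i \<inter> {..<11} = {i}"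
  by (auto simp: code_block_def)

section \<open>Coordinates for an arbitrary design\<close>

context steiner_4_7_23_dodecad
begin

text \<open>One block \<open>W0\<close> of the biplane gives five vertices \<open>V\<close>. The
  other ten blocks correspond to the edges on \<open>V\<close>, and each of the six points
  \<open>Q\<close> off \<open>W0\<close> yields a pentagon of edges. All labels follow from
  numbering the vertices along one of these pentagons.\<close>

lemma ex_code_coordinates:
  obtains \<phi> :: "nat \<Rightarrow> 'a" where "bij_betw \<phi> {..<23} UNIV" "\<phi> ` {..<11} = D"
    "\<And>i. i < 11 \<Longrightarrow> \<phi> ` code_block i \<in> \<B>"
proof -
  have "D \<noteq> {}"
    using card_D by auto
  then obtain d where "d \<in> D"
    by auto
  then obtain W0 where "{B \<in> W. d \<in> B} = {W0}"
    using card_W_point by (meson card_1_singletonE)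
  then have W0: "W0 \<in> W"
    by auto
  have WD: "\<exists>d. B \<inter> D = {d}" if "B \<in> W" for B
    using that unfolding W_def by (auto simp: card_1_singleton_iff)
  have eW: "e \<in> B" if "B \<in> W" for B
    using that by (simp add: W_def)
  define V where "V = W0 - D - {e}"
  define Q where "Q = - D - W0"
  have card_W0: "card (W0 \<inter> - D) = 6"
    using W0 card_Int_compl_D[of W0] by (simp add: W_def)
  have V_alt: "V = (W0 \<inter> - D) - {e}"
    by (auto simp: V_def)
  have card_V: "card V = 5"
    unfolding V_alt using card_W0 W0 e eW by (subst card_Diff_subset) auto
  have card_Q: "card Q = 6"
  proof -
    have "Q = - D - (W0 \<inter> - D)"
      by (auto simp: Q_def)
    then show ?thesis
      using card_W0 card_compl_D by (simp add: card_Diff_subset)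
  qed
  have W0_eq: "W0 = (W0 \<inter> D) \<union> insert e V"
    using eW[OF W0] by (auto simp: V_def)
  \<comment> \<open>\<open>B\<close> and \<open>W0\<close> share three points: \<open>e\<close> and
    two in \<open>V\<close>, since no point of \<open>D\<close> is on both.\<close>
  have card_edge: "B \<inter> V \<subseteq> V \<and> card (B \<inter> V) = 2" if B: "B \<in> W" "B \<noteq> W0" for B
  proof -
    have "B \<inter> W0 \<inter> D = {}"
      using W_eqI[OF B(1) W0] B(2) by auto
    then have "B \<inter> W0 = insert e (B \<inter> V)"
      using eW[OF B(1)] eW[OF W0] by (auto simp: V_def)
    moreover have "e \<notin> B \<inter> V"
      by (simp add: V_def)
    ultimately show ?thesis
      using card_W_Int[OF B(1) W0 B(2)] by simp
  qed
  have V_pair: "card {B \<in> W. a \<in> B \<and> b \<in> B} = 2" if "a \<in> V" "b \<in> V" "a \<noteq> b" for a b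
    using that by (intro card_W_pair) (auto simp: V_def)
  \<comment> \<open>A pair in \<open>V\<close> lies on just two blocks of \<open>W\<close>, one of
    which is \<open>W0\<close>.\<close>
  have edge_inj: "B = C" if B: "B \<in> W" "B \<noteq> W0" and C: "C \<in> W" "C \<noteq> W0" and eq: "B \<inter> V = C \<inter> V" for B C
  proof (rule ccontr)
    assume "B \<noteq> C"
    obtain a b where ab: "B \<inter> V = {a, b}" "a \<noteq> b"
      using card_edge[OF B] by (auto simp: card_2_iff)
    then have "a \<in> V" "b \<in> V" "a \<in> B" "b \<in> B"
      by auto
    moreover from this have "a \<in> W0" "b \<in> W0"
      by (simp_all add: V_def)
    moreover have "a \<in> C" "b \<in> C"
      using eq ab by auto
    ultimately have "{B, C, W0} \<subseteq> {B \<in> W. a \<in> B \<and> b \<in> B}"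
      using B C W0 by auto
    then have "card {B, C, W0} \<le> card {B \<in> W. a \<in> B \<and> b \<in> B}"
      by (intro card_mono) auto
    then show False
      using V_pair[OF \<open>a \<in> V\<close> \<open>b \<in> V\<close> ab(2)] \<open>B \<noteq> C\<close> B(2) C(2) by simp
  qed
  \<comment> \<open>The blocks through \<open>x\<close> become edges of a graph on \<open>V\<close>.
    It is two-regular because \<open>x\<close> and a vertex lie on two common blocks of
    \<open>W\<close>.\<close>
  define G where "G x = (\<lambda>B. B \<inter> V) ` {B \<in> W. x \<in> B}" for x
  have QW0: "B \<noteq> W0" if "x \<in> Q" "x \<in> B" for x B
    using that by (auto simp: Q_def)
  have edge_inj_on: "inj_on (\<lambda>B. B \<inter> V) {B \<in> W. x \<in> B}" if "x \<in> Q" for x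
    using edge_inj QW0[OF that] by (auto intro!: inj_onI)
  have G_edge: "A \<subseteq> V \<and> card A = 2" if "x \<in> Q" "A \<in> G x" for x A
    using that card_edge QW0 by (auto simp: G_def)
  have G_degree: "card {A \<in> G x. a \<in> A} = 2" if x: "x \<in> Q" and a: "a \<in> V" for x a
  proof -
    have "{A \<in> G x. a \<in> A} = (\<lambda>B. B \<inter> V) ` {B \<in> W. a \<in> B \<and> x \<in> B}"
      using a by (auto simp: G_def)
    moreover have "inj_on (\<lambda>B. B \<inter> V) {B \<in> W. a \<in> B \<and> x \<in> B}"
      using edge_inj_on[OF x] by (rule inj_on_subset) auto
    moreover have "card {B \<in> W. a \<in> B \<and> x \<in> B} = 2"
      using x a eW[OF W0] by (intro card_W_pair) (auto simp: Q_def V_def)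
    ultimately show ?thesis
      by (simp add: card_image)
  qed
  have G_common: "card (G x \<inter> G y) = 2" if x: "x \<in> Q" and y: "y \<in> Q" and "x \<noteq> y" for x y
  proof -
    have "G x \<inter> G y = (\<lambda>B. B \<inter> V) ` {B \<in> W. x \<in> B \<and> y \<in> B}"
    proof
      show "G x \<inter> G y \<subseteq> (\<lambda>B. B \<inter> V) ` {B \<in> W. x \<in> B \<and> y \<in> B}"
      proof
        fix A assume "A \<in> G x \<inter> G y"
        then obtain B C where BC: "B \<in> W" "x \<in> B" "A = B \<inter> V" "C \<in> W" "y \<in> C" "A = C \<inter> V"
          unfolding G_def by blast
        then have "B = C"
          using edge_inj QW0 x y by metis
        with BC show "A \<in> (\<lambda>B. B \<inter> V) ` {B \<in> W. x \<in> B \<and> y \<in> B}"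
          by blast
      qed
    qed (auto simp: G_def)
    moreover have "inj_on (\<lambda>B. B \<inter> V) {B \<in> W. x \<in> B \<and> y \<in> B}"
      using edge_inj_on[OF x] by (rule inj_on_subset) auto
    moreover have "card {B \<in> W. x \<in> B \<and> y \<in> B} = 2"
      using x y \<open>x \<noteq> y\<close> eW[OF W0] by (intro card_W_pair) (auto simp: Q_def)
    ultimately show ?thesis
      by (simp add: card_image)
  qed
  have "Q \<noteq> {}"
    using card_Q by auto
  then obtain x0 where x0: "x0 \<in> Q"
    by auto
  \<comment> \<open>The vertices are numbered along the pentagon of \<open>x0\<close>, so that its
    edges get the numbers \<open>0\<close> to \<open>4\<close>.\<close>
  obtain p where p: "bij_betw p {..<5::nat} V"
    and p0: "\<And>k. k < 10 \<Longrightarrow> p ` pentagon_edge k \<in> G x0 \<longleftrightarrow> k < 5"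
    using two_regular_pentagon[OF card_V G_edge[OF x0] G_degree[OF x0]] by metis
  define \<epsilon> where "\<epsilon> k = p ` pentagon_edge k" for k
  have \<epsilon>: "bij_betw \<epsilon> {..<10} {A. A \<subseteq> V \<and> card A = 2}"
    unfolding \<epsilon>_def by (rule pentagon_edges[OF p])
  have \<epsilon>_inj: "inj_on \<epsilon> {..<10}" and \<epsilon>_img: "\<epsilon> ` {..<10} = {A. A \<subseteq> V \<and> card A = 2}"
    using \<epsilon> by (simp_all add: bij_betw_def)
  define H where "H x = {k \<in> {..<10}. \<epsilon> k \<in> G x}" for x
  have H_img: "\<epsilon> ` H x = G x" if "x \<in> Q" for x
  proof -
    have "G x \<subseteq> \<epsilon> ` {..<10}"
      unfolding \<epsilon>_img using G_edge[OF that] by blast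
    then show ?thesis
      by (auto simp: H_def)
  qed
  have H_sub: "H x \<subseteq> {..<10}" for x
    by (auto simp: H_def)
  have H_x0: "H x0 = {..<5}"
    using p0 by (auto simp: H_def \<epsilon>_def)
  have H_common: "card (H x \<inter> H y) = 2" if "x \<in> Q" "y \<in> Q" "x \<noteq> y" for x y
  proof -
    have "\<epsilon> ` (H x \<inter> H y) = G x \<inter> G y"
      using inj_on_image_Int[OF \<epsilon>_inj H_sub H_sub] H_img that by simp
    moreover have "inj_on \<epsilon> (H x \<inter> H y)"
      using \<epsilon>_inj by (rule inj_on_subset) (use H_sub in blast)
    ultimately show ?thesis
      using G_common[OF that] by (metis card_image)
  qed
  have H_row: "card {k \<in> H x. i \<in> pentagon_edge k} = 2" if x: "x \<in> Q" and i: "i < 5" for x i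
  proof -
    have pi: "p i \<in> V"
      using p i by (auto simp: bij_betw_def)
    have mem: "p i \<in> \<epsilon> k \<longleftrightarrow> i \<in> pentagon_edge k" if "k < 10" for k
      unfolding \<epsilon>_def using p i pentagon_edge_subset[OF that]
      by (intro inj_on_image_mem_iff) (auto simp: bij_betw_def)
    have "\<epsilon> ` {k \<in> H x. i \<in> pentagon_edge k} = {A \<in> \<epsilon> ` H x. p i \<in> A}"
      using mem H_sub[of x] by blast
    then have img: "\<epsilon> ` {k \<in> H x. i \<in> pentagon_edge k} = {A \<in> G x. p i \<in> A}"
      unfolding H_img[OF x] .
    have "inj_on \<epsilon> {k \<in> H x. i \<in> pentagon_edge k}"
      using \<epsilon>_inj by (rule inj_on_subset) (use H_sub in blast)
    from card_image[OF this] show ?thesis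
      unfolding img G_degree[OF x pi] by simp
  qed
  have "\<exists>i. i < 5 \<and> H x = pentagon_switch i" if "x \<in> Q - {x0}" for x
  proof -
    have "card (H x \<inter> {..<5}) = 2"
      using H_common[of x x0] that x0 by (simp add: H_x0)
    from pentagon_switch_cases[OF H_sub[of x] this H_row]
    show ?thesis
      using that by blast
  qed
  then obtain s where s: "\<And>x. x \<in> Q - {x0} \<Longrightarrow> s x < 5 \<and> H x = pentagon_switch (s x)"
    by metis
  \<comment> \<open>Equal switches would have five common edges instead of two. With five points and
    five switches, each switch then occurs once.\<close>
  have s_inj: "inj_on s (Q - {x0})"
  proof (rule inj_onI, rule ccontr)
    fix x y assume xy: "x \<in> Q - {x0}" "y \<in> Q - {x0}" "s x = s y" "x \<noteq> y"
    then have "card (pentagon_switch (s x)) = 2"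
      using H_common[of x y] s[of x] s[of y] by simp
    then show False
      using card_pentagon_switch[of "s x"] s[OF xy(1)] by simp
  qed
  have s_img: "s ` (Q - {x0}) = {..<5}"
    using s s_inj card_Q x0 by (intro card_subset_eq) (auto simp: card_image)
  \<comment> \<open>\<open>q\<close> inverts the labelling \<open>s\<close>; label \<open>5\<close>
    is reserved for \<open>x0\<close>, whose pentagon is the cycle.\<close>
  define q where "q a = (if a = 5 then x0 else inv_into (Q - {x0}) s a)" for a
  have q_mem: "q a \<in> Q" and q_H: "H (q a) = pentagon_set a" if "a < 6" for a
  proof -
    have "q a \<in> Q \<and> H (q a) = pentagon_set a"
    proof (cases "a = 5")
      case True
      then show ?thesis
        using x0 H_x0 by (simp add: q_def pentagon_set_def)
    next
      case False
      then have "a \<in> s ` (Q - {x0})"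
        using that s_img by simp
      then have "inv_into (Q - {x0}) s a \<in> Q - {x0}" "s (inv_into (Q - {x0}) s a) = a"
        by (rule inv_into_into, rule f_inv_into_f)
      then have "q a \<in> Q - {x0}" "s (q a) = a"
        unfolding q_def using False by simp_all
      then show ?thesis
        using s[of "q a"] False by (simp add: pentagon_set_def)
    qed
    then show "q a \<in> Q" "H (q a) = pentagon_set a"
      by simp_all
  qed
  have q_img: "q ` {..<6} = Q"
  proof
    show "Q \<subseteq> q ` {..<6}"
    proof
      fix x assume x: "x \<in> Q"
      show "x \<in> q ` {..<6}"
      proof (cases "x = x0")
        case True
        then show ?thesis
          by (intro image_eqI[of _ _ 5]) (simp_all add: q_def)
      next
        case False
        then have "s x < 5"
          using s x by simp
        then show ?thesis
          using x False s_inj by (intro image_eqI[of _ _ "s x"]) (simp_all add: q_def)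
      qed
    qed
  qed (use q_mem in auto)
  have "\<exists>B. B \<in> W \<and> B \<noteq> W0 \<and> B \<inter> V = \<epsilon> k" if "k < 10" for k
  proof -
    have k: "\<epsilon> k \<subseteq> V" "card (\<epsilon> k) = 2"
      using \<epsilon>_img that by blast+
    then obtain a b where ab: "\<epsilon> k = {a, b}" "a \<noteq> b"
      by (auto simp: card_2_iff)
    have "{B \<in> W. a \<in> B \<and> b \<in> B} \<noteq> {W0}"
      using V_pair[of a b] ab k by auto
    moreover have "W0 \<in> {B \<in> W. a \<in> B \<and> b \<in> B}"
      using W0 k(1) ab by (auto simp: V_def)
    ultimately obtain B where B: "B \<in> W" "a \<in> B" "b \<in> B" "B \<noteq> W0"
      by blast
    have "\<epsilon> k = B \<inter> V"
      using k ab B card_edge[OF B(1,4)] by (intro card_subset_eq) auto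
    with B show ?thesis
      by blast
  qed
  then obtain \<gamma> where \<gamma>: "\<And>k. k < 10 \<Longrightarrow> \<gamma> k \<in> W \<and> \<gamma> k \<noteq> W0 \<and> \<gamma> k \<inter> V = \<epsilon> k"
    by metis
  have \<gamma>_Q: "\<gamma> k \<inter> Q = q ` {a. a < 6 \<and> k \<in> pentagon_set a}" if k: "k < 10" for k
  proof -
    have "x \<in> \<gamma> k \<longleftrightarrow> k \<in> H x" if x: "x \<in> Q" for x
    proof
      assume "x \<in> \<gamma> k"
      then have "\<epsilon> k \<in> G x"
        using \<gamma>[OF k] unfolding G_def by blast
      then show "k \<in> H x"
        using k by (simp add: H_def)
    next
      assume "k \<in> H x"
      then obtain C where C: "C \<in> W" "x \<in> C" "C \<inter> V = \<epsilon> k"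
        by (auto simp: H_def G_def)
      have "C = \<gamma> k"
      proof (rule edge_inj)
        show "C \<inter> V = \<gamma> k \<inter> V"
          using \<gamma>[OF k] C(3) by simp
      qed (use C QW0[OF x] \<gamma>[OF k] in simp_all)
      with C show "x \<in> \<gamma> k"
        by simp
    qed
    then have "\<gamma> k \<inter> Q = {x \<in> q ` {..<6}. k \<in> H x}"
      unfolding q_img by blast
    also have "\<dots> = q ` {a \<in> {..<6}. k \<in> H (q a)}"
      by blast
    also have "{a \<in> {..<6}. k \<in> H (q a)} = {a. a < 6 \<and> k \<in> pentagon_set a}"
      using q_H by auto
    finally show ?thesis .
  qed
  define \<delta> where "\<delta> B = the_elem (B \<inter> D)" for B
  have \<delta>: "B \<inter> D = {\<delta> B}" if "B \<in> W" for B
  proof -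
    from WD[OF that] obtain d where "B \<inter> D = {d}" ..
    then show ?thesis
      by (simp add: \<delta>_def)
  qed
  have \<delta>D: "\<delta> B \<in> D" if "B \<in> W" for B
  proof -
    have "\<delta> B \<in> B \<inter> D"
      unfolding \<delta>[OF that] by simp
    then show ?thesis
      by simp
  qed
  \<comment> \<open>The order matches \<open>code_block\<close>: index \<open>0\<close> is the point
    of \<open>W0\<close> in \<open>D\<close>, and \<open>k + 1\<close> that of the block on edge
    \<open>k\<close>; then come \<open>e\<close>, the vertices and the pentagons.\<close>
  define \<phi> where "\<phi> i = (if i = 0 then \<delta> W0 else if i < 11 then \<delta> (\<gamma> (i - 1)) else if i = 11 then e
     else if i < 17 then p (i - 12) else q (i - 17))" for i
  have W_cases: "B = W0 \<or> (\<exists>k<10. B = \<gamma> k)" if B: "B \<in> W" for B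
  proof (cases "B = W0")
    case False
    then have "B \<inter> V \<in> \<epsilon> ` {..<10}"
      unfolding \<epsilon>_img using card_edge[OF B] by simp
    then obtain k where k: "k < 10" "B \<inter> V = \<epsilon> k"
      by auto
    have "B = \<gamma> k"
    proof (rule edge_inj)
      show "B \<inter> V = \<gamma> k \<inter> V"
        using \<gamma>[OF k(1)] k(2) by simp
    qed (use B False \<gamma>[OF k(1)] in simp_all)
    with k show ?thesis
      by blast
  qed simp
  have \<phi>D: "\<phi> ` {..<11} = D"
  proof
    show "\<phi> ` {..<11} \<subseteq> D"
    proof clarify
      fix i :: nat assume "i < 11"
      then show "\<phi> i \<in> D"
        using \<delta>D W0 \<gamma>[of "i - 1"] by (simp add: \<phi>_def)
    qed
    show "D \<subseteq> \<phi> ` {..<11}"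
    proof
      fix d assume d: "d \<in> D"
      then obtain B where "{B \<in> W. d \<in> B} = {B}"
        using card_W_point by (meson card_1_singletonE)
      then have B: "B \<in> W" "d \<in> B"
        by auto
      have "d \<in> B \<inter> D"
        using B d by simp
      then have dB: "d = \<delta> B"
        unfolding \<delta>[OF B(1)] by simp
      from W_cases[OF B(1)] show "d \<in> \<phi> ` {..<11}"
      proof
        assume "B = W0"
        then show ?thesis
          by (intro image_eqI[of _ _ 0]) (simp_all add: \<phi>_def dB)
      next
        assume "\<exists>k<10. B = \<gamma> k"
        then obtain k where "k < 10" "B = \<gamma> k"
          by auto
        then show ?thesis
          by (intro image_eqI[of _ _ "Suc k"]) (simp_all add: \<phi>_def dB)
      qed
    qed
  qed
  have \<phi>p: "(\<phi> \<circ> (\<lambda>j. j + 12)) ` A = p ` A" if "A \<subseteq> {..<5}" for A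
    using that by (intro image_cong) (auto simp: \<phi>_def)
  have \<phi>q: "(\<phi> \<circ> (\<lambda>j. j + 17)) ` A = q ` A" for A
    by (intro image_cong) (auto simp: \<phi>_def)
  have pV: "p ` {..<5} = V"
    using p by (simp add: bij_betw_def)
  have \<phi>11: "\<phi> 11 = e"
    by (simp add: \<phi>_def)
  have "\<phi> ` {..<23} = UNIV"
  proof -
    have "\<phi> ` {..<11} \<subseteq> \<phi> ` {..<23}"
      by (intro image_mono) auto
    moreover have "(\<phi> \<circ> (\<lambda>j. j + 12)) ` {..<5} \<subseteq> \<phi> ` {..<23}" "(\<phi> \<circ> (\<lambda>j. j + 17)) ` {..<6} \<subseteq> \<phi> ` {..<23}"
      by auto
    moreover have "\<phi> 11 \<in> \<phi> ` {..<23}"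
      by simp
    ultimately have "D \<union> V \<union> Q \<union> {e} \<subseteq> \<phi> ` {..<23}"
      unfolding \<phi>D \<phi>p[OF order_refl] \<phi>q q_img pV \<phi>11 by blast
    moreover have "D \<union> V \<union> Q \<union> {e} = UNIV"
      by (auto simp: V_def Q_def)
    ultimately show ?thesis
      by blast
  qed
  then have "bij_betw \<phi> {..<23} UNIV"
    by (simp add: bij_betw_def eq_card_imp_inj_on card_UNIV)
  moreover have "\<phi> ` code_block i \<in> \<B>" if i: "i < 11" for i
  proof (cases i)
    case 0
    have "\<phi> ` code_block 0 = {\<phi> 0, \<phi> 11} \<union> (\<phi> \<circ> (\<lambda>j. j + 12)) ` {..<5}"
      by (simp add: code_block_def image_Un image_comp)
    also have "\<dots> = (W0 \<inter> D) \<union> insert e V"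
      unfolding \<phi>p[OF order_refl] pV \<phi>11 \<delta>[OF W0] by (auto simp: \<phi>_def)
    finally have "\<phi> ` code_block i = W0"
      using W0_eq 0 by simp
    then show ?thesis
      using W0 W_block by simp
  next
    case (Suc k)
    then have k: "k < 10"
      using i by simp
    have "\<phi> ` code_block i = {\<phi> i, \<phi> 11} \<union> (\<phi> \<circ> (\<lambda>j. j + 12)) ` pentagon_edge k \<union>
        (\<phi> \<circ> (\<lambda>j. j + 17)) ` {a. a < 6 \<and> k \<in> pentagon_set a}"
      using Suc by (simp add: code_block_def image_Un image_comp)
    also have "\<dots> = {\<phi> i, e} \<union> \<epsilon> k \<union> (\<gamma> k \<inter> Q)"
      unfolding \<phi>p[OF pentagon_edge_subset[OF k]] \<phi>q \<phi>11 \<gamma>_Q[OF k] \<epsilon>_def ..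
    also have "\<dots> = (\<gamma> k \<inter> D) \<union> {e} \<union> (\<gamma> k \<inter> V) \<union> (\<gamma> k \<inter> Q)"
      using \<gamma>[OF k] \<delta>[of "\<gamma> k"] Suc k by (auto simp: \<phi>_def)
    also have "\<dots> = \<gamma> k"
      using eW[of "\<gamma> k"] \<gamma>[OF k] by (auto simp: V_def Q_def)
    finally show ?thesis
      using \<gamma>[OF k] W_block by simp
  qed
  ultimately show ?thesis
    using \<phi>D that by blast
qed

text \<open>The sum over the points of \<open>B \<inter> D\<close> agrees with \<open>B\<close> on
  \<open>D\<close>. The difference \<open>S\<close> lies in the complement of \<open>D\<close> and
  meets all blocks evenly, as does the rest of that complement; if both were nonempty, each would
  have eight points, yet only twelve are available.\<close>

lemma xor_sum_representation:
  assumes J: "finite J" "inj_on \<phi> J" "\<phi> ` J = D"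
    and w: "\<And>i. i \<in> J \<Longrightarrow> w i \<in> \<B>" "\<And>i. i \<in> J \<Longrightarrow> w i \<inter> D = {\<phi> i}"
    and B: "B \<in> \<B>"
  defines "I \<equiv> {i \<in> J. \<phi> i \<in> B}"
  shows "xor_sum I w = B \<or> sym_diff (xor_sum I w) (- D) = B"
proof -
  define S where "S = sym_diff (xor_sum I w) B"
  have "card (\<phi> ` I) = card (B \<inter> D)"
    using J by (intro arg_cong[where f=card]) (auto simp: I_def)
  moreover have "inj_on \<phi> I"
    using J(2) by (rule inj_on_subset) (auto simp: I_def)
  ultimately have "odd (card I)"
    using odd_D[OF B] by (simp add: card_image)
  have "S \<subseteq> - D"
  proof
    fix y assume y: "y \<in> S"
    show "y \<in> - D"
    proof
      assume "y \<in> D"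
      then obtain j where j: "j \<in> J" "y = \<phi> j"
        using J(3) by auto
      have "{i \<in> I. y \<in> w i} = {i \<in> I. i = j}"
      proof (rule Collect_cong, rule conj_cong[OF refl])
        fix i assume "i \<in> I"
        then have "i \<in> J"
          by (simp add: I_def)
        have "y \<in> w i \<longleftrightarrow> y \<in> w i \<inter> D"
          using \<open>y \<in> D\<close> by simp
        also have "\<dots> \<longleftrightarrow> i = j"
          unfolding w(2)[OF \<open>i \<in> J\<close>] using j \<open>i \<in> J\<close> J(2) by (auto simp: inj_on_eq_iff)
        finally show "y \<in> w i \<longleftrightarrow> i = j" .
      qed
      also have "\<dots> = (if y \<in> B then {j} else {})"
        using j by (auto simp: I_def)
      finally have "y \<in> xor_sum I w \<longleftrightarrow> y \<in> B"
        by (simp add: xor_sum_def)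
      then show False
        using y by (auto simp: S_def)
    qed
  qed
  have even: "even (card (C \<inter> S))" if C: "C \<in> \<B>" for C
  proof -
    \<comment> \<open>An odd number of blocks, each meeting \<open>C\<close> oddly, adds up to a
      word meeting \<open>C\<close> oddly.\<close>
    have "even (\<Sum>i\<in>I. card (C \<inter> w i)) \<longleftrightarrow> even (card I)"
      using J(1) w(1) odd_card_Int_blocks[OF C] by (intro even_sum_odd) (auto simp: I_def)
    then have "odd (card (C \<inter> xor_sum I w))"
      using \<open>odd (card I)\<close> J(1) by (subst even_card_Int_xor_sum) (auto simp: I_def)
    then show ?thesis
      unfolding S_def using odd_card_Int_blocks[OF C B] by (subst even_card_Int_sym_diff) auto
  qed
  have "S = {} \<or> S = - D"
  proof (rule ccontr)
    assume "\<not> (S = {} \<or> S = - D)"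
    then have ne: "S \<noteq> {}" "- D - S \<noteq> {}"
      using \<open>S \<subseteq> - D\<close> by auto
    have eq: "sym_diff (- D) S = - D - S"
      using \<open>S \<subseteq> - D\<close> by blast
    have "even (card (C \<inter> (- D - S)))" if "C \<in> \<B>" for C
    proof -
      have "even (card (C \<inter> sym_diff (- D) S))"
        using even[OF that] even_compl_D[OF that] by (subst even_card_Int_sym_diff) auto
      then show ?thesis
        by (simp only: eq)
    qed
    then have "8 \<le> card S" "8 \<le> card (- D - S)"
      using even ne by (auto intro!: even_set_card_ge)
    moreover have "card (- D - S) = 12 - card S"
      using \<open>S \<subseteq> - D\<close> by (subst card_Diff_subset) (auto simp: card_compl_D)
    ultimately show False
      by linarith
  qed
  then show ?thesis
  proof
    assume "S = {}"
    then show ?thesis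
      by (auto simp: S_def)
  next
    assume "S = - D"
    then have "y \<in> - D \<longleftrightarrow> (y \<in> xor_sum I w) \<noteq> (y \<in> B)" for y
      unfolding S_def by blast
    then have "sym_diff (xor_sum I w) (- D) = B"
      by blast
    then show ?thesis ..
  qed
qed

text \<open>Blocks are code words by the preceding representation. Conversely a code word is an odd
  sum of blocks, possibly with the complement of \<open>D\<close> added, so it meets all blocks
  oddly and is a block because its weight is seven.\<close>

lemma blocks_eq_code_words:
  assumes \<phi>: "bij_betw \<phi> {..<23} UNIV" and \<phi>D: "\<phi> ` {..<11} = D"
    and cb: "\<And>i. i < 11 \<Longrightarrow> \<phi> ` code_block i \<in> \<B>"
  shows "\<B> = (\<lambda>b. \<phi> ` b) ` code_words"
proof -
  have inj: "inj_on \<phi> {..<23}" and img: "\<phi> ` {..<23} = UNIV"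
    using \<phi> by (simp_all add: bij_betw_def)
  define w where "w i = \<phi> ` code_block i" for i
  have \<phi>E: "\<phi> ` {11..<23} = - D"
  proof -
    have "\<phi> ` ({..<23} - {..<11}) = - D"
      by (subst inj_on_image_set_diff[OF inj]) (auto simp: img \<phi>D)
    moreover have "{..<23} - {..<11} = {11..<23::nat}"
      by auto
    ultimately show ?thesis
      by simp
  qed
  have xs: "\<phi> ` xor_sum I code_block = xor_sum I w" and xs_sub: "xor_sum I code_block \<subseteq> {..<23}"
    if "I \<subseteq> {..<11}" for I
  proof -
    show "\<phi> ` xor_sum I code_block = xor_sum I w"
      unfolding w_def using inj by (rule image_xor_sum) (use that code_block_subset in blast)
    show "xor_sum I code_block \<subseteq> {..<23}"
      by (rule xor_sum_subset) (use that code_block_subset in blast)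
  qed
  have sd: "\<phi> ` sym_diff A {11..<23} = sym_diff (\<phi> ` A) (- D)" if "A \<subseteq> {..<23}" for A
  proof -
    have s11: "{11..<23} \<subseteq> {..<23::nat}"
      by auto
    have "\<phi> ` (A - {11..<23}) = \<phi> ` A - \<phi> ` {11..<23}"
      by (rule inj_on_image_set_diff[OF inj _ s11]) (use that in blast)
    moreover have "\<phi> ` ({11..<23} - A) = \<phi> ` {11..<23} - \<phi> ` A"
      by (rule inj_on_image_set_diff[OF inj _ that]) (use s11 in blast)
    ultimately show ?thesis
      by (simp only: image_Un \<phi>E)
  qed
  show ?thesis
  proof
    show "\<B> \<subseteq> (\<lambda>b. \<phi> ` b) ` code_words"
    proof
      fix B assume B: "B \<in> \<B>"
      define b where "b = {i \<in> {..<23}. \<phi> i \<in> B}"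
      have \<phi>b: "\<phi> ` b = B"
        using img by (auto simp: b_def)
      have b_sub: "b \<subseteq> {..<23}"
        by (auto simp: b_def)
      have "card b = 7"
        using block[OF B] card_image[OF inj_on_subset[OF inj b_sub]] \<phi>b by simp
      have "\<phi> ` (b \<inter> {..<11}) = B \<inter> D"
        using inj_on_image_Int[OF inj b_sub, of "{..<11}"] by (simp add: \<phi>b \<phi>D)
      moreover have "inj_on \<phi> (b \<inter> {..<11})"
        using inj by (rule inj_on_subset) (use b_sub in auto)
      ultimately have "odd (card (b \<inter> {..<11}))"
        using odd_D[OF B] by (metis card_image)
      define I where "I = b \<inter> {..<11}"
      have I: "I \<subseteq> {..<11}"
        by (auto simp: I_def)
      have I_alt: "I = {i \<in> {..<11}. \<phi> i \<in> B}"
        by (auto simp: I_def b_def)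
      have "xor_sum I w = B \<or> sym_diff (xor_sum I w) (- D) = B"
        unfolding I_alt
      proof (rule xor_sum_representation[OF _ _ \<phi>D _ _ B])
        show "inj_on \<phi> {..<11}"
          using inj by (rule inj_on_subset) auto
        show "w i \<in> \<B>" if "i \<in> {..<11}" for i
          using cb that by (simp add: w_def)
        show "w i \<inter> D = {\<phi> i}" if "i \<in> {..<11}" for i
          using inj_on_image_Int[OF inj code_block_subset, of i "{..<11}"] that code_block_Int[of i]
          by (simp add: w_def \<phi>D)
      qed simp
      then have "\<phi> ` xor_sum I code_block = \<phi> ` b \<or> \<phi> ` sym_diff (xor_sum I code_block) {11..<23} = \<phi> ` b"
        unfolding sd[OF xs_sub[OF I]] xs[OF I] \<phi>b .
      moreover have "sym_diff (xor_sum I code_block) {11..<23} \<subseteq> {..<23}"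
        using xs_sub[OF I] by auto
      ultimately have "xor_sum I code_block = b \<or> sym_diff (xor_sum I code_block) {11..<23} = b"
        using inj_on_image_eq_iff[OF inj _ b_sub] xs_sub[OF I] by blast
      then have "b \<in> code_words"
        using b_sub \<open>card b = 7\<close> \<open>odd (card (b \<inter> {..<11}))\<close> by (simp add: code_words_def I_def)
      then show "B \<in> (\<lambda>b. \<phi> ` b) ` code_words"
        using \<phi>b by blast
    qed
    show "(\<lambda>b. \<phi> ` b) ` code_words \<subseteq> \<B>"
    proof clarify
      fix b assume "b \<in> code_words"
      define I where "I = b \<inter> {..<11}"
      have I: "I \<subseteq> {..<11}"
        by (auto simp: I_def)
      have b: "b \<subseteq> {..<23}" "card b = 7" "odd (card I)"
        and or: "xor_sum I code_block = b \<or> sym_diff (xor_sum I code_block) {11..<23} = b"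
        using \<open>b \<in> code_words\<close> by (simp_all add: code_words_def I_def)
      show "\<phi> ` b \<in> \<B>"
      proof (rule odd_set_block)
        show "card (\<phi> ` b) = 7"
          using card_image[OF inj_on_subset[OF inj b(1)]] b(2) by simp
        fix C assume C: "C \<in> \<B>"
        have "even (\<Sum>i\<in>I. card (C \<inter> w i)) \<longleftrightarrow> even (card I)"
          using odd_card_Int_blocks[OF C] cb I finite_subset[OF I]
          by (intro even_sum_odd) (auto simp: w_def)
        then have odd: "odd (card (C \<inter> xor_sum I w))"
          using b(3) finite_subset[OF I] by (subst even_card_Int_xor_sum) auto
        from or show "odd (card (C \<inter> \<phi> ` b))"
        proof
          assume "xor_sum I code_block = b"
          then show ?thesis
            using odd xs[OF I] by simp
        next
          assume *: "sym_diff (xor_sum I code_block) {11..<23} = b"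
          have "\<phi> ` b = sym_diff (xor_sum I w) (- D)"
            unfolding *[symmetric] sd[OF xs_sub[OF I]] xs[OF I] ..
          then show ?thesis
            using odd even_compl_D[OF C] by (simp only:) (subst even_card_Int_sym_diff, auto)
        qed
      qed
    qed
  qed
qed

end

text \<open>The symmetric difference of two blocks meeting in one point has twelve elements and
  meets every block evenly. Blocks have odd size, so its complement qualifies as
  \<open>D\<close>.\<close>

lemma (in steiner_4_7_23) ex_code_words_bij:
  assumes "B1 \<in> \<B>" "B2 \<in> \<B>" "card (B1 \<inter> B2) = 1"
  obtains \<phi> :: "nat \<Rightarrow> 'a" where "bij_betw \<phi> {..<23} UNIV" "\<B> = (\<lambda>b. \<phi> ` b) ` code_words"
proof -
  define D where "D = - sym_diff B1 B2"
  have c: "card (sym_diff B1 B2) = 12"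
    using card_sym_diff[of B1 B2] assms block by simp
  then have "sym_diff B1 B2 \<noteq> {}"
    by (metis card.empty zero_neq_numeral)
  then obtain e where e: "e \<in> sym_diff B1 B2"
    by blast
  have "card D = 11"
    unfolding D_def using c by (simp only: Compl_eq_Diff_UNIV) (subst card_Diff_subset, auto simp: card_UNIV)
  have "odd (card (B \<inter> D))" if B: "B \<in> \<B>" for B
  proof -
    have "even (card (B \<inter> sym_diff B1 B2))"
      using odd_card_Int_blocks[OF B] assms by (subst even_card_Int_sym_diff) auto
    moreover have "card B = card (B \<inter> sym_diff B1 B2) + card (B \<inter> D)"
      using card_Int_Diff[of B "sym_diff B1 B2"] by (simp add: D_def Diff_eq)
    ultimately show ?thesis
      using block[OF B] by presburger
  qed
  then interpret steiner_4_7_23_dodecad \<B> D e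
    using \<open>card D = 11\<close> e by unfold_locales (auto simp: D_def)
  obtain \<phi> :: "nat \<Rightarrow> 'a" where "bij_betw \<phi> {..<23} UNIV" "\<phi> ` {..<11} = D" "\<And>i. i < 11 \<Longrightarrow> \<phi> ` code_block i \<in> \<B>"
    using ex_code_coordinates by blast
  then show ?thesis
    using blocks_eq_code_words that by blast
qed

lemma steiner_4_7_23_of_design:
  assumes "quasi_symmetric_design 4 23 7 1 3 1 UNIV (\<B> :: 'a::finite set set)"
  shows "steiner_4_7_23 \<B>"
proof
  show "CARD('a) = 23"
    using assms by (simp add: quasi_symmetric_design_def)
  show "card B = 7" if "B \<in> \<B>" for B
    using assms that by (simp add: quasi_symmetric_design_def)
  show "card {B \<in> \<B>. T \<subseteq> B} = 1" if "card T = 4" for T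
    using assms that by (simp add: quasi_symmetric_design_def)
  show "card (B \<inter> C) = 1 \<or> card (B \<inter> C) = 3" if "B \<in> \<B>" "C \<in> \<B>" "B \<noteq> C" for B C
  proof -
    have "card (B \<inter> C) \<in> {card (B \<inter> C) | B C. B \<in> \<B> \<and> C \<in> \<B> \<and> B \<noteq> C}"
      using that by blast
    also have "\<dots> = {3, 1}"
      using assms by (simp add: quasi_symmetric_design_def)
    finally show ?thesis
      by auto
  qed
qed

text \<open>Both designs are images of the same family \<open>code_words\<close>, so one coordinate
  map composed with the inverse of the other carries blocks to blocks.\<close>

theorem quasi_symmetric_4_23_7_1_unique:
  fixes \<B> \<B>' :: "'a::finite set set"
  assumes "quasi_symmetric_design 4 23 7 1 3 1 UNIV \<B>" "quasi_symmetric_design 4 23 7 1 3 1 UNIV \<B>'"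
  obtains \<pi> :: "'a \<Rightarrow> 'a" where "bij \<pi>" "\<B>' = (\<lambda>B. \<pi> ` B) ` \<B>"
proof -
  have coords: "\<exists>\<phi> :: nat \<Rightarrow> 'a. bij_betw \<phi> {..<23} UNIV \<and> \<C> = (\<lambda>b. \<phi> ` b) ` code_words"
    if \<C>: "quasi_symmetric_design 4 23 7 1 3 1 UNIV \<C>" for \<C> :: "'a set set"
  proof -
    have "1 \<in> {card (B \<inter> C) | B C. B \<in> \<C> \<and> C \<in> \<C> \<and> B \<noteq> C}"
      using \<C> by (simp add: quasi_symmetric_design_def)
    then obtain B1 B2 where "B1 \<in> \<C>" "B2 \<in> \<C>" "1 = card (B1 \<inter> B2)"
      by blast
    from steiner_4_7_23.ex_code_words_bij[OF steiner_4_7_23_of_design[OF \<C>] this(1,2) this(3)[symmetric]]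
    obtain \<phi> :: "nat \<Rightarrow> 'a" where "bij_betw \<phi> {..<23} UNIV" "\<C> = (\<lambda>b. \<phi> ` b) ` code_words" .
    then show ?thesis
      by (intro exI conjI)
  qed
  obtain \<phi> \<phi>' :: "nat \<Rightarrow> 'a" where \<phi>: "bij_betw \<phi> {..<23} UNIV" "\<B> = (\<lambda>b. \<phi> ` b) ` code_words"
    and \<phi>': "bij_betw \<phi>' {..<23} UNIV" "\<B>' = (\<lambda>b. \<phi>' ` b) ` code_words"
    using coords assms by metis
  define \<pi> where "\<pi> = \<phi>' \<circ> inv_into {..<23} \<phi>"
  have "bij \<pi>"
    unfolding \<pi>_def using bij_betw_inv_into[OF \<phi>(1)] \<phi>'(1) by (rule bij_betw_trans)
  moreover have "\<B>' = (\<lambda>B. \<pi> ` B) ` \<B>"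
  proof -
    have "\<pi> ` \<phi> ` b = \<phi>' ` b" if "b \<in> code_words" for b
    proof -
      have "b \<subseteq> {..<23}"
        using that by (simp add: code_words_def)
      then have "inv_into {..<23} \<phi> ` \<phi> ` b = b"
        using \<phi>(1) by (intro inv_into_image_cancel) (auto simp: bij_betw_def)
      then show ?thesis
        unfolding \<pi>_def image_comp[symmetric] by simp
    qed
    then show ?thesis
      unfolding \<phi>(2) \<phi>'(2) by (subst image_image) (intro image_cong refl, rule sym)
  qed
  ultimately show ?thesis
    by (rule that)
qed

section \<open>The blocks of a tight 5-design\<close>

lemma frame_profiles_alt:
  fixes \<B> :: "'n set set"
  shows "frame_profiles \<alpha> \<B> = range (\<lambda>j i. if i = j then 1 else \<alpha>) \<union> range (\<lambda>j i. - (if i = j then 1 else \<alpha>)) \<union>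
     (\<lambda>B i. if i \<in> B then \<alpha> else - \<alpha>) ` \<B> \<union> (\<lambda>B i. - (if i \<in> B then \<alpha> else - \<alpha>)) ` \<B>"
proof -
  have 1: "{f s j | j s. s \<in> {1, -1 :: real}} = range (f 1) \<union> range (f (- 1))" for f :: "real \<Rightarrow> 'n \<Rightarrow> 'n \<Rightarrow> real"
    by blast
  have 2: "{f s B | B s. B \<in> \<B> \<and> s \<in> {1, -1 :: real}} = f 1 ` \<B> \<union> f (- 1) ` \<B>" for f :: "real \<Rightarrow> 'n set \<Rightarrow> 'n \<Rightarrow> real"
    by blast
  show ?thesis
    unfolding frame_profiles_def 1[of "\<lambda>s j i. s * (if i = j then 1 else \<alpha>)"]
      2[of "\<lambda>s B i. s * (if i \<in> B then \<alpha> else - \<alpha>)"]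
    by (simp only: mult_1_left mult_minus_left Un_assoc)
qed

lemma profiles_eq_frame_profiles:
  assumes g: "equiangular_frame \<alpha> g" and v: "\<And>B i. B \<in> \<B> \<Longrightarrow> v B \<bullet> g i = (if i \<in> B then \<alpha> else - \<alpha>)"
    and X: "X = range g \<union> uminus ` range g \<union> v ` \<B> \<union> uminus ` v ` \<B>"
  shows "(\<lambda>u i. u \<bullet> g i) ` X = frame_profiles \<alpha> \<B>"
proof -
  let ?p = "\<lambda>u i. u \<bullet> g i"
  have "?p ` range g = range (\<lambda>j i. if i = j then 1 else \<alpha>)"
    unfolding image_image by (intro image_cong refl ext) (simp add: equiangular_frame_inner[OF g] eq_commute)
  moreover have "?p ` uminus ` range g = range (\<lambda>j i. - (if i = j then 1 else \<alpha>))"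
    unfolding image_image by (intro image_cong refl ext) (simp add: equiangular_frame_inner[OF g] eq_commute)
  moreover have "?p ` v ` \<B> = (\<lambda>B i. if i \<in> B then \<alpha> else - \<alpha>) ` \<B>"
    unfolding image_image by (intro image_cong refl ext) (simp add: v)
  moreover have "?p ` uminus ` v ` \<B> = (\<lambda>B i. - (if i \<in> B then \<alpha> else - \<alpha>)) ` \<B>"
    unfolding image_image by (intro image_cong refl ext) (simp add: v)
  ultimately show ?thesis
    unfolding X image_Un frame_profiles_alt by simp
qed

text \<open>Reindexing the second frame by \<open>\<pi>\<close> turns the sign sets
  \<open>\<B>'\<close> back into \<open>\<B>\<close>, so both point sets have the same
  profiles.\<close>

lemma isometric_sets_of_profiles:
  fixes g g' :: "'n::finite \<Rightarrow> real^'n"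
  assumes g: "equiangular_frame \<alpha> g" and X: "(\<lambda>u i. u \<bullet> g i) ` X = frame_profiles \<alpha> \<B>"
    and g': "equiangular_frame \<alpha> g'" and v: "\<And>B i. B \<in> \<B>' \<Longrightarrow> v B \<bullet> g' i = (if i \<in> B then \<alpha> else - \<alpha>)"
    and X': "X' = range g' \<union> uminus ` range g' \<union> v ` \<B>' \<union> uminus ` v ` \<B>'"
    and \<pi>: "bij \<pi>" "\<B>' = (\<lambda>B. \<pi> ` B) ` \<B>"
  shows "isometric_sets X X'"
proof (rule isometric_sets_of_frames[OF g])
  have "\<pi> i = \<pi> j \<longleftrightarrow> i = j" for i j
    using \<pi>(1) by (simp add: bij_is_inj inj_eq)
  then show g\<pi>: "equiangular_frame \<alpha> (\<lambda>i. g' (\<pi> i))"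
    using g' by (simp add: equiangular_frame_def)
  have "(\<lambda>u i. u \<bullet> g' (\<pi> i)) ` X' = frame_profiles \<alpha> \<B>"
  proof (rule profiles_eq_frame_profiles[OF g\<pi>, of _ "\<lambda>B. v (\<pi> ` B)"])
    show "v (\<pi> ` B) \<bullet> g' (\<pi> i) = (if i \<in> B then \<alpha> else - \<alpha>)" if "B \<in> \<B>" for B i
      using that v[of "\<pi> ` B" "\<pi> i"] \<pi> by (simp add: inj_image_mem_iff[OF bij_is_inj[OF \<pi>(1)]])
    have "range (\<lambda>i. g' (\<pi> i)) = range g'"
      using \<pi>(1) by (metis bij_is_surj image_image)
    then show "X' = range (\<lambda>i. g' (\<pi> i)) \<union> uminus ` range (\<lambda>i. g' (\<pi> i)) \<union>
        (\<lambda>B. v (\<pi> ` B)) ` \<B> \<union> uminus ` (\<lambda>B. v (\<pi> ` B)) ` \<B>"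
      unfolding X' \<pi>(2) by (simp add: image_image)
  qed
  then show "(\<lambda>u i. u \<bullet> g i) ` X = (\<lambda>u i. u \<bullet> g' (\<pi> i)) ` X'"
    using X by simp
qed

text \<open>Two blocks share at most three points, so no four points lie in two blocks. The
  \<open>253 * 35 = 8855\<close> four-subsets of blocks are then all four-subsets of the point set,
  each covered once.\<close>

lemma quasi_symmetric_4_23_7_1_of_card:
  fixes \<B> :: "'a::finite set set"
  assumes 23: "CARD('a) = 23" and card_B: "card \<B> = 253"
    and block: "\<And>B. B \<in> \<B> \<Longrightarrow> card B = 7"
    and inter: "\<And>B C. B \<in> \<B> \<Longrightarrow> C \<in> \<B> \<Longrightarrow> B \<noteq> C \<Longrightarrow> card (B \<inter> C) \<in> {3, 1}"
  shows "quasi_symmetric_design 4 23 7 1 3 1 UNIV \<B>"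
proof -
  let ?sub = "\<lambda>B. {T. T \<subseteq> B \<and> card T = 4}"
  have disj: "?sub B \<inter> ?sub C = {}" if "B \<in> \<B>" "C \<in> \<B>" "B \<noteq> C" for B C
  proof -
    have "card T \<noteq> 4" if "T \<subseteq> B \<inter> C" for T
    proof -
      have "card T \<le> card (B \<inter> C)"
        using that by (intro card_mono) simp_all
      then show ?thesis
        using inter[OF \<open>B \<in> \<B>\<close> \<open>C \<in> \<B>\<close> \<open>B \<noteq> C\<close>] by auto
    qed
    then show ?thesis
      by blast
  qed
  have "card (\<Union>B\<in>\<B>. ?sub B) = (\<Sum>B\<in>\<B>. card (?sub B))"
    using disj by (intro card_UN_disjoint) auto
  also have "\<dots> = (\<Sum>B\<in>\<B>. 35)"
  proof (rule sum.cong)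
    fix B assume "B \<in> \<B>"
    then show "card (?sub B) = 35"
      using n_subsets[of B 4] block by (simp add: eval_nat_numeral)
  qed simp
  also have "\<dots> = card (?sub (UNIV :: 'a set))"
  proof -
    have "3 * (22 choose 3) = 22 * (21 choose 2 :: nat)" "4 * (23 choose 4) = 23 * (22 choose 3 :: nat)"
      using times_binomial_minus1_eq[of 3 22] times_binomial_minus1_eq[of 4 23] by simp_all
    then have "(23 choose 4 :: nat) = 8855"
      by (simp add: choose_two)
    then show ?thesis
      using n_subsets[of "UNIV :: 'a set" 4] 23 card_B by simp
  qed
  finally have "(\<Union>B\<in>\<B>. ?sub B) = ?sub UNIV"
    by (intro card_subset_eq) auto
  then have ex: "\<exists>B\<in>\<B>. T \<subseteq> B" if "card T = 4" for T
    using that by blast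
  have count: "card {B \<in> \<B>. T \<subseteq> B} = 1" if T: "card T = 4" for T
  proof -
    obtain B where B: "B \<in> \<B>" "T \<subseteq> B"
      using ex[OF T] by blast
    have "C = B" if "C \<in> \<B>" "T \<subseteq> C" for C
    proof (rule ccontr)
      assume "C \<noteq> B"
      then have "?sub B \<inter> ?sub C = {}"
        using disj[OF B(1) that(1)] by simp
      moreover have "T \<in> ?sub B \<inter> ?sub C"
        using B(2) that(2) T by simp
      ultimately show False
        by blast
    qed
    then have "{B \<in> \<B>. T \<subseteq> B} = {B}"
      using B by blast
    then show ?thesis
      by simp
  qed
  then interpret steiner_4_7_23 \<B>
    using 23 block inter by unfold_locales auto
  have "\<B> \<noteq> {}"
    using card_B by auto
  then obtain B where B: "B \<in> \<B>"
    by auto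
  \<comment> \<open>The block through three points of \<open>B\<close> and one point outside shares
    exactly these three with \<open>B\<close>.\<close>
  have three: "\<exists>C\<in>\<B>. C \<noteq> B \<and> card (B \<inter> C) = 3"
  proof -
    have "3 \<le> card B"
      using block[OF B] by simp
    then obtain T where T: "T \<subseteq> B" "card T = 3"
      by (meson obtain_subset_with_card_n)
    have "B \<noteq> UNIV"
      using block[OF B] 23 by auto
    then obtain x where x: "x \<notin> B"
      by blast
    then have "card (insert x T) = 4"
      using T by (subst card_insert_disjoint) auto
    then obtain C where C: "C \<in> \<B>" "insert x T \<subseteq> C"
      using ex by blast
    have "card T \<le> card (B \<inter> C)"
      using T(1) C(2) by (intro card_mono) auto
    moreover have "C \<noteq> B"
      using C(2) x by blast
    ultimately show ?thesis
      using C(1) inter[OF B C(1)] T(2) by auto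
  qed
  \<comment> \<open>If all other blocks met \<open>B\<close> in three points, the incidences with
    \<open>B\<close> would number \<open>7 + 252 * 3 = 763\<close>, but its seven points lie on
    \<open>77\<close> blocks each, which gives \<open>539\<close>.\<close>
  have one: "\<exists>C\<in>\<B>. C \<noteq> B \<and> card (B \<inter> C) = 1"
  proof (rule ccontr)
    assume no: "\<not> (\<exists>C\<in>\<B>. C \<noteq> B \<and> card (B \<inter> C) = 1)"
    have eq3: "card (C \<inter> B) = 3" if "C \<in> \<B> - {B}" for C
    proof -
      have C: "C \<in> \<B>" "C \<noteq> B"
        using that by simp_all
      then have "card (B \<inter> C) \<noteq> 1"
        using no by blast
      then show ?thesis
        using inter[OF B C(1)] C(2) by (metis Int_commute empty_iff insert_iff)
    qed
    have "(\<Sum>C\<in>\<B>. card (C \<inter> B)) = (\<Sum>x\<in>B. card {C \<in> \<B>. x \<in> C})"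
      by (intro sum_card_Int) auto
    also have "\<dots> = 7 * 77"
      using count1[of "{x}" for x] block[OF B] by simp
    finally have "(\<Sum>C\<in>\<B>. card (C \<inter> B)) = 539"
      by simp
    moreover have "(\<Sum>C\<in>\<B>. card (C \<inter> B)) = 7 + (\<Sum>C\<in>\<B> - {B}. card (C \<inter> B))"
      using B block[OF B] by (simp add: sum.remove[of \<B> B])
    moreover have "(\<Sum>C\<in>\<B> - {B}. card (C \<inter> B)) = (\<Sum>C\<in>\<B> - {B}. 3)"
      using eq3 by (intro sum.cong) auto
    ultimately show False
      using B card_B by simp
  qed
  have "{card (B \<inter> C) | B C. B \<in> \<B> \<and> C \<in> \<B> \<and> B \<noteq> C} = {3, 1}"
  proof
    show "{card (B \<inter> C) | B C. B \<in> \<B> \<and> C \<in> \<B> \<and> B \<noteq> C} \<subseteq> {3, 1}"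
      using inter by blast
    show "{3, 1} \<subseteq> {card (B \<inter> C) | B C. B \<in> \<B> \<and> C \<in> \<B> \<and> B \<noteq> C}"
    proof -
      obtain C C' where "C \<in> \<B>" "C \<noteq> B" "3 = card (B \<inter> C)" "C' \<in> \<B>" "C' \<noteq> B" "1 = card (B \<inter> C')"
        using one three by metis
      with B show ?thesis
        by blast
    qed
  qed
  then show ?thesis
    unfolding quasi_symmetric_design_def using 23 block count by simp
qed

section \<open>Sign sets in the four dimensions\<close>

context tight_5_design_frame
begin

lemma profiles_X: "(\<lambda>u i. u \<bullet> g i) ` X = frame_profiles \<alpha> (pos ` U)"
proof (rule profiles_eq_frame_profiles[OF frame, of _ "inv_into U pos"])
  have UR: "U \<subseteq> R"
    by (auto simp: U_def)
  have inj: "inj_on pos U"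
    using inj_on_pos UR by (rule inj_on_subset)
  show "inv_into U pos B \<bullet> g i = (if i \<in> B then \<alpha> else - \<alpha>)" if "B \<in> pos ` U" for B i
  proof -
    have "inv_into U pos B \<in> R" "pos (inv_into U pos B) = B"
      using that UR inv_into_into[OF that] by (auto simp: f_inv_into_f)
    then show ?thesis
      using inner_R by metis
  qed
  have "inv_into U pos ` pos ` U = U"
    using inj by (rule inv_into_image_cancel) simp
  moreover have "X = range g \<union> uminus ` range g \<union> U \<union> uminus ` U"
  proof
    show "X \<subseteq> range g \<union> uminus ` range g \<union> U \<union> uminus ` U"
    proof
      fix u assume u: "u \<in> X"
      show "u \<in> range g \<union> uminus ` range g \<union> U \<union> uminus ` U"
      proof (cases "u \<in> R")
        case True
        have "u \<in> U \<or> - u \<in> U"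
          using True uminus_R[OF True] card_compl[of "pos u"] by (auto simp: U_def pos_uminus)
        moreover have "u = - (- u)"
          by simp
        ultimately show ?thesis
          by blast
      qed (use u in \<open>auto simp: R_def\<close>)
    qed
    show "range g \<union> uminus ` range g \<union> U \<union> uminus ` U \<subseteq> X"
      using g_X uminus_X UR R_X by auto
  qed
  ultimately show "X = range g \<union> uminus ` range g \<union> inv_into U pos ` pos ` U \<union> uminus ` inv_into U pos ` pos ` U"
    by simp
qed

text \<open>For \<open>d \<ge> 3\<close> the square of the sign total is positive, so no point has
  as many positive as negative signs and \<open>U\<close> contains exactly one of each antipodal
  pair.\<close>

lemma card_U:
  assumes "3 \<le> CARD('n)"
  shows "2 * card (pos ` U) = CARD('n) * (CARD('n) - 1)"
proof -
  have UR: "U \<subseteq> R"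
    by (auto simp: U_def)
  have "2\<^sup>2 < \<beta>\<^sup>2"
    using assms by (simp add: beta_sq d_def)
  then have "2 < \<beta>"
    using beta_ge by (metis less_eq_real_def order_less_irrefl)
  have half: "2 * card (pos u) \<noteq> CARD('n)" if "u \<in> R" for u
  proof
    assume "2 * card (pos u) = CARD('n)"
    then have "2 * real (card (pos u)) - d = 0"
      unfolding d_def by linarith
    then show False
      using card_pos_sq[OF that] \<open>2 < \<beta>\<close> kappa_pos by simp
  qed
  have "U \<inter> uminus ` U = {}"
  proof -
    have False if u: "u \<in> U" "- u \<in> U" for u
    proof -
      have "u \<in> R"
        using u UR by blast
      then have "2 * card (pos u) \<le> CARD('n)" "2 * (CARD('n) - card (pos u)) \<le> CARD('n)"
        using u by (simp_all add: U_def pos_uminus card_compl)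
      then show False
        using half[OF \<open>u \<in> R\<close>] by linarith
    qed
    then show ?thesis
      by (metis disjoint_iff imageE)
  qed
  moreover have "R = U \<union> uminus ` U"
  proof
    show "R \<subseteq> U \<union> uminus ` U"
    proof
      fix u assume u: "u \<in> R"
      have "u \<in> U \<or> - u \<in> U"
        using u uminus_R[OF u] card_compl[of "pos u"] by (auto simp: U_def pos_uminus)
      moreover have "u = - (- u)"
        by simp
      ultimately show "u \<in> U \<union> uminus ` U"
        by blast
    qed
    show "U \<union> uminus ` U \<subseteq> R"
      using UR uminus_R by auto
  qed
  moreover have "finite U"
    using UR finite_R finite_subset by blast
  ultimately have "card R = card U + card (uminus ` U)"
    by (metis card_Un_disjoint finite_imageI)
  then show ?thesis
    using inj_on_subset[OF inj_on_pos UR] by (simp add: card_image card_R)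
qed

text \<open>In \<open>U\<close> the positive signs are not in the majority, which decides the root:
  the sign total is \<open>- m\<close>.\<close>

lemma card_block:
  assumes B: "B \<in> pos ` U" and m: "(\<beta> - 2) * \<kappa> = (real m)\<^sup>2"
  shows "2 * card B + m = CARD('n)"
proof -
  obtain u where u: "u \<in> U" "B = pos u"
    using B by auto
  then have "u \<in> R" "2 * card B \<le> CARD('n)"
    by (simp_all add: U_def)
  then have "(d - 2 * real (card B))\<^sup>2 = (real m)\<^sup>2"
    using card_pos_sq[of u] m u(2) by (simp add: power2_commute)
  moreover have le: "2 * real (card B) \<le> d"
    using \<open>2 * card B \<le> CARD('n)\<close> unfolding d_def by linarith
  ultimately have "d - 2 * real (card B) = real m"
    by (subst (asm) power2_eq_iff_nonneg) auto
  then show ?thesis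
    unfolding d_def by linarith
qed

lemma blocks_eq_subsets:
  assumes "card (pos ` U) = CARD('n) choose k" "\<And>B. B \<in> pos ` U \<Longrightarrow> card B = k"
  shows "pos ` U = {B. card B = k}"
proof (rule card_subset_eq)
  show "card (pos ` U) = card {B :: 'n set. card B = k}"
    using n_subsets[of "UNIV :: 'n set" k] assms(1) by simp
qed (use assms(2) in auto)

lemma blocks_2:
  assumes "CARD('n) = 2"
  shows "pos ` U = {B. card B = 1}"
proof -
  have d: "d = 2"
    using assms by (simp add: d_def)
  have "\<beta> = 2"
    using real_sqrt_abs[of 2] by (simp add: \<beta>_def d)
  have c: "card (pos u) = 1" if "u \<in> R" for u
    using card_pos_sq[OF that] by (simp add: \<open>\<beta> = 2\<close> d)
  \<comment> \<open>The sign total is zero, so \<open>U\<close> keeps both points of each antipodal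
    pair.\<close>
  have "U = R"
    using c assms by (auto simp: U_def)
  have "card (pos ` U) = 2"
    using card_image[OF inj_on_pos] card_R assms by (simp add: \<open>U = R\<close>)
  then show ?thesis
    using c assms \<open>U = R\<close> by (intro blocks_eq_subsets) auto
qed

lemma blocks_3:
  assumes "CARD('n) = 3"
  shows "pos ` U = {B. card B = 1}"
proof -
  have d: "d = 3"
    using assms by (simp add: d_def)
  have "\<beta>\<^sup>2 = 5"
    by (simp add: beta_sq d)
  then have "\<kappa> = \<beta> + 2"
    by (simp add: \<kappa>_def)
  \<comment> \<open>\<open>\<beta>\<close> is irrational here, yet
    \<open>(\<beta> - 2) (\<beta> + 2) = 1\<close> still gives an integral total.\<close>
  then have "(\<beta> - 2) * \<kappa> = \<beta>\<^sup>2 - 4"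
    by (simp add: algebra_simps power2_eq_square)
  then have "(\<beta> - 2) * \<kappa> = 1"
    by (simp add: \<open>\<beta>\<^sup>2 = 5\<close>)
  then have "card B = 1" if "B \<in> pos ` U" for B
    using card_block[OF that, of 1] assms by simp
  moreover have "card (pos ` U) = 3"
    using card_U assms by simp
  ultimately show ?thesis
    using assms by (intro blocks_eq_subsets) auto
qed

lemma blocks_7:
  assumes "CARD('n) = 7"
  shows "pos ` U = {B. card B = 2}"
proof -
  have d: "d = 7"
    using assms by (simp add: d_def)
  have "\<beta> = 3"
    using real_sqrt_abs[of 3] by (simp add: \<beta>_def d)
  then have "(\<beta> - 2) * \<kappa> = (real 3)\<^sup>2"
    by (simp add: \<kappa>_def)
  then have "card B = 2" if "B \<in> pos ` U" for B
    using card_block[OF that, of 3] assms by simp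
  moreover have "card (pos ` U) = 21"
    using card_U assms by simp
  ultimately show ?thesis
    using assms by (intro blocks_eq_subsets) (auto simp: choose_two)
qed

text \<open>The sign total is \<open>-9\<close>, so blocks have size seven. The inner product of two
  points with distinct blocks is 1/5 or -1/5 and an affine function of the size of the intersection,
  which is therefore \<open>3\<close> or \<open>1\<close>.\<close>

lemma blocks_23:
  assumes "CARD('n) = 23"
  shows "quasi_symmetric_design 4 23 7 1 3 1 UNIV (pos ` U)"
proof (rule quasi_symmetric_4_23_7_1_of_card[OF assms])
  have d: "d = 23"
    using assms by (simp add: d_def)
  have \<beta>: "\<beta> = 5"
    using real_sqrt_abs[of 5] by (simp add: \<beta>_def d)
  then have \<kappa>: "\<kappa> = 27" and \<alpha>: "\<alpha> = 1 / 5"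
    by (simp_all add: \<kappa>_def \<alpha>_def)
  have "(\<beta> - 2) * \<kappa> = (real 9)\<^sup>2"
    by (simp add: \<beta> \<kappa>)
  then show c: "card B = 7" if "B \<in> pos ` U" for B
    using card_block[OF that, of 9] assms by simp
  show "card (pos ` U) = 253"
    using card_U assms by simp
  fix B C assume B: "B \<in> pos ` U" and C: "C \<in> pos ` U" and "B \<noteq> C"
  then obtain u v where u: "u \<in> U" "B = pos u" and v: "v \<in> U" "C = pos v"
    by auto
  then have uR: "u \<in> R" and vR: "v \<in> R"
    by (simp_all add: U_def)
  have "v \<noteq> u"
    using u v \<open>B \<noteq> C\<close> by auto
  \<comment> \<open>An antipode would have the complementary sign set, of \<open>16\<close>
    points.\<close>
  moreover have "v \<noteq> - u"
  proof
    assume "v = - u"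
    then have "card C = 23 - card B"
      using u v uR assms card_compl by (simp add: pos_uminus)
    then show False
      using c[OF B] c[OF C] by simp
  qed
  then have "v \<bullet> u \<noteq> -1"
    using inner_eq_minus_one_imp[of u v] norm_X R_X uR vR by (auto simp: inner_commute)
  ultimately have "(u \<bullet> v)\<^sup>2 = (1 / 5)\<^sup>2"
    using inner_X[OF R_X[OF uR] R_X[OF vR]] by (auto simp: d inner_commute power2_eq_square)
  then have "u \<bullet> v = 1 / 5 \<or> u \<bullet> v = - (1 / 5)"
    by (simp only: power2_eq_iff)
  \<comment> \<open>The number \<open>-5 = 23 - 4 * 7\<close> comes from the sum of the sign
    products; \<open>3 / 25\<close> is \<open>(9/5)^2\<close>, the product of the two sums of inner
    products with the frame, divided by \<open>\<kappa> = 27\<close>.\<close>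
  moreover have "4 / 5 * (u \<bullet> v) = 1 / 25 * (4 * real (card (B \<inter> C)) - 5) - 3 / 25"
    using equiangular_frame_inner_expansion[OF frame, of u v]
    unfolding inner_R[OF uR] inner_R[OF vR] sum_signs_mult sum_signs coeff_ratio u(2)[symmetric] v(2)[symmetric] c[OF B] c[OF C] assms \<alpha> \<kappa>
    by (simp add: power2_eq_square)
  then have "real (card (B \<inter> C)) = 5 * (u \<bullet> v) + 2"
    by (simp add: field_simps)
  ultimately have "real (card (B \<inter> C)) = 3 \<or> real (card (B \<inter> C)) = 1"
    by auto
  then show "card (B \<inter> C) \<in> {3, 1}"
    by auto
qed

end

section \<open>The standard sets of lines\<close>

lemma sphere_Int_lines:
  fixes H :: "'a::real_normed_vector set"
  assumes N: "N > 0" and H: "\<And>x. x \<in> H \<Longrightarrow> norm x = N"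
  shows "sphere 0 1 \<inter> (\<Union>x\<in>H. span {x}) = (\<lambda>x. (1 / N) *\<^sub>R x) ` H \<union> uminus ` (\<lambda>x. (1 / N) *\<^sub>R x) ` H"
proof -
  have "sphere 0 1 \<inter> span {x} = {(1 / N) *\<^sub>R x, - ((1 / N) *\<^sub>R x)}" if "x \<in> H" for x
  proof -
    have norm: "norm (c *\<^sub>R x) = 1 \<longleftrightarrow> c = 1 / N \<or> c = - (1 / N)" for c
    proof -
      have "norm (c *\<^sub>R x) = 1 \<longleftrightarrow> \<bar>c\<bar> = 1 / N"
        using N H[OF that] by (simp add: eq_divide_eq)
      also have "\<dots> \<longleftrightarrow> c = 1 / N \<or> c = - (1 / N)"
        using N by (auto simp: abs_if)
      finally show ?thesis .
    qed
    have "sphere 0 1 \<inter> span {x} = (\<lambda>c. c *\<^sub>R x) ` {c. norm (c *\<^sub>R x) = 1}"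
      by (auto simp: span_singleton simp del: norm_scaleR)
    also have "{c. norm (c *\<^sub>R x) = 1} = {1 / N, - (1 / N)}"
      unfolding norm by blast
    finally show ?thesis
      by simp
  qed
  then have "(\<Union>x\<in>H. sphere 0 1 \<inter> span {x}) = (\<Union>x\<in>H. {(1 / N) *\<^sub>R x, - ((1 / N) *\<^sub>R x)})"
    by simp
  also have "\<dots> = (\<lambda>x. (1 / N) *\<^sub>R x) ` H \<union> uminus ` (\<lambda>x. (1 / N) *\<^sub>R x) ` H"
    by blast
  finally show ?thesis
    by blast
qed

text \<open>The block and point vectors have this form, a constant plus a multiple of an indicator,
  so their inner products reduce to intersection sizes.\<close>

lemma inner_step_vectors:
  fixes A B :: "'n::finite set" and p q r t :: real
  shows "(\<chi> j. (if j \<in> A then p else 0) + q) \<bullet> (\<chi> j. (if j \<in> B then r else 0) + t) =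
    p * r * real (card (A \<inter> B)) + p * t * real (card A) + q * r * real (card B) + q * t * real CARD('n)"
proof -
  have "(\<chi> j. (if j \<in> A then p else 0) + q) \<bullet> (\<chi> j. (if j \<in> B then r else 0) + t) =
    (\<Sum>j\<in>UNIV. p * r * indicator (A \<inter> B) j + p * t * indicator A j + q * r * indicator B j + q * t)"
    unfolding inner_vec_def by (intro sum.cong refl) (auto simp: indicator_def algebra_simps)
  then show ?thesis
    by (simp add: sum.distrib indicator_def sum.If_cases Int_def flip: sum_distrib_left)
qed

lemma block_vector_eq:
  "block_vector k s1 s2 B = (\<chi> j :: 'n::finite. (if j \<in> B then real CARD('n) else 0) +
     (sqrt ((real k)\<^sup>2 - real CARD('n) * (real s1 + real s2) / 2) - real k))"
  by (simp add: block_vector_def Let_def vec_eq_iff)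

lemma point_vector_eq:
  "point_vector k s1 s2 i = (\<chi> j :: 'n::finite. (if j \<in> {i} then (real s1 - real s2) * real CARD('n) else 0) +
     (- (real s1 - real s2) - sqrt ((real k - real s1) + real CARD('n) * (real s1 - real s2) / 2)))"
  by (simp add: point_vector_def Let_def vec_eq_iff algebra_simps)

text \<open>\<open>N\<close> is the common norm of the block and point vectors, and \<open>r\<close>
  the product of the roots of \<open>D1\<close> and \<open>D2\<close>, rational in both
  applications. The equations with \<open>N\<close> state the norms and inner products, the latter
  being \<plusminus>\<alpha> after scaling to unit length.\<close>

lemma design_vectors_frame:
  fixes \<B> :: "'n::finite set set"
  assumes \<B>: "\<And>B. B \<in> \<B> \<Longrightarrow> card B = k"
    and D1: "(real k)\<^sup>2 - real CARD('n) * (real s1 + real s2) / 2 = D1" "0 \<le> D1"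
    and D2: "(real k - real s1) + real CARD('n) * s / 2 = D2" "0 \<le> D2"
    and s: "s = real s1 - real s2" and r: "D1 * D2 = r\<^sup>2" "0 \<le> r"
    and N: "0 < N" and \<alpha>: "0 < \<alpha>" "\<alpha> < 1"
    and pp: "real CARD('n) * (D2 - s\<^sup>2) = \<alpha> * N\<^sup>2"
    and pp': "(s * real CARD('n))\<^sup>2 + real CARD('n) * (D2 - s\<^sup>2) = N\<^sup>2"
    and bb: "(real CARD('n))\<^sup>2 * real k + real CARD('n) * (D1 - (real k)\<^sup>2) = N\<^sup>2"
    and bp: "real CARD('n) * (s * real CARD('n) - real k * s - r) = \<alpha> * N\<^sup>2"
    and bp': "- real CARD('n) * (real k * s + r) = - \<alpha> * N\<^sup>2"
  defines "g i \<equiv> (1 / N) *\<^sub>R point_vector k s1 s2 i" and "v B \<equiv> (1 / N) *\<^sub>R block_vector k s1 s2 B"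
  shows "equiangular_frame \<alpha> g"
    and "\<And>B i. B \<in> \<B> \<Longrightarrow> v B \<bullet> g i = (if i \<in> B then \<alpha> else - \<alpha>)"
    and "sphere 0 1 \<inter> \<Union>(design_lines k s1 s2 \<B>) = range g \<union> uminus ` range g \<union> v ` \<B> \<union> uminus ` v ` \<B>"
proof -
  let ?d = "real CARD('n)" and ?b = "block_vector k s1 s2 :: 'n set \<Rightarrow> _" and ?p = "point_vector k s1 s2 :: 'n \<Rightarrow> _"
  have b: "?b B = (\<chi> j. (if j \<in> B then ?d else 0) + (sqrt D1 - real k))" for B
    by (simp add: block_vector_eq D1(1))
  have p: "?p i = (\<chi> j. (if j \<in> {i} then s * ?d else 0) + (- s - sqrt D2))" for i
    using D2(1) by (simp add: point_vector_eq s cong: if_cong)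
  have sq: "sqrt D1 * sqrt D2 = r" "(sqrt D1)\<^sup>2 = D1" "(sqrt D2)\<^sup>2 = D2"
    using r D1(2) D2(2) by (simp_all flip: real_sqrt_mult)
  have pp_inner: "?p i \<bullet> ?p j = (if i = j then N\<^sup>2 else \<alpha> * N\<^sup>2)" for i j
  proof -
    have "?p i \<bullet> ?p j = (s * ?d)\<^sup>2 * real (card ({i} \<inter> {j})) + ?d * ((sqrt D2)\<^sup>2 - s\<^sup>2)"
      unfolding p inner_step_vectors by (simp add: algebra_simps power2_eq_square)
    then show ?thesis
      using pp pp' sq by (cases "i = j") simp_all
  qed
  have bp_inner: "?b B \<bullet> ?p i = (if i \<in> B then \<alpha> * N\<^sup>2 else - \<alpha> * N\<^sup>2)" if "B \<in> \<B>" for B i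
  proof -
    have "?b B \<bullet> ?p i = ?d * (s * ?d * real (card (B \<inter> {i})) - real k * s - sqrt D1 * sqrt D2)"
      unfolding p b inner_step_vectors by (simp add: algebra_simps power2_eq_square \<B>[OF that])
    then show ?thesis
      using bp bp' sq by (cases "i \<in> B") (simp_all add: algebra_simps)
  qed
  have bb_inner: "?b B \<bullet> ?b B = N\<^sup>2" if "B \<in> \<B>" for B
  proof -
    have "?b B \<bullet> ?b B = ?d\<^sup>2 * real k + ?d * ((sqrt D1)\<^sup>2 - (real k)\<^sup>2)"
      unfolding b inner_step_vectors by (simp add: algebra_simps power2_eq_square \<B>[OF that])
    then show ?thesis
      using bb sq by simp
  qed
  show "equiangular_frame \<alpha> g"
    using \<alpha> N by (simp add: equiangular_frame_def g_def pp_inner power2_eq_square)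
  show "v B \<bullet> g i = (if i \<in> B then \<alpha> else - \<alpha>)" if "B \<in> \<B>" for B i
    using N by (simp add: g_def v_def bp_inner[OF that] power2_eq_square)
  have "norm x = N" if "x \<in> ?b ` \<B> \<union> range ?p" for x
    using that N bb_inner pp_inner by (auto simp: norm_eq_sqrt_inner)
  then have "sphere 0 1 \<inter> (\<Union>x\<in>?b ` \<B> \<union> range ?p. span {x}) =
      (\<lambda>x. (1 / N) *\<^sub>R x) ` (?b ` \<B> \<union> range ?p) \<union> uminus ` (\<lambda>x. (1 / N) *\<^sub>R x) ` (?b ` \<B> \<union> range ?p)"
    by (rule sphere_Int_lines[OF N])
  then show "sphere 0 1 \<inter> \<Union>(design_lines k s1 s2 \<B>) = range g \<union> uminus ` range g \<union> v ` \<B> \<union> uminus ` v ` \<B>"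
    unfolding design_lines_def g_def v_def by (simp add: image_Un image_image Un_ac)
qed

section \<open>The hexagon and the icosahedron\<close>

lemma (in tight_5_design_frame) isometric_of_singletons:
  assumes U: "pos ` U = {B. card B = 1}" and g': "equiangular_frame \<alpha> g'"
    and f: "\<And>j i. f j \<bullet> g' i = (if i = j then \<alpha> else - \<alpha>)"
    and X': "X' = range g' \<union> uminus ` range g' \<union> range f \<union> uminus ` range f"
  shows "isometric_sets X X'"
proof (rule isometric_sets_of_profiles[OF frame profiles_X g'])
  \<comment> \<open>All blocks are singletons, so a vector per index serves as a vector per
    block.\<close>
  let ?v = "\<lambda>B. f (the_elem B)"
  show "?v B \<bullet> g' i = (if i \<in> B then \<alpha> else - \<alpha>)" if "B \<in> pos ` U" for B i
    using that unfolding U by (auto simp: card_1_singleton_iff f)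
  have sing: "{B. card B = 1} = range (\<lambda>j. {j})"
    by (auto simp: card_1_singleton_iff)
  show "X' = range g' \<union> uminus ` range g' \<union> ?v ` pos ` U \<union> uminus ` ?v ` pos ` U"
    unfolding U sing X' image_image by simp
  show "bij (\<lambda>i. i)" "pos ` U = (\<lambda>B. (\<lambda>i. i) ` B) ` pos ` U"
    by (simp_all add: bij_id[unfolded id_def])
qed

text \<open>With \<open>w\<close> the direction of the vertex next to that of \<open>u\<close>, the
  third pair of opposite vertices has the directions \<open>w - u\<close> and
  \<open>u - w\<close>.\<close>

lemma hexagon_vertices:
  assumes uv: "norm u = 1" "norm v = 1" "u \<bullet> v = 0" and r: "0 < r"
    and H: "H = {r *\<^sub>R (cos (real j * pi / 3) *\<^sub>R u + sin (real j * pi / 3) *\<^sub>R v) | j::nat. j < 6}"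
  defines "w \<equiv> (1 / 2) *\<^sub>R u + (sqrt 3 / 2) *\<^sub>R v"
  shows "sphere 0 1 \<inter> (\<Union>x\<in>H. span {x}) = {u, - u, w, - w, w - u, u - w}"
proof -
  have H': "H = (\<lambda>x. r *\<^sub>R x) ` {u, w, w - u, - u, - w, u - w}"
  proof -
    let ?f = "\<lambda>j. cos (real j * pi / 3) *\<^sub>R u + sin (real j * pi / 3) *\<^sub>R v"
    have trig: "cos (2 * pi / 3) = - 1 / 2" "sin (2 * pi / 3) = sqrt 3 / 2"
      "cos (4 * pi / 3) = - 1 / 2" "sin (4 * pi / 3) = - (sqrt 3 / 2)"
      "cos (5 * pi / 3) = 1 / 2" "sin (5 * pi / 3) = - (sqrt 3 / 2)"
    proof -
      have "2 * pi / 3 = pi - pi / 3" "4 * pi / 3 = pi / 3 + pi" "5 * pi / 3 = - (pi / 3) + 2 * pi"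
        by simp_all
      then show "cos (2 * pi / 3) = - 1 / 2" "sin (2 * pi / 3) = sqrt 3 / 2"
        "cos (4 * pi / 3) = - 1 / 2" "sin (4 * pi / 3) = - (sqrt 3 / 2)"
        "cos (5 * pi / 3) = 1 / 2" "sin (5 * pi / 3) = - (sqrt 3 / 2)"
        by (simp_all only: cos_periodic_pi sin_periodic_pi cos_periodic sin_periodic cos_minus sin_minus
            cos_diff sin_diff cos_pi sin_pi cos_60 sin_60)
    qed
    have f: "?f 0 = u" "?f 1 = w" "?f 2 = w - u" "?f 3 = - u" "?f 4 = - w" "?f 5 = u - w"
      by (simp_all add: w_def trig cos_60 sin_60) (simp_all add: algebra_simps flip: scaleR_left_distrib)
    have "H = (\<lambda>x. r *\<^sub>R x) ` ?f ` {..<6}"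
      unfolding H by auto
    moreover have "{..<6} = {0, 1, 2, 3, 4, 5 :: nat}"
      by auto
    ultimately show ?thesis
      using f by simp
  qed
  have uu: "u \<bullet> u = 1" "v \<bullet> v = 1" "v \<bullet> u = 0"
    using uv by (simp_all add: norm_eq_1 inner_commute)
  have ww: "w \<bullet> w = 1" "w \<bullet> u = 1 / 2" "u \<bullet> w = 1 / 2"
    by (simp_all add: w_def inner_add_left inner_add_right uu uv(3))
  have "norm x = r" if "x \<in> H" for x
    using that r unfolding H'
    by (auto simp: norm_eq_sqrt_inner inner_diff_left inner_diff_right uu ww)
  then have "sphere 0 1 \<inter> (\<Union>x\<in>H. span {x}) = (\<lambda>x. (1 / r) *\<^sub>R x) ` H \<union> uminus ` (\<lambda>x. (1 / r) *\<^sub>R x) ` H"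
    by (rule sphere_Int_lines[OF r])
  then show ?thesis
    unfolding H' image_image using r by auto
qed

lemma (in tight_5_design_frame) isometric_hexagon:
  assumes 2: "CARD('n) = 2" and H: "regular_hexagon H"
  shows "isometric_sets X (sphere 0 1 \<inter> (\<Union>x\<in>H. span {x}))"
proof -
  obtain r u v where uv: "norm u = 1" "norm v = 1" "u \<bullet> v = 0" and r: "0 < r"
    and H: "H = {r *\<^sub>R (cos (real j * pi / 3) *\<^sub>R u + sin (real j * pi / 3) *\<^sub>R v) | j::nat. j < 6}"
    using H unfolding regular_hexagon_def by blast
  define w where "w = (1 / 2) *\<^sub>R u + (sqrt 3 / 2) *\<^sub>R v"
  have X': "sphere 0 1 \<inter> (\<Union>x\<in>H. span {x}) = {u, - u, w, - w, w - u, u - w}"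
    unfolding w_def by (rule hexagon_vertices[OF uv r H])
  have uu: "u \<bullet> u = 1" "v \<bullet> v = 1" "v \<bullet> u = 0"
    using uv by (simp_all add: norm_eq_1 inner_commute)
  have ww: "w \<bullet> w = 1" "w \<bullet> u = 1 / 2" "u \<bullet> w = 1 / 2"
    by (simp_all add: w_def inner_add_left inner_add_right uu uv(3))
  obtain i0 i1 :: 'n where i: "UNIV = {i0, i1}" "i0 \<noteq> i1"
    using 2 by (auto simp: card_2_iff)
  have \<alpha>: "\<alpha> = 1 / 2"
    using 2 real_sqrt_abs[of 2] by (simp add: \<alpha>_def \<beta>_def d_def)
  \<comment> \<open>Adjacent vertices enclose 60 degrees and form the frame; \<open>u - w\<close>
    has product \<open>1/2\<close> with \<open>u\<close> and \<open>-1/2\<close> with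
    \<open>w\<close>.\<close>
  define g' where "g' j = (if j = i0 then u else w)" for j
  define f where "f j = (if j = i0 then u - w else w - u)" for j
  have cases: "j = i0 \<or> j = i1" for j
    using i(1) by (metis UNIV_I insertE singletonD)
  show ?thesis
  proof (rule isometric_of_singletons[OF blocks_2[OF 2]])
    have "g' k \<bullet> g' j = (if k = j then 1 else 1 / 2)" for k j
      using cases[of k] cases[of j] i(2) by (auto simp: g'_def uu ww)
    then show "equiangular_frame \<alpha> g'"
      by (simp add: equiangular_frame_def \<alpha>)
    show "f j \<bullet> g' k = (if k = j then \<alpha> else - \<alpha>)" for j k
      using cases[of k] cases[of j] i(2) by (auto simp: g'_def f_def uu ww \<alpha> inner_diff_left)
    show "sphere 0 1 \<inter> (\<Union>x\<in>H. span {x}) = range g' \<union> uminus ` range g' \<union> range f \<union> uminus ` range f"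
      unfolding X' i(1) using i(2) by (auto simp: g'_def f_def)
  qed
qed

lemma (in tight_5_design_frame) isometric_icosahedron:
  assumes 3: "CARD('n) = 3" and H: "regular_icosahedron H"
  shows "isometric_sets X (sphere 0 1 \<inter> (\<Union>x\<in>H. span {x}))"
proof -
  define \<phi> :: real where "\<phi> = (1 + sqrt 5) / 2"
  obtain r u v w where n: "norm u = 1" "norm v = 1" "norm w = 1"
    and o: "u \<bullet> v = 0" "v \<bullet> w = 0" "w \<bullet> u = 0" and r: "0 < r"
    and H: "H = {r *\<^sub>R (a *\<^sub>R x + (b * \<phi>) *\<^sub>R y) | a b x y.
               a \<in> {1, -1} \<and> b \<in> {1, -1} \<and> (x, y) \<in> {(v, w), (w, u), (u, v)}}"
    using H unfolding regular_icosahedron_def \<phi>_def by blast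
  have ip: "u \<bullet> u = 1" "v \<bullet> v = 1" "w \<bullet> w = 1" "v \<bullet> u = 0" "w \<bullet> v = 0" "u \<bullet> w = 0"
    using n o by (simp_all add: norm_eq_1 inner_commute)
  have \<phi>2: "\<phi> * \<phi> = \<phi> + 1"
    by (simp add: \<phi>_def field_simps)
  have \<phi>_pos: "\<phi> > 0"
    by (simp add: \<phi>_def add_pos_nonneg)
  \<comment> \<open>\<open>M\<close> is the length of the vertices before scaling, as
    \<open>1 + \<phi>^2 = \<phi> + 2\<close>.\<close>
  define M where "M = sqrt (\<phi> + 2)"
  have M: "M > 0" "M * M = \<phi> + 2"
    using \<phi>_pos by (simp_all add: M_def)
  have \<alpha>: "\<alpha> = 1 / sqrt 5"
    using 3 by (simp add: \<alpha>_def \<beta>_def d_def)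
  \<comment> \<open>This is \<open>\<phi> / (\<phi> + 2) = 1 / sqrt 5\<close>, the cosine between
    adjacent vertices.\<close>
  have \<phi>\<alpha>: "\<phi> = \<alpha> * (M * M)"
    unfolding M(2) \<alpha> \<phi>_def by (simp add: field_simps)
  obtain i0 i1 i2 :: 'n where i: "UNIV = {i0, i1, i2}" "i0 \<noteq> i1" "i0 \<noteq> i2" "i1 \<noteq> i2"
    using 3 by (auto simp: card_3_iff)
  have cases: "j = i0 \<or> j = i1 \<or> j = i2" for j
    using i(1) by (metis UNIV_I insertE singletonD)
  define P where "P x y = (1 / M) *\<^sub>R (x + \<phi> *\<^sub>R y)" for x y :: "real^'n"
  define P' where "P' x y = (1 / M) *\<^sub>R (x - \<phi> *\<^sub>R y)" for x y :: "real^'n"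
  \<comment> \<open>The frame consists of three mutually adjacent vertices; \<open>f j\<close> is
    the further vertex at an acute angle to \<open>g' j\<close> and obtuse angles to the other
    two.\<close>
  define g' where "g' j = (if j = i0 then P v w else if j = i1 then P w u else P u v)" for j
  define f where "f j = (if j = i0 then P' w u else if j = i1 then P' u v else P' v w)" for j
  have H': "H = (\<lambda>x. r *\<^sub>R M *\<^sub>R x) ` (range g' \<union> uminus ` range g' \<union> range f \<union> uminus ` range f)"
  proof -
    define Q where "Q x y = r *\<^sub>R (x + \<phi> *\<^sub>R y)" for x y :: "real^'n"
    define Q' where "Q' x y = r *\<^sub>R (x - \<phi> *\<^sub>R y)" for x y :: "real^'n"
    have "{F a b x y | a b x y. a \<in> {1, -1} \<and> b \<in> {1, -1 :: real} \<and> (x, y) \<in> {(v, w), (w, u), (u, v)}} =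
      {F 1 1 v w, F 1 1 w u, F 1 1 u v, F (-1) (-1) v w, F (-1) (-1) w u, F (-1) (-1) u v,
       F 1 (-1) v w, F 1 (-1) w u, F 1 (-1) u v, F (-1) 1 v w, F (-1) 1 w u, F (-1) 1 u v}"
      for F :: "real \<Rightarrow> real \<Rightarrow> real^'n \<Rightarrow> real^'n \<Rightarrow> real^'n"
      by blast
    note set12 = this[of "\<lambda>a b x y. r *\<^sub>R (a *\<^sub>R x + (b * \<phi>) *\<^sub>R y)"]
    have F: "r *\<^sub>R (1 *\<^sub>R x + (1 * \<phi>) *\<^sub>R y) = Q x y" "r *\<^sub>R ((-1) *\<^sub>R x + (-1 * \<phi>) *\<^sub>R y) = - Q x y"
      "r *\<^sub>R (1 *\<^sub>R x + (-1 * \<phi>) *\<^sub>R y) = Q' x y" "r *\<^sub>R ((-1) *\<^sub>R x + (1 * \<phi>) *\<^sub>R y) = - Q' x y"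
      for x y :: "real^'n"
      by (simp_all add: Q_def Q'_def algebra_simps)
    have "H = {Q v w, Q w u, Q u v, - Q v w, - Q w u, - Q u v, Q' v w, Q' w u, Q' u v, - Q' v w, - Q' w u, - Q' u v}"
      unfolding H set12 F ..
    moreover have "range g' = {P v w, P w u, P u v}" "range f = {P' w u, P' u v, P' v w}"
      unfolding i(1) using i(2-) by (auto simp: g'_def f_def)
    moreover have "(r * M) *\<^sub>R P x y = Q x y" "(r * M) *\<^sub>R P' x y = Q' x y" for x y
      using M(1) by (simp_all add: P_def P'_def Q_def Q'_def)
    ultimately show ?thesis
      by (simp add: image_Un) blast
  qed
  have PP: "P v w \<bullet> P v w = 1" "P w u \<bullet> P w u = 1" "P u v \<bullet> P u v = 1"
    "P' v w \<bullet> P' v w = 1" "P' w u \<bullet> P' w u = 1" "P' u v \<bullet> P' u v = 1"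
  proof -
    have "1 / (\<phi> + 2) + (1 + \<phi>) / (\<phi> + 2) = 1"
      using \<phi>_pos by (simp flip: add_divide_distrib)
    then show "P v w \<bullet> P v w = 1" "P w u \<bullet> P w u = 1" "P u v \<bullet> P u v = 1"
      "P' v w \<bullet> P' v w = 1" "P' w u \<bullet> P' w u = 1" "P' u v \<bullet> P' u v = 1"
      using M(1)
      by (simp_all add: P_def P'_def inner_add_left inner_add_right inner_diff_left inner_diff_right ip o \<phi>2 M(2) field_simps)
  qed
  have frame': "g' k \<bullet> g' j = (if k = j then 1 else \<alpha>)" for k j
  proof -
    have "P v w \<bullet> P w u = \<alpha>" "P w u \<bullet> P v w = \<alpha>" "P v w \<bullet> P u v = \<alpha>" "P u v \<bullet> P v w = \<alpha>"
      "P w u \<bullet> P u v = \<alpha>" "P u v \<bullet> P w u = \<alpha>"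
      using M(1) \<phi>\<alpha> by (simp_all add: P_def inner_add_left inner_add_right ip o)
    then show ?thesis
      using cases[of k] cases[of j] i(2-) PP by (auto simp: g'_def)
  qed
  have ff: "f j \<bullet> g' k = (if k = j then \<alpha> else - \<alpha>)" for j k
  proof -
    have "P' w u \<bullet> P v w = \<alpha>" "P' w u \<bullet> P u v = - \<alpha>"
      "P' u v \<bullet> P v w = - \<alpha>" "P' u v \<bullet> P w u = \<alpha>"
      "P' v w \<bullet> P w u = - \<alpha>" "P' v w \<bullet> P u v = \<alpha>"
      using M(1) \<phi>\<alpha>
      by (simp_all add: P_def P'_def inner_add_left inner_add_right inner_diff_left ip o)
    moreover have "P' x y \<bullet> P x y = - \<alpha>" if "x \<bullet> x = 1" "y \<bullet> y = 1" "x \<bullet> y = 0" for x y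
    proof -
      have "P' x y \<bullet> P x y = (1 - \<phi> * \<phi>) / (M * M)"
        using M(1) that
        by (simp add: P_def P'_def inner_add_right inner_diff_left inner_commute[of y x] field_simps)
      also have "\<dots> = - (\<phi> / (M * M))"
        by (simp add: \<phi>2)
      also have "\<phi> / (M * M) = \<alpha>"
        using M(1) by (subst \<phi>\<alpha>) simp
      finally show ?thesis .
    qed
    then have "P' w u \<bullet> P w u = - \<alpha>" "P' u v \<bullet> P u v = - \<alpha>" "P' v w \<bullet> P v w = - \<alpha>"
      by (simp_all add: ip o)
    ultimately show ?thesis
      using cases[of k] cases[of j] i(2-) by (auto simp: g'_def f_def)
  qed
  have "f j \<bullet> f j = 1" "g' j \<bullet> g' j = 1" for j
    using cases[of j] i(2-) PP by (auto simp: f_def g'_def)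
  then have "norm x = r * M" if "x \<in> H" for x
    using that r M(1) unfolding H' by (auto simp: norm_eq_sqrt_inner)
  then have "sphere 0 1 \<inter> (\<Union>x\<in>H. span {x}) =
      (\<lambda>x. (1 / (r * M)) *\<^sub>R x) ` H \<union> uminus ` (\<lambda>x. (1 / (r * M)) *\<^sub>R x) ` H"
    by (intro sphere_Int_lines mult_pos_pos r M(1))
  then have X': "sphere 0 1 \<inter> (\<Union>x\<in>H. span {x}) = range g' \<union> uminus ` range g' \<union> range f \<union> uminus ` range f"
    unfolding H' image_image image_Un using r M(1) by auto
  show ?thesis
    using frame' alpha_pos frame
    by (intro isometric_of_singletons[OF blocks_3[OF 3] _ ff X']) (simp add: equiangular_frame_def)
qed

section \<open>The line sets in dimensions 7 and 23\<close>

lemma (in tight_5_design_frame) isometric_design_7: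
  assumes 7: "CARD('n) = 7"
  shows "isometric_sets X (sphere 0 1 \<inter> \<Union>(design_lines 2 1 0 {B :: 'n set. card B = 2}))"
proof -
  have \<alpha>: "\<alpha> = 1 / 3"
    using 7 real_sqrt_abs[of 3] by (simp add: \<alpha>_def \<beta>_def d_def)
  \<comment> \<open>Here \<open>D1 = 4 - 7/2\<close>, \<open>D2 = 1 + 7/2\<close>, and the squared
    norm is \<open>147/2\<close>.\<close>
  note * = design_vectors_frame[of "{B :: 'n set. card B = 2}" 2 1 0 "1 / 2" 1 "9 / 2" "3 / 2" "sqrt (147 / 2)" \<alpha>]
  show ?thesis
    by (rule isometric_sets_of_profiles[OF frame profiles_X *(1) *(2) *(3), of "\<lambda>i. i"])
      (simp_all add: 7 \<alpha> blocks_7 power2_eq_square bij_id[unfolded id_def])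
qed

lemma (in tight_5_design_frame) isometric_design_23:
  fixes \<B> :: "'n set set"
  assumes 23: "CARD('n) = 23" and \<B>: "quasi_symmetric_design 4 23 7 1 3 1 UNIV \<B>"
  shows "isometric_sets X (sphere 0 1 \<inter> \<Union>(design_lines 7 3 1 \<B>))"
proof -
  \<comment> \<open>Whichever Steiner system realizes the standard set, it is isomorphic to the one
    read off from \<open>X\<close>.\<close>
  obtain \<pi> where \<pi>: "bij \<pi>" "\<B> = (\<lambda>B. \<pi> ` B) ` pos ` U"
    using quasi_symmetric_4_23_7_1_unique[OF blocks_23[OF 23] \<B>] .
  have \<alpha>: "\<alpha> = 1 / 5"
    using 23 real_sqrt_abs[of 5] by (simp add: \<alpha>_def \<beta>_def d_def)
  have "card B = 7" if "B \<in> \<B>" for B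
    using \<B> that by (simp add: quasi_symmetric_design_def)
  \<comment> \<open>Here \<open>D1 = 49 - 46\<close>, \<open>D2 = 4 + 23\<close>, and the squared
    norm is \<open>46^2 + 23 * 23 = 2645\<close>.\<close>
  note * = design_vectors_frame[of \<B> 7 3 1 3 2 27 9 "sqrt 2645" \<alpha>, OF this]
  show ?thesis
    by (rule isometric_sets_of_profiles[OF frame profiles_X *(1) *(2) *(3) \<pi>])
      (simp_all add: 23 \<alpha> power2_eq_square)
qed

section \<open>Existence of realizations and conclusion\<close>

lemma ex_regular_hexagon:
  assumes "CARD('n::finite) = 2"
  shows "\<exists>H :: (real^'n) set. regular_hexagon H"
proof -
  obtain i j :: 'n where ij: "i \<noteq> j"
    using assms by (auto simp: card_2_iff)
  define H where "H = {1 *\<^sub>R (cos (real k * pi / 3) *\<^sub>R axis i 1 + sin (real k * pi / 3) *\<^sub>R axis j 1 :: real^'n) | k::nat. k < 6}"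
  have "norm (axis i 1 :: real^'n) = 1" "norm (axis j 1 :: real^'n) = 1" "axis i 1 \<bullet> (axis j 1 :: real^'n) = 0"
    using ij by (simp_all add: norm_axis_1 inner_axis_axis)
  then have "0 < (1::real) \<and> norm (axis i 1 :: real^'n) = 1 \<and> norm (axis j 1 :: real^'n) = 1 \<and>
      axis i 1 \<bullet> (axis j 1 :: real^'n) = 0 \<and>
      H = {1 *\<^sub>R (cos (real k * pi / 3) *\<^sub>R axis i 1 + sin (real k * pi / 3) *\<^sub>R axis j 1) | k::nat. k < 6}"
    unfolding H_def by (intro conjI refl zero_less_one)
  then have "regular_hexagon H"
    unfolding regular_hexagon_def by (intro exI)
  then show ?thesis ..
qed

lemma ex_regular_icosahedron:
  assumes "CARD('n::finite) = 3"
  shows "\<exists>H :: (real^'n) set. regular_icosahedron H"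
proof -
  obtain i j k :: 'n where ijk: "i \<noteq> j" "i \<noteq> k" "j \<noteq> k"
    using assms by (auto simp: card_3_iff)
  let ?u = "axis i 1 :: real^'n" and ?v = "axis j 1 :: real^'n" and ?w = "axis k 1 :: real^'n"
  define H where "H = {1 *\<^sub>R (a *\<^sub>R x + (b * ((1 + sqrt 5) / 2)) *\<^sub>R y) | a b x y.
      a \<in> {1, -1} \<and> b \<in> {1, -1} \<and> (x, y) \<in> {(?v, ?w), (?w, ?u), (?u, ?v)}}"
  have "norm ?u = 1" "norm ?v = 1" "norm ?w = 1" "?u \<bullet> ?v = 0" "?v \<bullet> ?w = 0" "?w \<bullet> ?u = 0"
    using ijk by (simp_all add: norm_axis_1 inner_axis_axis)
  then have "0 < (1::real) \<and> norm ?u = 1 \<and> norm ?v = 1 \<and> norm ?w = 1 \<and>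
      ?u \<bullet> ?v = 0 \<and> ?v \<bullet> ?w = 0 \<and> ?w \<bullet> ?u = 0 \<and>
      H = {1 *\<^sub>R (a *\<^sub>R x + (b * ((1 + sqrt 5) / 2)) *\<^sub>R y) | a b x y.
        a \<in> {1, -1} \<and> b \<in> {1, -1} \<and> (x, y) \<in> {(?v, ?w), (?w, ?u), (?u, ?v)}}"
    unfolding H_def by (intro conjI refl zero_less_one)
  then have "regular_icosahedron H"
    unfolding regular_icosahedron_def by (intro exI)
  then show ?thesis ..
qed

context tight_5_design_frame
begin

text \<open>This keeps the claim about all realizations from being vacuous. For
  \<open>d = 23\<close> the Steiner system is supplied by \<open>X\<close> itself.\<close>

lemma ex_standard_line_set: "\<exists>\<Omega> :: (real^'n) set set. standard_line_set \<Omega>"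
proof -
  consider "CARD('n) = 2" | "CARD('n) = 3" | "CARD('n) = 7" | "CARD('n) = 23"
    using dimension by blast
  then show ?thesis
  proof cases
    case 1
    then obtain H :: "(real^'n) set" where "regular_hexagon H"
      using ex_regular_hexagon by blast
    with 1 have "standard_line_set ((\<lambda>x. span {x}) ` H)"
      unfolding standard_line_set_def by metis
    then show ?thesis ..
  next
    case 2
    then obtain H :: "(real^'n) set" where "regular_icosahedron H"
      using ex_regular_icosahedron by blast
    with 2 have "standard_line_set ((\<lambda>x. span {x}) ` H)"
      unfolding standard_line_set_def by metis
    then show ?thesis ..
  next
    case 3
    then have "standard_line_set (design_lines 2 1 0 {B :: 'n set. card B = 2})"
      unfolding standard_line_set_def by simp
    then show ?thesis ..
  next
    case 4
    then have "standard_line_set (design_lines 7 3 1 (pos ` U))"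
      unfolding standard_line_set_def using blocks_23[OF 4] by metis
    then show ?thesis ..
  qed
qed

lemma isometric_standard_line_set:
  fixes \<Omega> :: "(real^'n) set set"
  assumes "standard_line_set \<Omega>"
  shows "isometric_sets X (sphere 0 1 \<inter> \<Union>\<Omega>)"
proof -
  consider H where "CARD('n) = 2" "regular_hexagon H" "\<Omega> = (\<lambda>x. span {x}) ` H"
    | H where "CARD('n) = 3" "regular_icosahedron H" "\<Omega> = (\<lambda>x. span {x}) ` H"
    | "CARD('n) = 7" "\<Omega> = design_lines 2 1 0 {B. card B = 2}"
    | \<B> where "CARD('n) = 23" "quasi_symmetric_design 4 23 7 1 3 1 UNIV \<B>" "\<Omega> = design_lines 7 3 1 \<B>"
    using assms unfolding standard_line_set_def by blast
  then show ?thesis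
  proof cases
    case 1
    then show ?thesis
      using isometric_hexagon by simp
  next
    case 2
    then show ?thesis
      using isometric_icosahedron by simp
  next
    case 3
    then show ?thesis
      using isometric_design_7 by simp
  next
    case 4
    then show ?thesis
      using isometric_design_23 by simp
  qed
qed

end

theorem theorem1p2:
  fixes X \<Gamma> :: "(real^'n) set"
  assumes "CARD('n) \<ge> 2"
    and "tight_spherical_design 5 X"
    and "\<Gamma> \<subseteq> X" and "card \<Gamma> = CARD('n)"
    and "\<forall>x\<in>\<Gamma>. \<forall>y\<in>\<Gamma>. x \<noteq> y \<longrightarrow> x \<bullet> y > 0"
  shows "CARD('n) \<in> {2, 3, 7, 23} \<and>
    (\<exists>\<Omega> :: (real^'n) set set. standard_line_set \<Omega>) \<and>
    (\<forall>\<Omega> :: (real^'n) set set. standard_line_set \<Omega> \<longrightarrow> isometric_sets X (sphere 0 1 \<inter> \<Union>\<Omega>))"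
proof -
  have X: "spherical_design 5 X" "card X = CARD('n) * (CARD('n) + 1)"
    using assms(2) by (simp_all add: tight_spherical_5_design_iff)
  then have "finite \<Gamma>"
    using assms(3) finite_subset by (auto simp: spherical_design_def)
  \<comment> \<open>\<Gamma> is indexed by the coordinate type, as the frame requires.\<close>
  then obtain g :: "'n \<Rightarrow> real^'n" where g: "bij_betw g UNIV \<Gamma>"
    using finite_same_card_bij[of "UNIV :: 'n set" \<Gamma>] assms(4) by auto
  interpret tight_5_design_frame X g
  proof
    show "g i \<in> X" for i
      using g assms(3) by (auto simp: bij_betw_def)
    show "inj g"
      using g by (simp add: bij_betw_def)
    show "0 < g i \<bullet> g j" if "i \<noteq> j" for i j
      using g that assms(5) by (auto simp: bij_betw_def inj_eq)
  qed (use X assms(1) in auto)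
  show ?thesis
    using dimension ex_standard_line_set isometric_standard_line_set by blast
qed

end
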